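(* Let $A\in\mathcal{M}(\lambda,\Lambda)$ for some $\lambda,\Lambda>0$ and suppose that $A$ satisfies the Cordes condition with constant $\delta\in(0,1]$. Let $\gamma:=\frac{\mathrm{tr}(A)}{|A|^2}\in L^\infty_{\mathrm{per}}(Y)$, $\tilde A:=\gamma A$, $C_\delta:=(1-\sqrt{1-\delta})^{-1}$, and $b_0(\varphi_1,\varphi_2):=(\gamma A:D^2\varphi_1,\Delta\varphi_2)_{L^2(Y)}$ for $\varphi_1,\varphi_2\in H^2_{\mathrm{per}}(Y)$. Then: (i) There exists a unique $\psi\in H^2_{\mathrm{per},0}(Y)$ such that $b_0(\varphi,\psi)=\int_Y\tilde A:D^2\varphi$ for any $\varphi\in H^2_{\mathrm{per},0}(Y)$, and we have the bound $\|\Delta\psi\|_{L^2(Y)}\le\sqrt{n}\,\frac{\Lambda}{\lambda}C_\delta$. (ii) The function $\tilde r:=1-\Delta\psi\in L^2_{\mathrm{per}}(Y)$ is the unique invariant measure to $\tilde A$, and $\tilde r\ge0$ almost everywhere. (iii) The function $r:=(\gamma,\tilde r)_{L^2(Y)}^{-1}\gamma\tilde r\in L^2_{\mathrm{per}}(Y)$ is the unique invariant measure to $A$, and $r\ge0$ almost everywhere. Further, we have the bound $$\|r\|_{L^2(Y)}\le\frac{\Lambda^3}{\lambda^3}\|\tilde r\|_{L^2(Y)}\le\frac{\Lambda^3}{\lambda^3}\left(\sqrt{n}\,\frac{\Lambda}{\lambda}C_\delta+1\right).$$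
   Context: $Y:=(0,1)^n$; "$Y$-periodic" means $\mathbb{Z}^n$-periodic. For $\lambda,\Lambda>0$, $\mathcal{M}(\lambda,\Lambda)$ denotes the set of all $Y$-periodic $A\in L^\infty(\mathbb{R}^n;\mathbb{R}^{n\times n}_{\mathrm{sym}})$ such that $\lambda|\xi|^2\le A\xi\cdot\xi\le\Lambda|\xi|^2$ a.e. in $\mathbb{R}^n$ for all $\xi\in\mathbb{R}^n\setminus\{0\}$. For matrices, $P:Q:=\sum_{i,j}p_{ij}q_{ij}$ and $|P|:=\sqrt{P:P}$. $A$ satisfies the Cordes condition with constant $\delta\in(0,1]$ if $\frac{|A|^2}{(\mathrm{tr}(A))^2}\le\frac{1}{n-1+\delta}$ a.e. in $\mathbb{R}^n$. $L^2_{\mathrm{per}}(Y)$, $L^\infty_{\mathrm{per}}(Y)$, $H^k_{\mathrm{per}}(Y)$ are the usual spaces of $Y$-periodic functions, and $H^k_{\mathrm{per},0}(Y):=\{\varphi\in H^k_{\mathrm{per}}(Y):\int_Y\varphi=0\}$. If $A\in\mathcal{M}(\lambda',\Lambda')$ for some $\lambda',\Lambda'>0$, a function $r\in L^2_{\mathrm{per}}(Y)$ is called an invariant measure to $A$ if $\int_Yr=1$ and $(r,-A:D^2\varphi)_{L^2(Y)}=0$ for all $\varphi\in H^2_{\mathrm{per}}(Y)$. (Under the hypotheses, $\tilde A\in\mathcal{M}(\frac{\lambda^2}{\Lambda^2},\frac{\Lambda^2}{\lambda^2})$.) *)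

theory Defs
  imports "HOL-Analysis.Analysis"
begin

text \<open>
  Elements of the function spaces below are represented by functions on the whole of
  \<open>\<real>\<^sup>n\<close>, modulo equality almost everywhere. All notions concerning them, including
  periodicity and uniqueness, are therefore understood up to Lebesgue null sets.
  For matrices, the Frobenius product \<open>P : Q\<close> and the norm \<open>|P|\<close> are the library's inner
  product and norm on \<open>real^'n^'n\<close>.
\<close>

definition unit_cell :: "(real^'n) set" where
  "unit_cell = {x. \<forall>i. 0 < x $ i \<and> x $ i < 1}"

definition ae_periodic :: "(real^'n \<Rightarrow> 'b) \<Rightarrow> bool" where
  "ae_periodic f \<longleftrightarrow>
     (\<forall>k. (\<forall>i. k $ i \<in> \<int>) \<longrightarrow> (AE x in lebesgue. f (x + k) = f x))"

definition unique_ae :: "((real^'n \<Rightarrow> real) \<Rightarrow> bool) \<Rightarrow> (real^'n \<Rightarrow> real) \<Rightarrow> bool" where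
  "unique_ae P f \<longleftrightarrow> P f \<and> (\<forall>g. P g \<longrightarrow> (AE x in lebesgue. g x = f x))"

definition cell_integral :: "(real^'n \<Rightarrow> real) \<Rightarrow> real" where
  "cell_integral f = (LINT x:unit_cell|lebesgue. f x)"

definition Linf_per :: "(real^'n \<Rightarrow> 'b::euclidean_space) set" where
  "Linf_per = {f \<in> borel_measurable lebesgue. ae_periodic f \<and>
     (\<exists>C. AE x in lebesgue. norm (f x) \<le> C)}"

definition L2_per :: "(real^'n \<Rightarrow> real) set" where
  "L2_per = {f \<in> borel_measurable lebesgue. ae_periodic f \<and>
     set_integrable lebesgue unit_cell (\<lambda>x. (f x)\<^sup>2)}"

definition L2_inner :: "(real^'n \<Rightarrow> real) \<Rightarrow> (real^'n \<Rightarrow> real) \<Rightarrow> real" where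
  "L2_inner f g = cell_integral (\<lambda>x. f x * g x)"

definition L2_norm :: "(real^'n \<Rightarrow> real) \<Rightarrow> real" where
  "L2_norm f = sqrt (L2_inner f f)"

definition partial_deriv :: "'n \<Rightarrow> (real^'n \<Rightarrow> real) \<Rightarrow> real^'n \<Rightarrow> real" where
  "partial_deriv i f x = frechet_derivative f (at x) (axis i 1)"

primrec iter_partial :: "'n list \<Rightarrow> (real^'n \<Rightarrow> real) \<Rightarrow> real^'n \<Rightarrow> real" where
  "iter_partial [] f = f"
| "iter_partial (i # is) f = partial_deriv i (iter_partial is f)"

text \<open>
  A function is smooth iff all its iterated partial derivatives exist and are
  (totally) differentiable everywhere.
\<close>

definition smooth_per :: "(real^'n \<Rightarrow> real) set" where
  "smooth_per = {\<phi>. (\<forall>is x. iter_partial is \<phi> differentiable (at x)) \<and>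
     (\<forall>x k. (\<forall>i. k $ i \<in> \<int>) \<longrightarrow> \<phi> (x + k) = \<phi> x)}"

text \<open>
  Weak derivatives of periodic functions, tested against smooth periodic functions on the
  cell. The derivative \<open>\<partial>\<^sub>i\<^sub>1 \<dots> \<partial>\<^sub>i\<^sub>m\<close> is indexed by the list of its directions.
\<close>

definition has_weak_deriv ::
  "'n list \<Rightarrow> (real^'n \<Rightarrow> real) \<Rightarrow> (real^'n \<Rightarrow> real) \<Rightarrow> bool" where
  "has_weak_deriv is f g \<longleftrightarrow>
     (\<forall>\<phi>\<in>smooth_per. L2_inner f (iter_partial is \<phi>) = (-1) ^ length is * L2_inner g \<phi>)"

text \<open>
  The weak derivative is determined only up to a null set; an arbitrary representative
  is chosen.
\<close>

definition weak_deriv :: "'n list \<Rightarrow> (real^'n \<Rightarrow> real) \<Rightarrow> real^'n \<Rightarrow> real" where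
  "weak_deriv is f = (SOME g. g \<in> L2_per \<and> has_weak_deriv is f g)"

definition H_per :: "nat \<Rightarrow> (real^'n \<Rightarrow> real) set" where
  "H_per k = {f \<in> L2_per. \<forall>is. length is \<le> k \<longrightarrow> (\<exists>g\<in>L2_per. has_weak_deriv is f g)}"

definition H_per0 :: "nat \<Rightarrow> (real^'n \<Rightarrow> real) set" where
  "H_per0 k = {f \<in> H_per k. cell_integral f = 0}"

definition hessian :: "(real^'n \<Rightarrow> real) \<Rightarrow> real^'n \<Rightarrow> real^'n^'n" where
  "hessian f x = (\<chi> i j. weak_deriv [i, j] f x)"

definition laplacian :: "(real^'n \<Rightarrow> real) \<Rightarrow> real^'n \<Rightarrow> real" where
  "laplacian f x = (\<Sum>i\<in>UNIV. weak_deriv [i, i] f x)"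

definition elliptic :: "real \<Rightarrow> real \<Rightarrow> (real^'n \<Rightarrow> real^'n^'n) set" where
  "elliptic l L = {A \<in> Linf_per.
     (AE x in lebesgue. transpose (A x) = A x) \<and>
     (AE x in lebesgue. \<forall>\<xi>. \<xi> \<noteq> 0 \<longrightarrow>
        l * (norm \<xi>)\<^sup>2 \<le> (A x *v \<xi>) \<bullet> \<xi> \<and> (A x *v \<xi>) \<bullet> \<xi> \<le> L * (norm \<xi>)\<^sup>2)}"

definition cordes :: "real \<Rightarrow> (real^'n \<Rightarrow> real^'n^'n) \<Rightarrow> bool" where
  "cordes \<delta> A \<longleftrightarrow>
     (AE x in lebesgue. (norm (A x))\<^sup>2 / (trace (A x))\<^sup>2 \<le> 1 / (real CARD('n) - 1 + \<delta>))"

definition invariant_measure :: "(real^'n \<Rightarrow> real^'n^'n) \<Rightarrow> (real^'n \<Rightarrow> real) \<Rightarrow> bool" where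
  "invariant_measure A r \<longleftrightarrow>
     (\<exists>l>0. \<exists>L>0. A \<in> elliptic l L) \<and> r \<in> L2_per \<and> cell_integral r = 1 \<and>
     (\<forall>\<phi>\<in>H_per 2. L2_inner r (\<lambda>x. (- A x) \<bullet> hessian \<phi> x) = 0)"

definition cordes_gamma :: "(real^'n \<Rightarrow> real^'n^'n) \<Rightarrow> real^'n \<Rightarrow> real" where
  "cordes_gamma A x = trace (A x) / (norm (A x))\<^sup>2"

definition cordes_form ::
  "(real^'n \<Rightarrow> real^'n^'n) \<Rightarrow> (real^'n \<Rightarrow> real) \<Rightarrow> (real^'n \<Rightarrow> real) \<Rightarrow> real" where
  "cordes_form A \<phi>\<^sub>1 \<phi>\<^sub>2 =
     L2_inner (\<lambda>x. (cordes_gamma A x *\<^sub>R A x) \<bullet> hessian \<phi>\<^sub>1 x) (laplacian \<phi>\<^sub>2)"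

end

theory Submission
  imports Defs
begin

text \<open>
  The Cordes condition says that \<open>B = \<gamma> A\<close> satisfies \<open>|I - B| \<le> \<theta> = \<surd>(1 - \<delta>) < 1\<close> pointwise, while
  Fourier analysis on the torus gives \<open>\<parallel>D\<^sup>2 u\<parallel> = \<parallel>\<Delta> u\<parallel>\<close> in \<open>L\<^sup>2\<close> and the solvability of \<open>\<Delta> u = g\<close> in \<open>H\<^sup>2\<close> for \<open>g\<close>
  of mean zero. A function \<open>w\<close> of mean one is orthogonal to all \<open>B : D\<^sup>2 \<phi>\<close> iff
  \<open>w = 1 + \<Sum>\<^sub>i\<^sub>j R\<^sub>i\<^sub>j ((I - B)\<^sub>i\<^sub>j w)\<close> with the operators \<open>R\<^sub>i\<^sub>j = \<partial>\<^sub>i \<partial>\<^sub>j \<Delta>\<^sup>-\<^sup>1\<close>, and the right-hand side is a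
  \<open>\<theta>\<close>-contraction; this gives existence and uniqueness of the invariant measure \<open>w\<close>, and \<open>\<psi>\<close> is
  recovered from \<open>\<Delta> \<psi> = 1 - w\<close>.

  For the sign of \<open>w\<close>, approximate \<open>B\<close> almost everywhere by trigonometric polynomials \<open>Q\<close> with
  \<open>|I - Q| \<le> \<theta>\<close>. The Neumann series then solves \<open>f = c + Q : D\<^sup>2 \<phi>\<close> up to a uniformly small error with
  trigonometric polynomials \<open>\<phi>\<close>, for every trigonometric polynomial \<open>f\<close>. If \<open>f \<ge> 0\<close>, evaluation at a
  maximum of \<open>\<phi>\<close> shows that \<open>c\<close> is nonnegative up to that error. Since \<open>\<integral> w f\<close> differs from \<open>c\<close> by
  \<open>\<integral> w (Q - B) : D\<^sup>2 \<phi>\<close> and the error, it follows that \<open>\<integral> w f \<ge> 0\<close>, whence \<open>w \<ge> 0\<close>.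

  The invariant measures to \<open>A\<close> are those to \<open>B\<close> multiplied by \<open>\<gamma>\<close> and normalized.
\<close>

section \<open>Square-integrable functions\<close>


text \<open>The factor gamma is the scalar g that minimizes |I - g A|, and the Cordes condition
  bounds the minimum by theta = sqrt (1 - delta); hence C_delta = 1 / (1 - theta). No dimensional
  constant is lost between matrices and operators, because the symbol k k^T / |k|^2 of D^2
  Laplace^-1 has Frobenius norm at most 1. The obstacle is the sign. The contraction lives in L2,
  where no maximum principle is at hand: B is only measurable, and solutions of B : D^2 phi = f are
  only in H^2. With trigonometric Q every partial Neumann sum is a trigonometric polynomial, so
  derivatives at a maximum make sense, and |I - Q| \<le> 1 is all the maximum principle asks for.
  The remaining point is that the L2 norm of D^2 phi is at most that of f divided by 1 - theta,
  whatever Q is. Hence the term with Q - B vanishes in the limit although Q converges to B only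
  almost everywhere.\<close>

definition square_integrable :: "'a measure \<Rightarrow> ('a \<Rightarrow> real) \<Rightarrow> bool" where
  "square_integrable M f \<longleftrightarrow> f \<in> borel_measurable M \<and> integrable M (\<lambda>x. (f x)\<^sup>2)"

definition inner_on :: "'a measure \<Rightarrow> ('a \<Rightarrow> real) \<Rightarrow> ('a \<Rightarrow> real) \<Rightarrow> real" where
  "inner_on M f g = (\<integral>x. f x * g x \<partial>M)"

definition norm_on :: "'a measure \<Rightarrow> ('a \<Rightarrow> real) \<Rightarrow> real" where
  "norm_on M f = sqrt (\<integral>x. (f x)\<^sup>2 \<partial>M)"

lemma square_integrable_measurable [measurable_dest]:
  "square_integrable M f \<Longrightarrow> f \<in> borel_measurable M"
  by (simp add: square_integrable_def)

lemma square_integrableD: "square_integrable M f \<Longrightarrow> integrable M (\<lambda>x. (f x)\<^sup>2)"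
  by (simp add: square_integrable_def)

lemma abs_mult_le_sum_squares: "\<bar>a * b\<bar> \<le> a\<^sup>2 + (b::real)\<^sup>2"
proof -
  have "0 \<le> (\<bar>a\<bar> - \<bar>b\<bar>)\<^sup>2" by simp
  then have "2 * \<bar>a * b\<bar> \<le> a\<^sup>2 + b\<^sup>2" by (simp add: power2_diff abs_mult)
  then show ?thesis by linarith
qed

lemma square_integrable_mult:
  assumes "square_integrable M f" "square_integrable M g"
  shows "integrable M (\<lambda>x. f x * g x)"
proof (rule Bochner_Integration.integrable_bound)
  show "integrable M (\<lambda>x. (f x)\<^sup>2 + (g x)\<^sup>2)"
    using assms by (simp add: square_integrable_def)
  show "(\<lambda>x. f x * g x) \<in> borel_measurable M"
    using assms by measurable
  show "AE x in M. norm (f x * g x) \<le> norm ((f x)\<^sup>2 + (g x)\<^sup>2)"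
    using abs_mult_le_sum_squares by (intro AE_I2) (simp add: abs_of_nonneg)
qed

lemma square_integrable_add:
  assumes "square_integrable M f" "square_integrable M g"
  shows "square_integrable M (\<lambda>x. f x + g x)"
proof -
  have "integrable M (\<lambda>x. (f x)\<^sup>2 + (g x)\<^sup>2 + 2 * (f x * g x))"
    using square_integrable_mult[OF assms] assms
    by (auto simp: square_integrable_def)
  moreover have "(\<lambda>x. f x + g x) \<in> borel_measurable M"
    using assms by measurable
  ultimately show ?thesis
    by (simp add: square_integrable_def power2_sum mult_ac)
qed

lemma square_integrable_cmult:
  assumes "square_integrable M f" shows "square_integrable M (\<lambda>x. c * f x)"
  using assms by (auto simp: square_integrable_def power_mult_distrib)

lemma square_integrable_diff:
  assumes "square_integrable M f" "square_integrable M g"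
  shows "square_integrable M (\<lambda>x. f x - g x)"
  using square_integrable_add[OF assms(1) square_integrable_cmult[OF assms(2), of "-1"]] by simp

lemma square_integrable_zero [simp]: "square_integrable M (\<lambda>x. 0)"
  by (simp add: square_integrable_def)

lemma square_integrable_sum:
  "(\<And>i. i \<in> I \<Longrightarrow> square_integrable M (f i)) \<Longrightarrow> square_integrable M (\<lambda>x. \<Sum>i\<in>I. f i x)"
  by (induction I rule: infinite_finite_induct) (auto intro: square_integrable_add)

lemma square_integrable_bounded_mult:
  assumes f: "square_integrable M f" and [measurable]: "g \<in> borel_measurable M"
    and b: "AE x in M. \<bar>g x\<bar> \<le> C"
  shows "square_integrable M (\<lambda>x. g x * f x)"
  unfolding square_integrable_def
proof
  have [measurable]: "f \<in> borel_measurable M" using f by measurable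
  show "(\<lambda>x. g x * f x) \<in> borel_measurable M" by measurable
  show "integrable M (\<lambda>x. (g x * f x)\<^sup>2)"
  proof (rule Bochner_Integration.integrable_bound)
    show "integrable M (\<lambda>x. C\<^sup>2 * (f x)\<^sup>2)" using f by (simp add: square_integrable_def)
    show "AE x in M. norm ((g x * f x)\<^sup>2) \<le> norm (C\<^sup>2 * (f x)\<^sup>2)"
      using b
    proof eventually_elim
      case (elim x)
      then have "(g x)\<^sup>2 \<le> C\<^sup>2" by (metis abs_ge_zero power2_abs power_mono)
      then show ?case by (simp add: power_mult_distrib mult_right_mono)
    qed
  qed measurable
qed

lemma (in finite_measure) square_integrable_bounded:
  assumes [measurable]: "f \<in> borel_measurable M" and b: "AE x in M. \<bar>f x\<bar> \<le> C"
  shows "square_integrable M f"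
  using square_integrable_bounded_mult[of M "\<lambda>x. 1" f C] assms
  by (simp add: square_integrable_def)

lemma (in finite_measure) square_integrable_integrable:
  "square_integrable M f \<Longrightarrow> integrable M f"
  using square_integrable_imp_integrable by (auto simp: square_integrable_def)

lemma norm_on_nonneg [simp]: "0 \<le> norm_on M f"
  by (simp add: norm_on_def)

lemma norm_on_square: "(norm_on M f)\<^sup>2 = inner_on M f f"
  by (simp add: norm_on_def inner_on_def power2_eq_square)

lemma inner_on_add:
  assumes "square_integrable M f" "square_integrable M g" "square_integrable M h"
  shows "inner_on M (\<lambda>x. f x + g x) h = inner_on M f h + inner_on M g h"
  using assms by (simp add: inner_on_def distrib_right square_integrable_mult)

lemma inner_on_diff:
  assumes "square_integrable M f" "square_integrable M g" "square_integrable M h"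
  shows "inner_on M (\<lambda>x. f x - g x) h = inner_on M f h - inner_on M g h"
  using assms by (simp add: inner_on_def left_diff_distrib square_integrable_mult)

lemma inner_on_commute: "inner_on M f g = inner_on M g f"
  by (simp add: inner_on_def mult.commute)

lemma inner_on_cmult: "inner_on M (\<lambda>x. c * f x) g = c * inner_on M f g"
  by (simp add: inner_on_def mult.assoc)

lemma inner_on_sum:
  assumes "\<And>i. i \<in> I \<Longrightarrow> square_integrable M (f i)" "square_integrable M g"
  shows "inner_on M (\<lambda>x. \<Sum>i\<in>I. f i x) g = (\<Sum>i\<in>I. inner_on M (f i) g)"
  using assms by (simp add: inner_on_def sum_distrib_right square_integrable_mult)

lemma inner_on_cong_AE:
  assumes "AE x in M. f x = f' x" "AE x in M. g x = g' x"
    and [measurable]: "f \<in> borel_measurable M" "f' \<in> borel_measurable M"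
      "g \<in> borel_measurable M" "g' \<in> borel_measurable M"
  shows "inner_on M f g = inner_on M f' g'"
  unfolding inner_on_def using assms(1,2) by (intro integral_cong_AE) auto

lemma norm_on_eq_0:
  assumes "square_integrable M f" "norm_on M f = 0"
  shows "AE x in M. f x = 0"
proof -
  have "(\<integral>x. (f x)\<^sup>2 \<partial>M) = 0" using assms by (simp add: norm_on_def)
  then show ?thesis
    using assms by (subst (asm) integral_nonneg_eq_0_iff_AE) (auto simp: square_integrable_def)
qed

text \<open>The quadratic form in fact \<open>q\<close> is the integral of a square. At s = (g,g), t
  = -(f,g) its nonnegativity is the claim multiplied by (g,g). If (g,g) = 0, the form is affine in t
  at s = 1, which forces (f,g) = 0.\<close>

lemma Cauchy_Schwarz_on:
  assumes f: "square_integrable M f" and g: "square_integrable M g"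
  shows "\<bar>inner_on M f g\<bar> \<le> norm_on M f * norm_on M g"
proof -
  let ?a = "inner_on M f f" and ?b = "inner_on M f g" and ?c = "inner_on M g g"
  have q: "0 \<le> s\<^sup>2 * ?a + 2 * s * t * ?b + t\<^sup>2 * ?c" for s t
  proof -
    have "0 \<le> (\<integral>x. (s * f x + t * g x)\<^sup>2 \<partial>M)" by simp
    also have "(\<lambda>x. (s * f x + t * g x)\<^sup>2)
        = (\<lambda>x. s\<^sup>2 * (f x * f x) + 2 * s * t * (f x * g x) + t\<^sup>2 * (g x * g x))"
      by (auto simp: power2_eq_square algebra_simps)
    also have "(\<integral>x. \<dots> x \<partial>M) = s\<^sup>2 * ?a + 2 * s * t * ?b + t\<^sup>2 * ?c"
      using square_integrable_mult[OF f f] square_integrable_mult[OF f g]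
        square_integrable_mult[OF g g]
      by (simp add: inner_on_def)
    finally show ?thesis .
  qed
  have "?b\<^sup>2 \<le> ?a * ?c"
  proof (cases "?c = 0")
    case True
    have "?a \<ge> 0" using q[of 1 0] by simp
    have "?b = 0"
    proof (rule ccontr)
      assume "?b \<noteq> 0"
      moreover have "0 \<le> ?a + 2 * (- (?a + 1) / (2 * ?b)) * ?b"
        using q[of 1 "- (?a + 1) / (2 * ?b)"] True by simp
      ultimately show False by (simp add: field_simps)
    qed
    then show ?thesis using True by simp
  next
    case False
    then have c: "?c > 0" using q[of 0 1] by simp
    have "0 \<le> ?c\<^sup>2 * ?a + 2 * ?c * (- ?b) * ?b + (- ?b)\<^sup>2 * ?c" by (rule q)
    then have "0 \<le> ?c * (?a * ?c - ?b\<^sup>2)" by (simp add: power2_eq_square algebra_simps)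
    then show ?thesis using c by (simp add: zero_le_mult_iff)
  qed
  then have "?b\<^sup>2 \<le> (norm_on M f * norm_on M g)\<^sup>2"
    by (simp add: power_mult_distrib norm_on_square)
  then show ?thesis by (metis abs_le_square_iff abs_of_nonneg mult_nonneg_nonneg norm_on_nonneg)
qed

lemma norm_on_triangle:
  assumes f: "square_integrable M f" and g: "square_integrable M g"
  shows "norm_on M (\<lambda>x. f x + g x) \<le> norm_on M f + norm_on M g"
proof (rule power2_le_imp_le)
  have "(norm_on M (\<lambda>x. f x + g x))\<^sup>2 = (norm_on M f)\<^sup>2 + 2 * inner_on M f g + (norm_on M g)\<^sup>2"
  proof -
    have "inner_on M f (\<lambda>x. f x + g x) = inner_on M f f + inner_on M g f"
      "inner_on M g (\<lambda>x. f x + g x) = inner_on M f g + inner_on M g g"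
      using f g by (subst inner_on_commute, simp add: inner_on_add)+
    then show ?thesis
      using inner_on_add[OF f g square_integrable_add[OF f g]] inner_on_commute[of M g f]
      by (simp add: norm_on_square)
  qed
  also have "\<dots> \<le> (norm_on M f + norm_on M g)\<^sup>2"
    using Cauchy_Schwarz_on[OF f g] by (simp add: power2_sum)
  finally show "(norm_on M (\<lambda>x. f x + g x))\<^sup>2 \<le> (norm_on M f + norm_on M g)\<^sup>2" .
qed simp

lemma norm_on_cmult: "norm_on M (\<lambda>x. c * f x) = \<bar>c\<bar> * norm_on M f"
  by (simp add: norm_on_def power_mult_distrib real_sqrt_mult)

lemma norm_on_minus_commute: "norm_on M (\<lambda>x. f x - g x) = norm_on M (\<lambda>x. g x - f x)"
  by (simp add: norm_on_def power2_commute)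

lemma norm_on_mono:
  assumes "square_integrable M g" "f \<in> borel_measurable M" "AE x in M. \<bar>f x\<bar> \<le> \<bar>g x\<bar>"
  shows "norm_on M f \<le> norm_on M g"
  unfolding norm_on_def real_sqrt_le_iff
proof (rule integral_mono_AE')
  show "integrable M (\<lambda>x. (g x)\<^sup>2)" using assms by (simp add: square_integrable_def)
  show "AE x in M. (f x)\<^sup>2 \<le> (g x)\<^sup>2" using assms(3) by (simp add: abs_le_square_iff)
qed auto

lemma norm_on_const: "norm_on M (\<lambda>x. c) = sqrt (measure M (space M)) * \<bar>c\<bar>"
  by (simp add: norm_on_def real_sqrt_mult)

text \<open>Fatou's lemma for the squares yields integrability of the limit and its norm bound
  together.\<close>

lemma Fatou_norm_on:
  assumes u: "\<And>n. square_integrable M (u n)" and f: "f \<in> borel_measurable M"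
    and lim: "AE x in M. (\<lambda>n. u n x) \<longlonglongrightarrow> f x" and b: "\<And>n. norm_on M (u n) \<le> C"
  shows "square_integrable M f \<and> norm_on M f \<le> C"
proof -
  have C: "0 \<le> C" using b[of 0] norm_on_nonneg[of M "u 0"] by linarith
  have [measurable]: "u n \<in> borel_measurable M" "f \<in> borel_measurable M" for n
    using u f by measurable
  have "(\<integral>\<^sup>+x. ennreal ((f x)\<^sup>2) \<partial>M) = (\<integral>\<^sup>+x. liminf (\<lambda>n. ennreal ((u n x)\<^sup>2)) \<partial>M)"
  proof (rule nn_integral_cong_AE)
    show "AE x in M. ennreal ((f x)\<^sup>2) = liminf (\<lambda>n. ennreal ((u n x)\<^sup>2))"
      using lim
    proof eventually_elim
      case (elim x)
      then have "(\<lambda>n. ennreal ((u n x)\<^sup>2)) \<longlonglongrightarrow> ennreal ((f x)\<^sup>2)"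
        by (intro tendsto_ennrealI tendsto_power)
      then show ?case using lim_imp_Liminf[OF sequentially_bot] by metis
    qed
  qed
  also have "\<dots> \<le> liminf (\<lambda>n. \<integral>\<^sup>+x. ennreal ((u n x)\<^sup>2) \<partial>M)"
    by (intro nn_integral_liminf) measurable
  also have "\<dots> \<le> liminf (\<lambda>n::nat. ennreal (C\<^sup>2))"
  proof (rule Liminf_mono, rule always_eventually, rule allI)
    fix n
    have "(\<integral>\<^sup>+x. ennreal ((u n x)\<^sup>2) \<partial>M) = ennreal (\<integral>x. (u n x)\<^sup>2 \<partial>M)"
      using u by (intro nn_integral_eq_integral) (auto simp: square_integrable_def)
    also have "\<dots> = ennreal ((norm_on M (u n))\<^sup>2)" by (simp add: norm_on_def)
    also have "\<dots> \<le> ennreal (C\<^sup>2)" using b[of n] by (intro ennreal_leI power_mono) auto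
    finally show "(\<integral>\<^sup>+x. ennreal ((u n x)\<^sup>2) \<partial>M) \<le> ennreal (C\<^sup>2)" .
  qed
  also have "\<dots> = ennreal (C\<^sup>2)" by (simp add: Liminf_const)
  finally have le: "(\<integral>\<^sup>+x. ennreal ((f x)\<^sup>2) \<partial>M) \<le> ennreal (C\<^sup>2)" .
  then have int: "integrable M (\<lambda>x. (f x)\<^sup>2)"
    by (intro integrableI_bounded) (auto intro: le_less_trans)
  then have "ennreal (\<integral>x. (f x)\<^sup>2 \<partial>M) \<le> ennreal (C\<^sup>2)"
    using le nn_integral_eq_integral[OF int] by simp
  then have "(\<integral>x. (f x)\<^sup>2 \<partial>M) \<le> C\<^sup>2" by simp
  then have "norm_on M f \<le> C" using C by (simp add: norm_on_def real_le_lsqrt)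
  then show ?thesis using int f by (simp add: square_integrable_def)
qed

lemma (in finite_measure) norm_on_L1_bound:
  assumes "square_integrable M f"
  shows "(\<integral>x. \<bar>f x\<bar> \<partial>M) \<le> sqrt (measure M (space M)) * norm_on M f"
proof -
  have a: "square_integrable M (\<lambda>x. \<bar>f x\<bar>)" using assms by (auto simp: square_integrable_def)
  have o: "square_integrable M (\<lambda>x. 1)" by (simp add: square_integrable_def)
  show ?thesis
    using Cauchy_Schwarz_on[OF o a] by (simp add: inner_on_def norm_on_def)
qed

text \<open>Along a subsequence with increments at most 2^-k in norm, the increments are summable in
  L1, hence almost everywhere; Fatou then gives convergence in norm. The limit \<open>f\<close> is
  left open because the application needs a representative that is periodic on the whole space, not
  just one defined on the cell.\<close>

lemma (in finite_measure) square_integrable_Cauchy_subseq: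
  assumes u: "\<And>n. square_integrable M (u n)"
    and Cau: "\<And>e. e > 0 \<Longrightarrow> \<exists>N. \<forall>m\<ge>N. \<forall>n\<ge>N. norm_on M (\<lambda>x. u m x - u n x) \<le> e"
  obtains r :: "nat \<Rightarrow> nat" where "strict_mono r" "AE x in M. convergent (\<lambda>n. u (r n) x)"
    "\<And>f. f \<in> borel_measurable M \<Longrightarrow> AE x in M. (\<lambda>n. u (r n) x) \<longlonglongrightarrow> f x \<Longrightarrow>
       square_integrable M f \<and> (\<lambda>n. norm_on M (\<lambda>x. u n x - f x)) \<longlonglongrightarrow> 0"
proof -
  have [measurable]: "u n \<in> borel_measurable M" for n using u by measurable
  obtain N where N: "\<And>k m n. m \<ge> N k \<Longrightarrow> n \<ge> N k \<Longrightarrow> norm_on M (\<lambda>x. u m x - u n x) \<le> (1/2)^k"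
    using Cau[of "(1/2)^_"] by (metis zero_less_divide_1_iff zero_less_numeral zero_less_power)
  define r where "r = rec_nat (N 0) (\<lambda>k p. Suc (max p (N (Suc k))))"
  have r0: "r 0 = N 0" and rS: "r (Suc k) = Suc (max (r k) (N (Suc k)))" for k
    by (simp_all add: r_def)
  have rN: "r k \<ge> N k" for k by (cases k) (simp_all add: r0 rS)
  have mono: "strict_mono r" by (intro strict_monoI_Suc) (simp add: rS)
  have step: "norm_on M (\<lambda>x. u (r (Suc k)) x - u (r k) x) \<le> (1/2)^k" for k
    using mono by (intro N) (auto intro: rN le_trans[OF rN[of k]] simp: rS)
  let ?d = "\<lambda>k x. u (r (Suc k)) x - u (r k) x"
  let ?c = "sqrt (measure M (space M))"
  have sd: "square_integrable M (?d k)" for k by (intro square_integrable_diff u)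
  have L1: "(\<integral>\<^sup>+x. ennreal \<bar>?d k x\<bar> \<partial>M) \<le> ennreal (?c * (1/2)^k)" for k
  proof -
    have "(\<integral>\<^sup>+x. ennreal \<bar>?d k x\<bar> \<partial>M) = ennreal (\<integral>x. \<bar>?d k x\<bar> \<partial>M)"
      using square_integrable_integrable[OF sd[of k]] by (intro nn_integral_eq_integral) auto
    also have "\<dots> \<le> ennreal (?c * (1/2)^k)"
      using norm_on_L1_bound[OF sd[of k]] step[of k]
      by (intro ennreal_leI) (smt (verit, best) mult_left_mono real_sqrt_ge_zero measure_nonneg)
    finally show ?thesis .
  qed
  have "(\<integral>\<^sup>+x. (\<Sum>k. ennreal \<bar>?d k x\<bar>) \<partial>M) = (\<Sum>k. \<integral>\<^sup>+x. ennreal \<bar>?d k x\<bar> \<partial>M)"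
    by (intro nn_integral_suminf) measurable
  also have "\<dots> \<le> (\<Sum>k. ennreal (?c * (1/2)^k))"
    by (intro suminf_le L1) auto
  also have "\<dots> = ennreal (\<Sum>k. ?c * (1/2)^k)"
    by (intro suminf_ennreal2 summable_mult summable_geometric) auto
  also have "\<dots> < \<infinity>" by simp
  finally have "AE x in M. (\<Sum>k. ennreal \<bar>?d k x\<bar>) \<noteq> \<infinity>"
    by (intro nn_integral_noteq_infinite) auto
  then have conv: "AE x in M. convergent (\<lambda>n. u (r n) x)"
  proof eventually_elim
    case (elim x)
    then have "summable (\<lambda>k. \<bar>?d k x\<bar>)"
      by (intro summable_suminf_not_top) auto
    then have "summable (\<lambda>k. ?d k x)" by (rule summable_rabs_cancel)
    then have "(\<lambda>n. \<Sum>k<n. ?d k x) \<longlonglongrightarrow> (\<Sum>k. ?d k x)" by (rule summable_LIMSEQ)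
    then have "(\<lambda>n. u (r n) x - u (r 0) x) \<longlonglongrightarrow> (\<Sum>k. ?d k x)"
      using sum_lessThan_telescope[of "\<lambda>k. u (r k) x"] by simp
    then have "(\<lambda>n. (u (r n) x - u (r 0) x) + u (r 0) x) \<longlonglongrightarrow> (\<Sum>k. ?d k x) + u (r 0) x"
      by (intro tendsto_add tendsto_const)
    then show ?case by (auto simp: convergent_def)
  qed
  show thesis
  proof (rule that[OF mono conv])
    fix f assume f[measurable]: "f \<in> borel_measurable M"
      and lim: "AE x in M. (\<lambda>n. u (r n) x) \<longlonglongrightarrow> f x"
    have key: "square_integrable M (\<lambda>x. u m x - f x) \<and> norm_on M (\<lambda>x. u m x - f x) \<le> (1/2)^k"
      if "m \<ge> N k" for m k
    proof (rule Fatou_norm_on)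
      show "square_integrable M (\<lambda>x. u m x - u (r (n + k)) x)" for n
        by (intro square_integrable_diff u)
      show "AE x in M. (\<lambda>n. u m x - u (r (n + k)) x) \<longlonglongrightarrow> u m x - f x"
        using lim by eventually_elim (intro tendsto_intros LIMSEQ_ignore_initial_segment)
      fix n
      have "r (n + k) \<ge> N k" using rN[of k] mono by (meson le_add2 le_trans strict_mono_less_eq)
      then show "norm_on M (\<lambda>x. u m x - u (r (n + k)) x) \<le> (1/2)^k"
        by (intro N that)
    qed measurable
    have "square_integrable M (\<lambda>x. u (N 0) x - (u (N 0) x - f x))"
      by (rule square_integrable_diff[OF u]) (use key[of 0 "N 0"] in auto)
    moreover have "(\<lambda>n. norm_on M (\<lambda>x. u n x - f x)) \<longlonglongrightarrow> 0"
    proof (rule LIMSEQ_I)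
      fix e :: real assume "e > 0"
      then obtain k where k: "(1/2)^k < e" using real_arch_pow_inv[of e "1/2"] by auto
      show "\<exists>no. \<forall>n\<ge>no. norm (norm_on M (\<lambda>x. u n x - f x) - 0) < e"
        using key k by (intro exI[of _ "N k"]) fastforce
    qed
    ultimately show "square_integrable M f \<and> (\<lambda>n. norm_on M (\<lambda>x. u n x - f x)) \<longlonglongrightarrow> 0"
      by simp
  qed
qed

section \<open>The periodicity cell\<close>


text \<open>As a measure of its own the cell is a finite measure space of mass 1, so norms and inner
  products over it fall under the preceding section.\<close>

definition cell :: "(real^'n) measure" where
  "cell = restrict_space lebesgue unit_cell"

definition int_vec :: "int^'n \<Rightarrow> real^'n" where
  "int_vec k = (\<chi> i. of_int (k $ i))"

lemma int_vec_nth [simp]: "int_vec k $ i = of_int (k $ i)"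
  by (simp add: int_vec_def)

lemma int_vec_Ints: "\<forall>i. int_vec k $ i \<in> \<int>"
  by simp

lemma int_vec_cases:
  assumes "\<forall>i. k $ i \<in> \<int>" obtains m where "k = int_vec m"
proof
  show "k = int_vec (\<chi> i. \<lfloor>k $ i\<rfloor>)"
    using assms by (simp add: vec_eq_iff of_int_floor_cancel)
qed

lemma unit_cell_box: "unit_cell = box 0 (1 :: real^'n)"
  by (auto simp: unit_cell_def mem_box_cart)

lemma unit_cell_borel [measurable, simp]: "unit_cell \<in> sets borel"
  by (simp add: unit_cell_box)

lemma unit_cell_lebesgue [measurable, simp]: "unit_cell \<in> sets lebesgue"
  by (simp add: unit_cell_box)

lemma space_cell [simp]: "space cell = unit_cell"
  by (simp add: cell_def space_restrict_space)

lemma emeasure_cell: "emeasure cell (space (cell :: (real^'n) measure)) = 1"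
proof -
  have "emeasure lborel (box 0 (1 :: real^'n)) = ennreal (\<Prod>b\<in>Basis. (1 - 0) \<bullet> (b::real^'n))"
    by (rule emeasure_lborel_box) (auto simp: Basis_vec_def inner_axis)
  also have "\<dots> = 1"
    by (auto simp: Basis_vec_def inner_axis intro!: prod.neutral)
  finally show ?thesis
    by (simp add: cell_def space_restrict_space emeasure_restrict_space)
       (simp add: unit_cell_box)
qed

interpretation cell: finite_measure "cell :: (real^'n) measure"
  by standard (simp add: emeasure_cell del: space_cell)

lemma measure_cell [simp]: "measure cell unit_cell = 1"
  using emeasure_cell by (simp add: measure_def)

lemma cell_integral_eq: "cell_integral f = integral\<^sup>L cell f"
  by (simp add: cell_integral_def set_lebesgue_integral_def cell_def integral_restrict_space)

lemma measurable_cell: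
  "f \<in> borel_measurable lebesgue \<Longrightarrow> f \<in> borel_measurable cell"
  by (simp add: cell_def measurable_restrict_space1)

lemma AE_cell_iff: "(AE x in cell. P x) \<longleftrightarrow> (AE x in lebesgue. x \<in> unit_cell \<longrightarrow> P x)"
  unfolding cell_def by (rule AE_restrict_space_iff) simp

lemma AE_cell: "(AE x in lebesgue. P x) \<Longrightarrow> (AE x in cell. P x)"
  by (auto simp: AE_cell_iff)

lemma L2_per_iff:
  "f \<in> L2_per \<longleftrightarrow> f \<in> borel_measurable lebesgue \<and> ae_periodic f \<and> square_integrable cell f"
proof -
  have "set_integrable lebesgue unit_cell (\<lambda>x. (f x)\<^sup>2) = integrable cell (\<lambda>x. (f x)\<^sup>2)"
    by (simp add: set_integrable_def cell_def integrable_restrict_space)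
  then show ?thesis
    unfolding L2_per_def square_integrable_def using measurable_cell[of f] by blast
qed

lemma L2_per_square_integrable: "f \<in> L2_per \<Longrightarrow> square_integrable cell f"
  by (simp add: L2_per_iff)

lemma L2_inner_eq: "L2_inner f g = inner_on cell f g"
  by (simp add: L2_inner_def inner_on_def cell_integral_eq)

lemma L2_norm_eq: "L2_norm f = norm_on cell f"
  by (simp add: L2_norm_def norm_on_def L2_inner_eq inner_on_def power2_eq_square)

lemma AE_translation:
  fixes P :: "'a::euclidean_space \<Rightarrow> bool"
  assumes "AE x in lebesgue. P x" shows "AE x in lebesgue. P (x + a)"
proof -
  have "AE x in lborel. P x" using assms by (simp add: AE_completion_iff)
  then obtain N where N: "N \<in> null_sets lborel" "{x. \<not> P x} \<subseteq> N"
    by (auto simp: eventually_ae_filter)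
  have "{x. x - (- a) \<in> N} \<in> null_sets lborel" by (rule null_sets_translation[OF N(1)])
  moreover have "{x. \<not> P (x + a)} \<subseteq> {x. x - (- a) \<in> N}" using N(2) by auto
  ultimately have "AE x in lborel. P (x + a)" by (intro AE_I') auto
  then show ?thesis by (simp add: AE_completion_iff)
qed

lemma AE_nth_neq: "AE x in lebesgue. (x :: real^'n) $ i \<noteq> c"
proof -
  have "{x :: real^'n. x $ i = c} \<in> null_sets lebesgue"
    using negligible_hyperplane[of "axis i 1 :: real^'n" c]
    by (simp add: inner_axis' negligible_iff_null_sets[symmetric] axis_eq_0_iff)
  then show ?thesis by (rule AE_I') auto
qed

lemma AE_nth_not_Ints: "AE x in lebesgue. \<forall>i. (x :: real^'n) $ i \<notin> \<int>"
proof -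
  have "AE x in lebesgue. \<forall>i::'n. \<forall>m::int. (x :: real^'n) $ i \<noteq> of_int m"
    by (subst AE_all_countable, rule allI, subst AE_all_countable, rule allI, rule AE_nth_neq)
  then show ?thesis by eventually_elim (auto elim: Ints_cases)
qed

text \<open>Almost every point has no integer coordinate and so lies in a lattice translate of the
  open cell. There are only countably many translates, hence the exceptional null sets can be
  united.\<close>

lemma AE_of_cell:
  fixes P :: "real^'n \<Rightarrow> bool"
  assumes cell: "AE x in cell. P x"
    and per: "\<And>k. \<forall>i. k $ i \<in> \<int> \<Longrightarrow> AE x in lebesgue. P (x + k) = P x"
  shows "AE x in lebesgue. P x"
proof -
  have "AE x in lebesgue. x + int_vec k \<in> unit_cell \<longrightarrow> P x" for k :: "int^'n"
  proof -
    have "AE x in lebesgue. x + int_vec k \<in> unit_cell \<longrightarrow> P (x + int_vec k)"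
      using cell AE_translation[of "\<lambda>x. x \<in> unit_cell \<longrightarrow> P x"] by (simp add: AE_cell_iff)
    moreover have "AE x in lebesgue. P (x + int_vec k) = P x"
      by (rule per[OF int_vec_Ints])
    ultimately show ?thesis by eventually_elim simp
  qed
  then have "AE x in lebesgue. \<forall>k::int^'n. x + int_vec k \<in> unit_cell \<longrightarrow> P x"
    by (subst AE_all_countable) blast
  then show ?thesis
    using AE_nth_not_Ints
  proof eventually_elim
    case (elim x)
    have "x + int_vec (\<chi> i. - \<lfloor>x $ i\<rfloor>) \<in> unit_cell"
      unfolding unit_cell_def
    proof (intro CollectI allI)
      fix i
      have "of_int \<lfloor>x $ i\<rfloor> \<noteq> x $ i" using elim(2) by (metis Ints_of_int)
      then show "0 < (x + int_vec (\<chi> i. - \<lfloor>x $ i\<rfloor>)) $ i \<and> (x + int_vec (\<chi> i. - \<lfloor>x $ i\<rfloor>)) $ i < 1"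
        using of_int_floor_le[of "x $ i"] by (auto simp: less_le) linarith+
    qed
    then show ?case using elim(1) by blast
  qed
qed

lemma ae_periodic_eq_AE:
  assumes "ae_periodic f" "ae_periodic g" "AE x in cell. f x = g x"
  shows "AE x in lebesgue. f x = g x"
proof (rule AE_of_cell[OF assms(3)])
  fix k :: "real^'a" assume k: "\<forall>i. k $ i \<in> \<int>"
  have "AE x in lebesgue. f (x + k) = f x" "AE x in lebesgue. g (x + k) = g x"
    using assms k by (auto simp: ae_periodic_def)
  then show "AE x in lebesgue. (f (x + k) = g (x + k)) = (f x = g x)"
    by eventually_elim simp
qed

lemma ae_periodic_compose:
  "ae_periodic f \<Longrightarrow> ae_periodic (\<lambda>x. h (f x))"
  unfolding ae_periodic_def by (fast elim: eventually_mono intro: arg_cong[of _ _ h])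

lemma ae_periodic_compose2:
  assumes "ae_periodic f" "ae_periodic g" shows "ae_periodic (\<lambda>x. h (f x) (g x))"
  unfolding ae_periodic_def
proof (intro allI impI)
  fix k :: "real^'a" assume k: "\<forall>i. k $ i \<in> \<int>"
  have "AE x in lebesgue. f (x + k) = f x" "AE x in lebesgue. g (x + k) = g x"
    using assms k by (auto simp: ae_periodic_def)
  then show "AE x in lebesgue. h (f (x + k)) (g (x + k)) = h (f x) (g x)"
    by eventually_elim simp
qed

lemma ae_periodic_const [simp]: "ae_periodic (\<lambda>x. c)"
  by (simp add: ae_periodic_def)

section \<open>Translation invariance of integrals over the cell\<close>

lemma integrable_unit_cell_continuous:
  fixes f :: "real^'n \<Rightarrow> real"
  assumes S [measurable]: "S \<in> sets borel" "S \<subseteq> cbox 0 1" and f: "continuous_on UNIV f"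
  shows "integrable lborel (\<lambda>x. indicator S x * f x)"
proof (rule Bochner_Integration.integrable_bound)
  have [measurable]: "f \<in> borel_measurable borel" by (rule borel_measurable_continuous_onI[OF f])
  show "integrable lborel (\<lambda>x. indicator (cbox 0 1) x *\<^sub>R f x)"
    using f by (intro borel_integrable_compact) (auto intro: continuous_on_subset)
  show "(\<lambda>x. indicator S x * f x) \<in> borel_measurable lborel" by simp
  show "AE x in lborel. norm (indicator S x * f x) \<le> norm (indicator (cbox 0 1) x *\<^sub>R f x)"
    using S(2) by (intro AE_I2) (auto simp: indicator_def)
qed

lemma integral_cell_continuous:
  fixes f :: "real^'n \<Rightarrow> real"
  assumes f: "continuous_on UNIV f"
  shows "integral\<^sup>L cell f = (\<integral>x. indicator unit_cell x * f x \<partial>lborel)"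
proof -
  have [measurable]: "f \<in> borel_measurable borel" by (rule borel_measurable_continuous_onI[OF f])
  show ?thesis
    by (simp add: cell_def integral_restrict_space integral_completion)
qed

lemma lborel_integral_translation:
  fixes f :: "'a::euclidean_space \<Rightarrow> real"
  assumes [measurable]: "f \<in> borel_measurable borel"
  shows "(\<integral>x. f (x + a) \<partial>lborel) = (\<integral>x. f x \<partial>lborel)"
proof -
  have "(\<integral>x. f x \<partial>lborel) = (\<integral>x. f x \<partial>(distr lborel borel ((+) a)))"
    by (simp add: lborel_distr_plus)
  also have "\<dots> = (\<integral>x. f (x + a) \<partial>lborel)"
    by (subst integral_distr) (auto simp: add.commute)
  finally show ?thesis by simp
qed

definition int_periodic :: "(real^'n \<Rightarrow> 'b) \<Rightarrow> bool" where
  "int_periodic f \<longleftrightarrow> (\<forall>x k. (\<forall>i. k $ i \<in> \<int>) \<longrightarrow> f (x + k) = f x)"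

text \<open>Cut the cell at x_i = 1 - t. Shifting the lower slab by t and the upper one by t - 1,
  which periodicity permits, reassembles the cell up to a null set.\<close>

lemma integral_cell_translation_axis_unit:
  fixes f :: "real^'n \<Rightarrow> real"
  assumes f: "continuous_on UNIV f" and per: "int_periodic f" and t: "0 \<le> t" "t < 1"
  shows "(\<integral>x. f (x + axis i t) \<partial>cell) = integral\<^sup>L cell f"
proof -
  have fm [measurable]: "f \<in> borel_measurable borel" by (rule borel_measurable_continuous_onI[OF f])
  have cont: "continuous_on UNIV (\<lambda>x. f (x + a))" for a
    using f by (intro continuous_on_compose2[OF f] continuous_intros) auto
  define A B :: "(real^'n) set" where "A = unit_cell \<inter> {x. x $ i < 1 - t}"
    and "B = unit_cell \<inter> {x. x $ i \<ge> 1 - t}"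
  have AB [measurable]: "A \<in> sets borel" "B \<in> sets borel" unfolding A_def B_def by measurable
  have sub: "A \<subseteq> cbox 0 1" "B \<subseteq> cbox 0 1"
    by (auto simp: A_def B_def unit_cell_def mem_box_cart less_imp_le)
  let ?e = "axis i t :: real^'n" and ?d = "axis i (t - 1) :: real^'n"
  have fe: "f (x + ?e) = f (x + ?d)" for x
  proof -
    have "x + ?e = (x + ?d) + axis i 1" by (simp add: vec_eq_iff axis_def)
    moreover have "\<forall>j. (axis i 1 :: real^'n) $ j \<in> \<int>" by (simp add: axis_def)
    ultimately show ?thesis using per unfolding int_periodic_def by metis
  qed
  have sh: "(\<integral>x. indicator S x * f (x + a) \<partial>lborel) = (\<integral>x. indicator S (x - a) * f x \<partial>lborel)"
    if [measurable]: "S \<in> sets borel" for S a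
    using lborel_integral_translation[of "\<lambda>x. indicator S (x - a) * f x" a] by simp
  have int_sh: "integrable lborel (\<lambda>x. indicator S (x - a) * f x)"
    if [measurable]: "S \<in> sets borel" and "S \<subseteq> cbox 0 1" for S a
  proof -
    have "integrable (distr lborel borel ((+) a)) (\<lambda>x. indicator S (x - a) * f x)"
      using integrable_unit_cell_continuous[OF that cont, of a]
      by (subst integrable_distr_eq) (auto simp: add.commute)
    then show ?thesis by (simp add: lborel_distr_plus)
  qed
  define R where "R y \<longleftrightarrow> (\<forall>j. j \<noteq> i \<longrightarrow> 0 < y $ j \<and> y $ j < 1)" for y :: "real^'n"
  have inU: "y \<in> unit_cell \<longleftrightarrow> 0 < y $ i \<and> y $ i < 1 \<and> R y" for y
    unfolding unit_cell_def R_def mem_Collect_eq by metis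
  have inA: "y \<in> A \<longleftrightarrow> 0 < y $ i \<and> y $ i < 1 - t \<and> R y" for y
    using t by (auto simp: A_def inU)
  have inB: "y \<in> B \<longleftrightarrow> 1 - t \<le> y $ i \<and> y $ i < 1 \<and> R y" for y
    using t by (auto simp: B_def inU)
  have R_e: "R (y - axis i s) = R y" for y s
    by (simp add: R_def axis_def)
  have axis_i: "(axis i s :: real^'n) $ i = s" for s
    by (simp add: axis_def)
  have "(\<integral>x. f (x + ?e) \<partial>cell) = (\<integral>x. indicator unit_cell x * f (x + ?e) \<partial>lborel)"
    by (rule integral_cell_continuous[OF cont])
  also have "\<dots> = (\<integral>x. indicator A x * f (x + ?e) + indicator B x * f (x + ?d) \<partial>lborel)"
    by (intro Bochner_Integration.integral_cong) (auto simp: A_def B_def fe indicator_def)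
  also have "\<dots> = (\<integral>x. indicator A x * f (x + ?e) \<partial>lborel) + (\<integral>x. indicator B x * f (x + ?d) \<partial>lborel)"
    by (intro Bochner_Integration.integral_add integrable_unit_cell_continuous AB sub cont)
  also have "\<dots> = (\<integral>x. indicator A (x - ?e) * f x \<partial>lborel) + (\<integral>x. indicator B (x - ?d) * f x \<partial>lborel)"
    by (simp add: sh)
  also have "\<dots> = (\<integral>x. indicator A (x - ?e) * f x + indicator B (x - ?d) * f x \<partial>lborel)"
    by (intro Bochner_Integration.integral_add[symmetric] int_sh AB sub)
  also have "\<dots> = (\<integral>x. indicator unit_cell x * f x \<partial>lborel)"
  proof (rule integral_cong_AE)
    \<comment> \<open>The shifted slabs miss the plane x_i = t and include points with x_i = 0, so
      the indicators agree only off these two planes.\<close>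
    have "AE x in lborel. (x :: real^'n) $ i \<noteq> t" "AE x in lborel. (x :: real^'n) $ i \<noteq> 0"
      using AE_nth_neq[of i t] AE_nth_neq[of i 0] by (simp_all add: AE_completion_iff)
    then show "AE x in lborel. indicator A (x - ?e) * f x + indicator B (x - ?d) * f x
        = indicator unit_cell x * f x"
    proof eventually_elim
      case (elim x)
      have "x - ?e \<in> A \<longleftrightarrow> x \<in> unit_cell \<and> x $ i > t"
        "x - ?d \<in> B \<longleftrightarrow> x \<in> unit_cell \<and> x $ i < t"
        using t elim by (auto simp: inA inB inU R_e axis_i)
      then show ?case using elim by (auto simp: indicator_def)
    qed
  qed measurable
  also have "\<dots> = integral\<^sup>L cell f"
    by (rule integral_cell_continuous[OF f, symmetric])
  finally show ?thesis .
qed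

lemma integral_cell_translation_axis:
  fixes f :: "real^'n \<Rightarrow> real"
  assumes f: "continuous_on UNIV f" and per: "int_periodic f"
  shows "(\<integral>x. f (x + axis i t) \<partial>cell) = integral\<^sup>L cell f"
proof -
  have "f (x + axis i t) = f (x + axis i (frac t))" for x
  proof -
    have "x + axis i t = (x + axis i (frac t)) + axis i (of_int \<lfloor>t\<rfloor>)"
      by (simp add: vec_eq_iff axis_def frac_def)
    moreover have "\<forall>j. axis i (of_int \<lfloor>t\<rfloor> :: real) $ j \<in> \<int>" by (simp add: axis_def)
    ultimately show ?thesis using per unfolding int_periodic_def by metis
  qed
  then show ?thesis
    using integral_cell_translation_axis_unit[OF f per frac_ge_0 frac_lt_1, of i t] by simp
qed

lemma integral_cell_translation:
  fixes f :: "real^'n \<Rightarrow> real"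
  assumes f: "continuous_on UNIV f" and per: "int_periodic f"
  shows "(\<integral>x. f (x + v) \<partial>cell) = integral\<^sup>L cell f"
proof -
  have "(\<integral>x. f (x + (\<Sum>i\<in>I. axis i (v $ i))) \<partial>cell) = integral\<^sup>L cell f" if "finite I" for I
    using that
  proof (induction I rule: finite_induct)
    case (insert i I)
    let ?w = "\<Sum>i\<in>I. axis i (v $ i)"
    let ?g = "\<lambda>x. f (x + ?w)"
    have g: "continuous_on UNIV ?g"
      using f by (intro continuous_on_compose2[OF f] continuous_intros) auto
    have gp: "int_periodic ?g"
      unfolding int_periodic_def
    proof (intro allI impI)
      fix x k :: "real^'n" assume k: "\<forall>i. k $ i \<in> \<int>"
      have "x + k + ?w = x + ?w + k" by simp
      then show "f (x + k + ?w) = f (x + ?w)" using per k unfolding int_periodic_def by metis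
    qed
    have "(\<integral>x. f (x + (\<Sum>i\<in>insert i I. axis i (v $ i))) \<partial>cell) = (\<integral>x. ?g (x + axis i (v $ i)) \<partial>cell)"
      using insert by (simp add: add.assoc)
    then show ?case using integral_cell_translation_axis[OF g gp] insert by simp
  qed simp
  moreover have "(\<Sum>i\<in>UNIV. axis i (v $ i)) = v"
    by (simp add: vec_eq_iff axis_def)
  ultimately show ?thesis using finite_class.finite_UNIV by metis
qed

section \<open>The Hartley basis\<close>


definition phase :: "int^'n \<Rightarrow> real^'n \<Rightarrow> real" where
  "phase k x = 2 * pi * (int_vec k \<bullet> x)"

text \<open>
  The functions \<open>cos + sin\<close> form a real orthonormal basis indexed by the whole lattice. Second
  derivatives act diagonally on it, first derivatives exchange the frequencies \<open>k\<close> and \<open>- k\<close>.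
\<close>

definition hart :: "int^'n \<Rightarrow> real^'n \<Rightarrow> real" where
  "hart k x = cos (phase k x) + sin (phase k x)"

lemma int_vec_0 [simp]: "int_vec 0 = 0"
  and int_vec_add: "int_vec (k + l) = int_vec k + int_vec l"
  and int_vec_diff: "int_vec (k - l) = int_vec k - int_vec l"
  and int_vec_minus: "int_vec (- k) = - int_vec k"
  by (simp_all add: vec_eq_iff)

lemma int_vec_eq_0_iff [simp]: "int_vec k = 0 \<longleftrightarrow> k = 0"
  by (simp add: vec_eq_iff)

lemma phase_0 [simp]: "phase 0 x = 0" "phase k 0 = 0"
  by (simp_all add: phase_def)

lemma phase_minus [simp]: "phase (- k) x = - phase k x"
  by (simp add: phase_def int_vec_minus)

lemma phase_add: "phase (k + l) x = phase k x + phase l x"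
  by (simp add: phase_def int_vec_add inner_add_left algebra_simps)

lemma phase_diff: "phase (k - l) x = phase k x - phase l x"
  by (simp add: phase_def int_vec_diff inner_diff_left algebra_simps)

lemma phase_add_right: "phase k (x + y) = phase k x + phase k y"
  by (simp add: phase_def inner_add_right algebra_simps)

lemma phase_diff_right: "phase k (x - y) = phase k x - phase k y"
  by (simp add: phase_def inner_diff_right algebra_simps)

lemma phase_scaleR_right: "phase k (t *\<^sub>R y) = t * phase k y"
  by (simp add: phase_def)

lemma phase_axis: "phase k (axis i t) = 2 * pi * of_int (k $ i) * t"
  by (simp add: phase_def inner_axis)

lemma continuous_phase [continuous_intros]: "continuous_on S (phase k)"
  unfolding phase_def by (intro continuous_intros)

lemma phase_int_vec: "\<exists>m::int. phase k (int_vec l) = 2 * pi * of_int m"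
proof
  show "phase k (int_vec l) = 2 * pi * of_int (\<Sum>i\<in>UNIV. k $ i * l $ i)"
    by (simp add: phase_def inner_vec_def)
qed

lemma hart_0 [simp]: "hart 0 x = 1"
  by (simp add: hart_def)

lemma cos_phase: "cos (phase k x) = (hart k x + hart (- k) x) / 2"
  by (simp add: hart_def)

lemma sin_phase: "sin (phase k x) = (hart k x - hart (- k) x) / 2"
  by (simp add: hart_def)

lemma abs_hart_le: "\<bar>hart k x\<bar> \<le> 2"
  using abs_cos_le_one[of "phase k x"] abs_sin_le_one[of "phase k x"]
  unfolding hart_def by linarith

text \<open>With phases p and q the product is cos (p - q) + sin (p + q), and cosine and sine are
  the even and odd parts of Hartley functions. Products therefore stay in the span, with frequencies
  k - l and k + l up to sign.\<close>

lemma hart_mult: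
  "hart k x * hart l x
    = (hart (k - l) x + hart (l - k) x) / 2 + (hart (k + l) x - hart (- (k + l)) x) / 2"
proof -
  have "hart k x * hart l x = cos (phase (k - l) x) + sin (phase (k + l) x)"
    by (simp add: hart_def phase_add phase_diff cos_diff sin_add algebra_simps)
  then show ?thesis
    by (simp only: cos_phase sin_phase minus_diff_eq)
qed

lemma hart_add_right: "hart k (x + v) = cos (phase k v) * hart k x + sin (phase k v) * hart (- k) x"
  by (simp add: hart_def phase_add_right cos_add sin_add algebra_simps)

lemma hart_diff_right: "hart k (x - v) = cos (phase k v) * hart k x - sin (phase k v) * hart (- k) x"
  by (simp add: hart_def phase_diff_right cos_diff sin_diff algebra_simps)

lemma continuous_hart [continuous_intros]: "continuous_on S (hart k)"
  unfolding hart_def by (intro continuous_intros)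

lemma int_periodic_hart: "int_periodic (hart k)"
  unfolding int_periodic_def
proof (intro allI impI)
  fix x l :: "real^'a" assume "\<forall>i. l $ i \<in> \<int>"
  then obtain m where l: "l = int_vec m" by (rule int_vec_cases)
  obtain j :: int where j: "phase k l = 2 * pi * of_int j" using phase_int_vec l by blast
  have "cos (phase k l) = 1" "sin (phase k l) = 0"
    unfolding j by (rule cos_int_2pin, rule sin_int_2pin)
  then show "hart k (x + l) = hart k x" by (simp add: hart_add_right)
qed

lemma borel_measurable_continuous_lebesgue:
  "continuous_on UNIV (f :: 'a::euclidean_space \<Rightarrow> 'b::metric_space) \<Longrightarrow> f \<in> borel_measurable lebesgue"
  by (simp add: borel_measurable_continuous_onI measurable_completion)

lemma ae_periodic_int_periodic: "int_periodic f \<Longrightarrow> ae_periodic f"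
  by (simp add: int_periodic_def ae_periodic_def)

lemma bounded_L2_per:
  assumes "f \<in> borel_measurable lebesgue" "ae_periodic f" "\<And>x. \<bar>f x\<bar> \<le> C"
  shows "f \<in> L2_per"
  unfolding L2_per_iff
  using assms cell.square_integrable_bounded[OF measurable_cell[OF assms(1)], of C] by auto

lemma hart_L2_per: "hart k \<in> L2_per"
  by (intro bounded_L2_per[where C=2] borel_measurable_continuous_lebesgue continuous_intros
      ae_periodic_int_periodic int_periodic_hart abs_hart_le)

lemma square_integrable_hart [simp]: "square_integrable cell (hart k)"
  using hart_L2_per by (rule L2_per_square_integrable)

text \<open>For k \<noteq> 0 the shift \<open>v\<close> is half a wavelength: it reverses the sign
  of \<open>hart k\<close> but preserves its integral.\<close>

lemma integral_hart: "integral\<^sup>L cell (hart k) = (if k = 0 then 1 else 0)"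
proof (cases "k = 0")
  case True
  then have "hart k = (\<lambda>x. 1)" by auto
  then show ?thesis using True by simp
next
  case False
  then obtain i where i: "k $ i \<noteq> 0" by (auto simp: vec_eq_iff)
  define v :: "real^'a" where "v = axis i (1 / (2 * of_int (k $ i)))"
  have "phase k v = pi" using i by (simp add: v_def phase_axis)
  then have "hart k (x + v) = - hart k x" for x by (simp add: hart_add_right)
  then have "- integral\<^sup>L cell (hart k) = (\<integral>x. hart k (x + v) \<partial>cell)" by simp
  also have "\<dots> = integral\<^sup>L cell (hart k)"
    by (intro integral_cell_translation continuous_intros int_periodic_hart)
  finally show ?thesis using False by simp
qed

lemma integrable_hart [simp]: "integrable cell (hart k)"
  by (intro cell.square_integrable_integrable) simp

text \<open>The integrals at k + l and - (k + l) coincide and cancel, even when l = - k, so only the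
  difference k - l decides.\<close>

lemma inner_hart_hart: "inner_on cell (hart k) (hart l) = (if k = l then 1 else 0)"
proof -
  let ?I = "\<lambda>k. integral\<^sup>L cell (hart k)"
  have "inner_on cell (hart k) (hart l) = (?I (k - l) + ?I (l - k)) / 2 + (?I (k + l) - ?I (- (k + l))) / 2"
    unfolding inner_on_def hart_mult by (simp del: minus_add_distrib)
  also have "?I (- (k + l)) = ?I (k + l)"
    by (simp only: integral_hart neg_equal_0_iff_equal)
  also have "?I (l - k) = ?I (k - l)"
    by (simp only: integral_hart right_minus_eq eq_commute[of l k])
  finally show ?thesis by (simp add: integral_hart)
qed

text \<open>Cubes are invariant under negation, which matters because translations and first
  derivatives mix k with - k, and their number of points grows only polynomially in d.\<close>

definition freq :: "nat \<Rightarrow> (int^'n) set" where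
  "freq d = {k. \<forall>i. \<bar>k $ i\<bar> \<le> int d}"

lemma card_freq: "finite (freq d :: (int^'n) set) \<and> card (freq d :: (int^'n) set) \<le> (2 * d + 1) ^ CARD('n)"
proof -
  let ?P = "PiE (UNIV :: 'n set) (\<lambda>_. {- int d..int d})"
  have sub: "(freq d :: (int^'n) set) \<subseteq> vec_lambda ` ?P"
  proof
    fix k :: "int^'n" assume "k \<in> freq d"
    then have "vec_nth k \<in> ?P" by (auto simp: freq_def abs_le_iff minus_le_iff)
    then show "k \<in> vec_lambda ` ?P" by (metis image_eqI vec_nth_inverse)
  qed
  have fin: "finite ?P" by (intro finite_PiE) auto
  have "card (freq d :: (int^'n) set) \<le> card ?P"
    using card_mono[OF finite_imageI[OF fin] sub] card_image_le[OF fin] le_trans by blast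
  also have "\<dots> = (2 * d + 1) ^ CARD('n)" 
  proof -
    have "nat (2 * int d + 1) = 2 * d + 1" by linarith
    then show ?thesis by (simp add: card_PiE)
  qed
  finally show ?thesis using finite_subset[OF sub] fin by blast
qed

lemma finite_freq [simp]: "finite (freq d)"
  using card_freq by blast

lemma freq_mono: "d \<le> e \<Longrightarrow> freq d \<subseteq> freq e"
  unfolding freq_def by (auto intro: order_trans)

lemma freq_0 [simp]: "0 \<in> freq d"
  by (simp add: freq_def)

lemma freq_minus [simp]: "- k \<in> freq d \<longleftrightarrow> k \<in> freq d"
  by (simp add: freq_def)

lemma freq_add: "k \<in> freq d \<Longrightarrow> l \<in> freq e \<Longrightarrow> k + l \<in> freq (d + e)"
  unfolding freq_def by (auto intro!: order_trans[OF abs_triangle_ineq] add_mono)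

lemma freq_diff: "k \<in> freq d \<Longrightarrow> l \<in> freq e \<Longrightarrow> k - l \<in> freq (d + e)"
  using freq_add[of k d "- l" e] by simp

lemma freq_exhaust: "\<exists>d. k \<in> freq d"
proof
  show "k \<in> freq (nat (\<Sum>i\<in>UNIV. \<bar>k $ i\<bar>))"
    unfolding freq_def by (auto intro!: member_le_sum)
qed

section \<open>Trigonometric polynomials graded by degree\<close>

definition trig_sum :: "nat \<Rightarrow> (int^'n \<Rightarrow> real) \<Rightarrow> real^'n \<Rightarrow> real" where
  "trig_sum d a x = (\<Sum>k\<in>freq d. a k * hart k x)"

definition is_trig :: "nat \<Rightarrow> (real^'n \<Rightarrow> real) \<Rightarrow> bool" where
  "is_trig d f \<longleftrightarrow> (\<exists>a. f = trig_sum d a)"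

lemma is_trig_trig_sum [simp]: "is_trig d (trig_sum d a)"
  by (auto simp: is_trig_def)

lemma is_trig_hart: assumes "k \<in> freq d" shows "is_trig d (hart k)"
  unfolding is_trig_def
proof
  show "hart k = trig_sum d (\<lambda>l. if l = k then 1 else 0)"
    using assms by (auto simp: trig_sum_def if_distrib[where f="\<lambda>x. x * _"] cong: if_cong)
qed

lemma is_trig_add: "is_trig d f \<Longrightarrow> is_trig d g \<Longrightarrow> is_trig d (\<lambda>x. f x + g x)"
proof -
  have "(\<lambda>x. trig_sum d a x + trig_sum d b x) = trig_sum d (\<lambda>k. a k + b k)" for a b
    by (auto simp: trig_sum_def distrib_right sum.distrib)
  then show "is_trig d f \<Longrightarrow> is_trig d g \<Longrightarrow> is_trig d (\<lambda>x. f x + g x)"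
    unfolding is_trig_def by metis
qed

lemma is_trig_cmult: "is_trig d f \<Longrightarrow> is_trig d (\<lambda>x. c * f x)"
proof -
  have "(\<lambda>x. c * trig_sum d a x) = trig_sum d (\<lambda>k. c * a k)" for a
    by (auto simp: trig_sum_def sum_distrib_left mult.assoc)
  then show "is_trig d f \<Longrightarrow> is_trig d (\<lambda>x. c * f x)"
    unfolding is_trig_def by metis
qed

lemma is_trig_const: "is_trig d (\<lambda>x. c)"
  using is_trig_cmult[OF is_trig_hart[OF freq_0], of d c] by simp

lemma is_trig_diff: "is_trig d f \<Longrightarrow> is_trig d g \<Longrightarrow> is_trig d (\<lambda>x. f x - g x)"
  using is_trig_add[of d f "\<lambda>x. (-1) * g x"] is_trig_cmult[of d g "-1"] by simp

lemma is_trig_sum: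
  "(\<And>i. i \<in> I \<Longrightarrow> is_trig d (f i)) \<Longrightarrow> is_trig d (\<lambda>x. \<Sum>i\<in>I. f i x)"
  by (induction I rule: infinite_finite_induct) (auto intro: is_trig_add is_trig_const)

lemma is_trig_mono: assumes "is_trig d f" "d \<le> e" shows "is_trig e f"
proof -
  obtain a where "f = (\<lambda>x. \<Sum>k\<in>freq d. a k * hart k x)"
    using assms(1) by (auto simp: is_trig_def trig_sum_def fun_eq_iff)
  moreover have "is_trig e (\<lambda>x. \<Sum>k\<in>freq d. a k * hart k x)"
    using freq_mono[OF assms(2)] by (intro is_trig_sum is_trig_cmult is_trig_hart) auto
  ultimately show ?thesis by simp
qed

lemma is_trig_hart_mult:
  assumes "k \<in> freq d" "l \<in> freq e" shows "is_trig (d + e) (\<lambda>x. hart k x * hart l x)"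
proof -
  have "is_trig (d + e) (\<lambda>x. (1/2) * (hart (k - l) x + hart (l - k) x)
      + (1/2) * (hart (k + l) x - hart (- (k + l)) x))"
    using assms freq_diff[OF assms] freq_diff[OF assms(2,1)]
    by (intro is_trig_add is_trig_cmult is_trig_diff is_trig_hart)
       (auto simp: freq_add[OF assms] add.commute[of e d] simp del: minus_add_distrib)
  then show ?thesis by (simp add: hart_mult)
qed

lemma is_trig_mult:
  assumes "is_trig d f" "is_trig e g" shows "is_trig (d + e) (\<lambda>x. f x * g x)"
proof -
  obtain a b where f: "f = (\<lambda>x. \<Sum>k\<in>freq d. a k * hart k x)"
    and g: "g = (\<lambda>x. \<Sum>k\<in>freq e. b k * hart k x)"
    using assms by (auto simp: is_trig_def trig_sum_def fun_eq_iff)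
  have "(\<lambda>x. f x * g x) = (\<lambda>x. \<Sum>k\<in>freq d. \<Sum>l\<in>freq e. (a k * b l) * (hart k x * hart l x))"
    by (simp add: f g sum_product mult_ac)
  then show ?thesis
    by (simp only:) (intro is_trig_sum is_trig_cmult is_trig_hart_mult)
qed

lemma is_trig_continuous: assumes "is_trig d f" shows "continuous_on S f"
proof -
  obtain a where f: "f = (\<lambda>x. \<Sum>k\<in>freq d. a k * hart k x)"
    using assms by (auto simp: is_trig_def trig_sum_def fun_eq_iff)
  show ?thesis unfolding f by (intro continuous_intros)
qed

lemma is_trig_periodic: assumes "is_trig d f" shows "int_periodic f"
proof -
  have "hart l (x + k) = hart l x" if "\<forall>i. k $ i \<in> \<int>" for l and x k :: "real^'a"
    using int_periodic_hart[of l] that by (simp add: int_periodic_def)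
  then show ?thesis
    using assms by (auto simp: is_trig_def trig_sum_def int_periodic_def)
qed

lemma L2_per_add: "f \<in> L2_per \<Longrightarrow> g \<in> L2_per \<Longrightarrow> (\<lambda>x. f x + g x) \<in> L2_per"
  unfolding L2_per_iff by (auto intro: square_integrable_add ae_periodic_compose2)

lemma L2_per_diff: "f \<in> L2_per \<Longrightarrow> g \<in> L2_per \<Longrightarrow> (\<lambda>x. f x - g x) \<in> L2_per"
  unfolding L2_per_iff by (auto intro: square_integrable_diff ae_periodic_compose2)

lemma L2_per_cmult: "f \<in> L2_per \<Longrightarrow> (\<lambda>x. c * f x) \<in> L2_per"
  unfolding L2_per_iff by (auto intro: square_integrable_cmult ae_periodic_compose[where h="\<lambda>y. c * y"])

lemma L2_per_const [simp]: "(\<lambda>x. c) \<in> L2_per"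
  by (intro bounded_L2_per[where C="\<bar>c\<bar>"]) auto

lemma L2_per_sum: "(\<And>i. i \<in> I \<Longrightarrow> f i \<in> L2_per) \<Longrightarrow> (\<lambda>x. \<Sum>i\<in>I. f i x) \<in> L2_per"
  by (induction I rule: infinite_finite_induct) (auto intro: L2_per_add)

lemma is_trig_L2_per: assumes "is_trig d f" shows "f \<in> L2_per"
proof -
  obtain a where f: "f = (\<lambda>x. \<Sum>k\<in>freq d. a k * hart k x)"
    using assms by (auto simp: is_trig_def trig_sum_def fun_eq_iff)
  show ?thesis unfolding f by (intro L2_per_sum L2_per_cmult hart_L2_per)
qed

lemma square_integrable_trig: "is_trig d f \<Longrightarrow> square_integrable cell f"
  by (intro L2_per_square_integrable is_trig_L2_per)

section \<open>Hartley coefficients\<close>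

definition coef :: "(real^'n \<Rightarrow> real) \<Rightarrow> int^'n \<Rightarrow> real" where
  "coef f k = inner_on cell f (hart k)"

lemma coef_add: "square_integrable cell f \<Longrightarrow> square_integrable cell g \<Longrightarrow>
    coef (\<lambda>x. f x + g x) k = coef f k + coef g k"
  by (simp add: coef_def inner_on_add)

lemma coef_diff: "square_integrable cell f \<Longrightarrow> square_integrable cell g \<Longrightarrow>
    coef (\<lambda>x. f x - g x) k = coef f k - coef g k"
  by (simp add: coef_def inner_on_diff)

lemma coef_cmult: "coef (\<lambda>x. c * f x) k = c * coef f k"
  by (simp add: coef_def inner_on_cmult)

lemma coef_sum: "(\<And>i. i \<in> I \<Longrightarrow> square_integrable cell (f i)) \<Longrightarrow>
    coef (\<lambda>x. \<Sum>i\<in>I. f i x) k = (\<Sum>i\<in>I. coef (f i) k)"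
  by (simp add: coef_def inner_on_sum)

lemma coef_hart: "coef (hart l) k = (if k = l then 1 else 0)"
  by (auto simp: coef_def inner_hart_hart)

lemma coef_const: "coef (\<lambda>x. c) k = (if k = 0 then c else 0)"
  using coef_cmult[of c "hart 0" k] coef_hart[of 0 k] by simp

lemma coef_0: "coef f 0 = integral\<^sup>L cell f"
  by (simp add: coef_def inner_on_def)

lemma coef_trig_sum: "coef (trig_sum d a) k = (if k \<in> freq d then a k else 0)"
proof -
  have "coef (trig_sum d a) k = (\<Sum>l\<in>freq d. coef (\<lambda>x. a l * hart l x) k)"
    unfolding trig_sum_def by (intro coef_sum square_integrable_cmult) simp
  also have "\<dots> = (\<Sum>l\<in>freq d. if k = l then a l else 0)"
    by (intro sum.cong) (auto simp: coef_cmult coef_hart)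
  finally show ?thesis by simp
qed

lemma is_trig_expand: assumes "is_trig d f" shows "f = trig_sum d (coef f)"
proof -
  obtain a where "f = trig_sum d a" using assms by (auto simp: is_trig_def)
  moreover have "trig_sum d (coef (trig_sum d a)) = trig_sum d a"
    by (auto simp: trig_sum_def[abs_def] coef_trig_sum[unfolded trig_sum_def[abs_def]])
  ultimately show ?thesis by simp
qed

lemma inner_trig_sum:
  assumes "square_integrable cell f"
  shows "inner_on cell (trig_sum d a) f = (\<Sum>k\<in>freq d. a k * coef f k)"
proof -
  have "inner_on cell (trig_sum d a) f = (\<Sum>k\<in>freq d. inner_on cell (\<lambda>x. a k * hart k x) f)"
    unfolding trig_sum_def using assms by (intro inner_on_sum square_integrable_cmult) auto
  then show ?thesis by (simp add: inner_on_cmult coef_def inner_on_commute[of _ f])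
qed

lemma norm_trig_sum: "(norm_on cell (trig_sum d a))\<^sup>2 = (\<Sum>k\<in>freq d. (a k)\<^sup>2)"
proof -
  have "square_integrable cell (trig_sum d a)" by (rule square_integrable_trig[OF is_trig_trig_sum])
  then show ?thesis
    by (subst norm_on_square, subst inner_trig_sum) (auto simp: coef_trig_sum power2_eq_square)
qed

lemma abs_coef_le: "square_integrable cell f \<Longrightarrow> \<bar>coef f k\<bar> \<le> norm_on cell f"
  using Cauchy_Schwarz_on[of cell f "hart k"] norm_on_square[of cell "hart k"]
  by (simp add: coef_def inner_hart_hart power2_eq_1_iff)
     (metis abs_1 abs_minus_cancel abs_of_nonneg mult.right_neutral norm_on_nonneg)

text \<open>There are at most (2 d + 1)^n coefficients, each bounded by the L2 norm, and Hartley
  functions are bounded by 2. Growth polynomial in the degree is what turns a geometrically small L2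
  norm into a uniformly small remainder in \<open>trig_solve\<close>.\<close>

lemma is_trig_sup_le:
  fixes f :: "real^'n \<Rightarrow> real"
  assumes "is_trig d f"
  shows "\<bar>f x\<bar> \<le> 2 * (2 * real d + 1) ^ CARD('n) * norm_on cell f"
proof -
  have "\<bar>f x\<bar> = \<bar>\<Sum>k\<in>freq d. coef f k * hart k x\<bar>"
    using is_trig_expand[OF assms] by (metis trig_sum_def)
  also have "\<dots> \<le> (\<Sum>k\<in>freq d. \<bar>coef f k * hart k x\<bar>)" by (rule sum_abs)
  also have "\<dots> \<le> (\<Sum>k\<in>(freq d :: (int^'n) set). norm_on cell f * 2)"
    unfolding abs_mult
    by (intro sum_mono mult_mono abs_coef_le abs_hart_le square_integrable_trig[OF assms]) auto
  also have "\<dots> = real (card (freq d :: (int^'n) set)) * (2 * norm_on cell f)" by simp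
  also have "\<dots> \<le> real ((2 * d + 1) ^ CARD('n)) * (2 * norm_on cell f)"
    using card_freq[where 'n='n, of d] by (intro mult_right_mono) (auto simp only: of_nat_le_iff, auto)
  finally show ?thesis by (simp add: algebra_simps)
qed

section \<open>Approximation by trigonometric polynomials\<close>


text \<open>
  Its normalized powers are nonnegative trigonometric polynomials concentrating at the lattice
  points. Convolution with them is an averaging, so it preserves pointwise norm bounds.
\<close>

definition bump :: "real^'n \<Rightarrow> real" where
  "bump z = (\<Prod>i\<in>UNIV. (1 + cos (2 * pi * z $ i)) / 2)"

lemma bump_factor_bounds: "0 \<le> (1 + cos t) / (2::real)" "(1 + cos t) / (2::real) \<le> 1"
  using cos_ge_minus_one[of t] cos_le_one[of t] by (simp, linarith, simp)

lemma bump_nonneg: "0 \<le> bump z"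
  unfolding bump_def by (intro prod_nonneg bump_factor_bounds)

lemma bump_le_1: "bump z \<le> 1"
  unfolding bump_def by (intro prod_le_1 conjI bump_factor_bounds)

lemma bump_power: "0 \<le> bump z ^ m" "bump z ^ m \<le> 1" "\<bar>bump z ^ m\<bar> \<le> 1"
  using bump_nonneg[of z] bump_le_1[of z] by (auto simp: power_le_one)

lemma bump_0 [simp]: "bump 0 = 1"
  by (simp add: bump_def)

lemma bump_minus: "bump (- z) = bump z"
  by (simp add: bump_def)

lemma continuous_bump [continuous_intros]: "continuous_on S bump"
  unfolding bump_def by (intro continuous_intros) auto

lemma bump_less_1:
  assumes "z $ i \<noteq> 0" "\<bar>z $ i\<bar> < 1"
  shows "bump z < 1"
proof -
  have "cos (2 * pi * z $ i) \<noteq> 1"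
  proof
    assume "cos (2 * pi * z $ i) = 1"
    then obtain m :: int where "2 * pi * z $ i = of_int m * 2 * pi" by (auto simp: cos_one_2pi_int)
    then have m: "z $ i = of_int m" by simp
    then have "\<bar>m\<bar> < 1" using assms(2) by linarith
    then show False using m assms(1) by simp
  qed
  then have "cos (2 * pi * z $ i) < 1" using cos_le_one[of "2 * pi * z $ i"] by linarith
  then have lt: "(1 + cos (2 * pi * z $ i)) / 2 < 1" by simp
  have "bump z = (1 + cos (2 * pi * z $ i)) / 2 * (\<Prod>j\<in>UNIV - {i}. (1 + cos (2 * pi * z $ j)) / 2)"
    unfolding bump_def by (rule prod.remove) auto
  also have "\<dots> \<le> (1 + cos (2 * pi * z $ i)) / 2 * 1"
    by (intro mult_left_mono prod_le_1 conjI bump_factor_bounds)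
  finally show ?thesis using lt by simp
qed

lemma is_trig_prod:
  assumes "finite I" "\<And>i. i \<in> I \<Longrightarrow> \<exists>d. is_trig d (f i)"
  shows "\<exists>d. is_trig d (\<lambda>x. \<Prod>i\<in>I. f i x)"
  using assms
proof (induction I rule: finite_induct)
  case empty
  then show ?case by (auto intro: is_trig_const)
next
  case (insert i I)
  then obtain e where "is_trig e (\<lambda>x. \<Prod>i\<in>I. f i x)" by auto
  moreover obtain d where "is_trig d (f i)" using insert.prems by blast
  ultimately have "is_trig d (f i)" "is_trig e (\<lambda>x. \<Prod>i\<in>I. f i x)" by auto
  from is_trig_mult[OF this] show ?case using insert by auto
qed

lemma is_trig_bump: "\<exists>d. is_trig d (bump :: real^'n \<Rightarrow> real)"
  unfolding bump_def
proof (rule is_trig_prod)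
  fix i :: 'n
  have "phase (axis i 1) z = 2 * pi * z $ i" for z
    by (simp add: phase_def int_vec_def axis_def inner_vec_def if_distrib[where f="\<lambda>x. x * _"]
        if_distrib[where f=of_int] cong: if_cong)
  then have e: "(\<lambda>z. (1 + cos (2 * pi * z $ i)) / 2)
      = (\<lambda>z. 1/2 + 1/4 * (hart (axis i 1) z + hart (- axis i 1) z))"
    by (auto simp: hart_def)
  have "axis i 1 \<in> (freq 1 :: (int^'n) set)" by (simp add: freq_def axis_def)
  then have "is_trig 1 (\<lambda>z. 1/2 + 1/4 * (hart (axis i 1 :: int^'n) z + hart (- axis i 1) z))"
    by (intro is_trig_add is_trig_const is_trig_cmult is_trig_hart) auto
  then show "\<exists>d. is_trig d (\<lambda>z::real^'n. (1 + cos (2 * pi * z $ i)) / 2)"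
    unfolding e by blast
qed auto

lemma is_trig_power: "\<exists>d. is_trig d f \<Longrightarrow> \<exists>d. is_trig d (\<lambda>x. f x ^ m)"
proof (induction m)
  case (Suc m)
  then obtain d e where "is_trig d f" "is_trig e (\<lambda>x. f x ^ m)" by auto
  from is_trig_mult[OF this] show ?case by auto
qed (auto intro: is_trig_const)

lemma norm_integral_le:
  fixes f :: "'a \<Rightarrow> 'b::{banach, second_countable_topology}"
  assumes "integrable M f" "integrable M g" "\<And>x. x \<in> space M \<Longrightarrow> norm (f x) \<le> g x"
  shows "norm (\<integral>x. f x \<partial>M) \<le> (\<integral>x. g x \<partial>M)"
  using integral_norm_bound[of M f] integral_mono[OF integrable_norm[OF assms(1)] assms(2,3)]
  by (rule order_trans)

lemma integrable_cell_bounded: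
  fixes f :: "real^'n \<Rightarrow> 'b::euclidean_space"
  assumes "f \<in> borel_measurable lebesgue" "\<And>x. norm (f x) \<le> C"
  shows "integrable cell f"
  using assms by (intro cell.integrable_const_bound[where B=C] measurable_cell) auto

text \<open>The addition theorem separates x from y in \<open>K (x - y)\<close>, so the integration
  only produces coefficients. It brings in the frequency - k beside k, which does not raise the
  degree.\<close>

lemma is_trig_convolution:
  fixes g :: "real^'n \<Rightarrow> real"
  assumes K: "is_trig d K" and g: "g \<in> borel_measurable lebesgue" "\<And>y. \<bar>g y\<bar> \<le> C"
  shows "is_trig d (\<lambda>x. \<integral>y. K (x - y) * g y \<partial>cell)"
proof -
  let ?c = "\<lambda>k. \<integral>y. cos (phase k y) * g y \<partial>cell" and ?s = "\<lambda>k. \<integral>y. sin (phase k y) * g y \<partial>cell"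
  have C: "0 \<le> C" using g(2)[of 0] abs_ge_zero[of "g 0"] by linarith
  have m: "(\<lambda>y. cos (phase k y)) \<in> borel_measurable lebesgue"
    "(\<lambda>y. sin (phase k y)) \<in> borel_measurable lebesgue" for k :: "int^'n"
    by (intro borel_measurable_continuous_lebesgue continuous_intros)+
  have i: "integrable cell (\<lambda>y. cos (phase k y) * g y)" "integrable cell (\<lambda>y. sin (phase k y) * g y)" for k
    using m[of k] g(1) C
    by (intro integrable_cell_bounded[where C="1 * C"];
        auto simp: abs_mult intro!: mult_mono[of _ 1 _ C, simplified] g(2) borel_measurable_times)+
  have "(\<integral>y. K (x - y) * g y \<partial>cell)
      = (\<Sum>k\<in>freq d. coef K k * (hart k x * ?c k - hart (- k) x * ?s k))" for x
  proof -
    have "(\<integral>y. K (x - y) * g y \<partial>cell) = (\<integral>y. (\<Sum>k\<in>freq d. coef K k *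
        (hart k x * (cos (phase k y) * g y) - hart (- k) x * (sin (phase k y) * g y))) \<partial>cell)"
      by (subst is_trig_expand[OF K])
         (simp add: trig_sum_def hart_diff_right sum_distrib_left algebra_simps)
    also have "\<dots> = (\<Sum>k\<in>freq d. coef K k * (hart k x * ?c k - hart (- k) x * ?s k))"
      using i by (simp add: Bochner_Integration.integral_sum)
    finally show ?thesis .
  qed
  moreover have "is_trig d (\<lambda>x. \<Sum>k\<in>freq d. coef K k * (?c k * hart k x - ?s k * hart (- k) x))"
    by (intro is_trig_sum is_trig_cmult is_trig_diff is_trig_hart) auto
  ultimately show ?thesis by (simp add: mult.commute)
qed

definition bump_mass :: "nat \<Rightarrow> (real^'n) itself \<Rightarrow> real" where
  "bump_mass m _ = (\<integral>y. bump (y :: real^'n) ^ m \<partial>cell)"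

definition mollify :: "nat \<Rightarrow> (real^'n \<Rightarrow> 'b::euclidean_space) \<Rightarrow> real^'n \<Rightarrow> 'b" where
  "mollify m g x = (\<integral>y. (bump (x - y) ^ m / bump_mass m TYPE(real^'n)) *\<^sub>R g y \<partial>cell)"

lemma continuous_bump_diff: "continuous_on S (\<lambda>y. bump (x - y) ^ m)"
  by (intro continuous_intros continuous_on_compose2[OF continuous_bump[of UNIV]]) auto

lemma integrable_bump [simp]: "integrable cell (\<lambda>y. bump (x - y) ^ m)"
  by (intro integrable_cell_bounded[where C=1] borel_measurable_continuous_lebesgue continuous_bump_diff)
     (simp add: bump_power del: power_abs)

lemma bump_mass_translate: "(\<integral>y. bump (x - y) ^ m \<partial>cell) = bump_mass m TYPE(real^'n)" for x :: "real^'n"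
proof -
  obtain d where "is_trig d (\<lambda>y::real^'n. bump y ^ m)" using is_trig_power[OF is_trig_bump] by blast
  then have "(\<integral>y. bump (y + (- x)) ^ m \<partial>cell) = bump_mass m TYPE(real^'n)"
    unfolding bump_mass_def
    by (intro integral_cell_translation is_trig_continuous is_trig_periodic) auto
  moreover have "bump (y + (- x)) = bump (x - y)" for y :: "real^'n"
    using bump_minus[of "x - y"] by simp
  ultimately show ?thesis by simp
qed

lemma unit_cell_measure_ball:
  fixes x :: "real^'n"
  assumes "\<rho> > 0" "ball x \<rho> \<subseteq> unit_cell"
  shows "measure cell (ball x \<rho>) > 0"
proof -
  have "measure cell (ball x \<rho>) = measure lborel (ball x \<rho>)"
    unfolding cell_def by (subst measure_restrict_space) (use assms in auto)
  also have "\<dots> > 0" using assms(1) by (rule content_ball_pos)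
  finally show ?thesis .
qed

text \<open>The mass decays at most like b^m for any lower bound b of \<open>bump\<close> on a small
  ball. When b exceeds the values of \<open>bump\<close> away from the peak, the normalized kernel
  decays geometrically there.\<close>

lemma bump_mass_lower:
  fixes x :: "real^'n"
  assumes "ball x \<rho> \<subseteq> unit_cell" "0 \<le> b" "\<And>y. y \<in> ball x \<rho> \<Longrightarrow> b \<le> bump (x - y)"
  shows "b ^ m * measure cell (ball x \<rho>) \<le> bump_mass m TYPE(real^'n)"
proof -
  have s: "ball x \<rho> \<in> sets cell"
    using assms(1) by (auto simp: cell_def sets_restrict_space_iff)
  have "b ^ m * measure cell (ball x \<rho>) = (\<integral>y. b ^ m * indicator (ball x \<rho>) y \<partial>cell)"
    using assms(1) s by (simp add: Int_absorb2 Int_absorb1)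
  also have "\<dots> \<le> (\<integral>y. bump (x - y) ^ m \<partial>cell)"
  proof (rule integral_mono)
    show "integrable cell (\<lambda>y. b ^ m * indicator (ball x \<rho>) y)"
      using s by (auto simp: less_top[symmetric] intro!: integrable_mult_right integrable_real_indicator)
    fix y show "b ^ m * indicator (ball x \<rho>) y \<le> bump (x - y) ^ m"
      using assms(2,3) bump_nonneg[of "x - y"] by (auto simp: indicator_def intro!: power_mono)
  qed simp
  finally show ?thesis by (simp add: bump_mass_translate)
qed

lemma unit_cell_ball:
  assumes "x \<in> unit_cell" obtains \<rho> where "\<rho> > 0" "ball x \<rho> \<subseteq> unit_cell"
  using assms by (metis open_box open_contains_ball unit_cell_box)

lemma unit_cell_nonempty: "(\<chi> i. 1/2) \<in> (unit_cell :: (real^'n) set)"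
  by (simp add: unit_cell_def)

lemma bump_near:
  assumes "b < 1" obtains \<rho> where "\<rho> > 0" "\<And>y. dist x y < \<rho> \<Longrightarrow> b < bump (x - y)"
proof -
  have "continuous_on UNIV (\<lambda>y. bump (x - y))"
    using continuous_bump_diff[of UNIV x 1] by simp
  then have "isCont (\<lambda>y. bump (x - y)) x" by (simp add: continuous_on_eq_continuous_at)
  then have "((\<lambda>y. bump (x - y)) \<longlongrightarrow> 1) (at x)" by (simp add: isCont_def)
  then have "eventually (\<lambda>y. b < bump (x - y)) (at x)" using assms by (rule order_tendstoD(1))
  then obtain \<rho> where "\<rho> > 0" "\<And>y. y \<noteq> x \<Longrightarrow> dist y x < \<rho> \<Longrightarrow> b < bump (x - y)"
    by (auto simp: eventually_at)
  then show thesis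
    using assms by (intro that[of \<rho>]) (metis bump_0 dist_commute right_minus_eq)+
qed

lemma bump_mass_pos: "bump_mass m TYPE(real^'n) > 0"
proof -
  let ?x = "(\<chi> i. 1/2) :: real^'n"
  obtain \<rho>1 where r1: "\<rho>1 > 0" "ball ?x \<rho>1 \<subseteq> unit_cell"
    using unit_cell_ball[OF unit_cell_nonempty] by blast
  obtain \<rho>2 where r2: "\<rho>2 > 0" "\<And>y. dist ?x y < \<rho>2 \<Longrightarrow> 1/2 < bump (?x - y)"
    using bump_near[of "1/2" ?x] by auto
  let ?r = "min \<rho>1 \<rho>2"
  have r: "?r > 0" "ball ?x ?r \<subseteq> unit_cell" using r1 r2(1) by auto
  have "0 < (1/2) ^ m * measure cell (ball ?x ?r)" using unit_cell_measure_ball[OF r] by simp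
  also have "\<dots> \<le> bump_mass m TYPE(real^'n)"
    using r(2) r2(2) by (intro bump_mass_lower) (auto intro: less_imp_le)
  finally show ?thesis .
qed

lemma integrable_mollify:
  fixes g :: "real^'n \<Rightarrow> 'b::euclidean_space"
  assumes "g \<in> borel_measurable lebesgue" "\<And>y. norm (g y) \<le> C"
  shows "integrable cell (\<lambda>y. (bump (x - y) ^ m / bump_mass m TYPE(real^'n)) *\<^sub>R g y)"
proof (rule integrable_cell_bounded)
  show "(\<lambda>y. (bump (x - y) ^ m / bump_mass m TYPE(real^'n)) *\<^sub>R g y) \<in> borel_measurable lebesgue"
    using assms(1) bump_mass_pos[where 'n='n, of m]
    by (intro borel_measurable_scaleR borel_measurable_continuous_lebesgue[OF continuous_on_divide]
        continuous_bump_diff continuous_on_const) auto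
  have C: "0 \<le> C" using assms(2)[of 0] norm_ge_zero[of "g 0"] by linarith
  show "norm ((bump (x - y) ^ m / bump_mass m TYPE(real^'n)) *\<^sub>R g y)
      \<le> (1 / bump_mass m TYPE(real^'n)) * C" for y
  proof -
    let ?M = "bump_mass m TYPE(real^'n)"
    have "norm ((bump (x - y) ^ m / ?M) *\<^sub>R g y) = bump (x - y) ^ m / ?M * norm (g y)"
      using bump_power(1)[of "x - y" m] bump_mass_pos[where 'n='n, of m]
      by (simp only: norm_scaleR abs_of_nonneg divide_nonneg_pos)
    also have "\<dots> \<le> 1 / ?M * C"
      using bump_power(2)[of "x - y" m] bump_mass_pos[where 'n='n, of m] assms(2)[of y]
      by (intro mult_mono divide_right_mono) auto
    finally show ?thesis .
  qed
qed

lemma norm_mollify_le: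
  fixes g :: "real^'n \<Rightarrow> 'b::euclidean_space"
  assumes g: "g \<in> borel_measurable lebesgue" "\<And>y. norm (g y) \<le> C"
  shows "norm (mollify m g x) \<le> C"
proof -
  let ?M = "bump_mass m TYPE(real^'n)"
  have "norm (mollify m g x) \<le> (\<integral>y. bump (x - y) ^ m / ?M * C \<partial>cell)"
    unfolding mollify_def
  proof (rule norm_integral_le)
    show "norm ((bump (x - y) ^ m / ?M) *\<^sub>R g y) \<le> bump (x - y) ^ m / ?M * C" for y
      using bump_nonneg[of "x - y"] bump_mass_pos[where 'n='n, of m] g(2)[of y]
      by (auto intro!: mult_left_mono divide_right_mono)
  qed (use integrable_mollify[OF g] in auto)
  also have "\<dots> = C" using bump_mass_pos[where 'n='n, of m] by (simp add: bump_mass_translate)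
  finally show ?thesis .
qed

lemma is_trig_mollify:
  fixes g :: "real^'n \<Rightarrow> 'b::euclidean_space"
  assumes g: "g \<in> borel_measurable lebesgue" "\<And>y. norm (g y) \<le> C"
  shows "\<exists>d. is_trig d (\<lambda>x. mollify m g x \<bullet> b)"
proof -
  let ?M = "bump_mass m TYPE(real^'n)"
  obtain d where d: "is_trig d (\<lambda>y::real^'n. bump y ^ m)" using is_trig_power[OF is_trig_bump] by blast
  have "is_trig d (\<lambda>x. (1 / ?M) * (\<integral>y. bump (x - y) ^ m * (g y \<bullet> b) \<partial>cell))"
  proof (intro is_trig_cmult is_trig_convolution[OF d])
    show "(\<lambda>y. g y \<bullet> b) \<in> borel_measurable lebesgue"
      using g(1) by (intro borel_measurable_inner) auto
    show "\<bar>g y \<bullet> b\<bar> \<le> C * norm b" for y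
      using Cauchy_Schwarz_ineq2[of "g y" b] mult_right_mono[OF g(2)[of y], of "norm b"] by simp
  qed
  moreover have "mollify m g x \<bullet> b = (1 / ?M) * (\<integral>y. bump (x - y) ^ m * (g y \<bullet> b) \<partial>cell)" for x
    unfolding mollify_def
    by (subst integral_inner_left[symmetric])
       (use integrable_mollify[OF g] in \<open>auto simp: field_simps\<close>)
  ultimately show ?thesis by auto
qed

text \<open>The integral is split at distance \<delta> from x. Nearby, continuity of
  \<open>g\<close> gives e / 2. Farther away the normalized kernel is at most (a / b)^m / v, where a
  bounds \<open>bump (x - y)\<close> there and b, with a < b < 1, is a lower bound on a ball of
  measure v around x.\<close>

lemma mollify_tendsto:
  fixes g :: "real^'n \<Rightarrow> 'b::euclidean_space"
  assumes g: "continuous_on UNIV g" "\<And>y. norm (g y) \<le> C" and x: "x \<in> unit_cell"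
  shows "(\<lambda>m. mollify m g x) \<longlonglongrightarrow> g x"
proof (rule LIMSEQ_I)
  fix e :: real assume e: "e > 0"
  have gm: "g \<in> borel_measurable lebesgue" by (rule borel_measurable_continuous_lebesgue[OF g(1)])
  have C: "0 \<le> C" using g(2)[of 0] norm_ge_zero[of "g 0"] by linarith
  obtain \<delta> where d: "\<delta> > 0" "\<And>y. dist y x < \<delta> \<Longrightarrow> dist (g y) (g x) < e / 2"
    using g(1) e by (metis UNIV_I continuous_on_iff half_gt_zero)
  define S where "S = cbox 0 (1 :: real^'n) - ball x \<delta>"
  have S: "compact S" unfolding S_def by (intro compact_diff) auto
  \<comment> \<open>As x is interior, its coordinates differ by less than 1 from those of any y in
    the closed cell. So x - y cannot be a nonzero lattice point, where \<open>bump\<close> returns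
    to 1.\<close>
  have lt: "bump (x - y) < 1" if "y \<in> S" for y
  proof -
    have y: "y \<in> cbox 0 1" "y \<noteq> x" using that d(1) by (auto simp: S_def)
    then obtain i where i: "y $ i \<noteq> x $ i" by (auto simp: vec_eq_iff)
    have "0 \<le> y $ i" "y $ i \<le> 1" using y(1) by (auto simp: mem_box_cart)
    moreover have "0 < x $ i" "x $ i < 1" using x by (auto simp: unit_cell_def)
    ultimately have "\<bar>(x - y) $ i\<bar> < 1" by auto
    then show ?thesis using i by (intro bump_less_1[of _ i]) auto
  qed
  obtain a where a: "0 \<le> a" "a < 1" "\<And>y. y \<in> S \<Longrightarrow> bump (x - y) \<le> a"
  proof (cases "S = {}")
    case True then show thesis by (intro that[of 0]) auto
  next
    case False
    have "continuous_on S (\<lambda>y. bump (x - y))" using continuous_bump_diff[of S x 1] by simp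
    then obtain y0 where "y0 \<in> S" "\<And>y. y \<in> S \<Longrightarrow> bump (x - y) \<le> bump (x - y0)"
      using continuous_attains_sup[OF S False] by blast
    then show thesis using lt bump_nonneg by (intro that[of "bump (x - y0)"]) auto
  qed
  obtain b where b: "a < b" "b < 1" using dense[OF a(2)] by blast
  then have b0: "0 < b" using a(1) by linarith
  obtain \<rho>1 where r1: "\<rho>1 > 0" "ball x \<rho>1 \<subseteq> unit_cell" using unit_cell_ball[OF x] by blast
  obtain \<rho>2 where r2: "\<rho>2 > 0" "\<And>y. dist x y < \<rho>2 \<Longrightarrow> b < bump (x - y)"
    using bump_near[OF b(2)] by blast
  define \<rho> where "\<rho> = min \<rho>1 \<rho>2"
  have r: "\<rho> > 0" "ball x \<rho> \<subseteq> unit_cell" using r1 r2(1) by (auto simp: \<rho>_def)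
  define v where "v = measure cell (ball x \<rho>)"
  have v: "v > 0" using unit_cell_measure_ball[OF r] by (simp add: v_def)
  have low: "b ^ m * v \<le> bump_mass m TYPE(real^'n)" for m
    unfolding v_def using r(2) r2(2) b0 by (intro bump_mass_lower) (auto simp: \<rho>_def intro: less_imp_le)
  have bound: "norm (mollify m g x - g x) \<le> e / 2 + 2 * C / v * (a / b) ^ m" for m
  proof -
    let ?M = "bump_mass m TYPE(real^'n)"
    have M: "?M > 0" by (rule bump_mass_pos)
    let ?k = "\<lambda>y. bump (x - y) ^ m / ?M"
    have k0: "0 \<le> ?k y" for y using bump_nonneg[of "x - y"] M by simp
    have ki: "integrable cell ?k" by simp
    have k1: "(\<integral>y. ?k y \<partial>cell) = 1" using M by (simp add: bump_mass_translate)
    have "(\<integral>y. ?k y *\<^sub>R g x \<partial>cell) = (\<integral>y. ?k y \<partial>cell) *\<^sub>R g x"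
      by (rule integral_scaleR_left) (rule ki)
    then have "mollify m g x - g x = (\<integral>y. ?k y *\<^sub>R g y \<partial>cell) - (\<integral>y. ?k y *\<^sub>R g x \<partial>cell)"
      using k1 by (simp add: mollify_def)
    also have "\<dots> = (\<integral>y. ?k y *\<^sub>R g y - ?k y *\<^sub>R g x \<partial>cell)"
      by (rule Bochner_Integration.integral_diff[symmetric])
         (use integrable_mollify[OF gm g(2)] ki in \<open>auto intro!: integrable_scaleR_left\<close>)
    also have "norm \<dots> \<le> (\<integral>y. ?k y * (e / 2) + 2 * C * (a ^ m / ?M) \<partial>cell)"
    proof (rule norm_integral_le)
      show "integrable cell (\<lambda>y. ?k y *\<^sub>R g y - ?k y *\<^sub>R g x)"
        using integrable_mollify[OF gm g(2)] ki
        by (intro Bochner_Integration.integrable_diff integrable_scaleR_left)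
      show "integrable cell (\<lambda>y. ?k y * (e / 2) + 2 * C * (a ^ m / ?M))"
        using ki by (intro Bochner_Integration.integrable_add integrable_mult_left) auto
      fix y :: "real^'n" assume "y \<in> space cell"
      then have y: "y \<in> cbox 0 1" by (auto simp: unit_cell_def mem_box_cart less_imp_le)
      have eq: "norm (?k y *\<^sub>R g y - ?k y *\<^sub>R g x) = ?k y * norm (g y - g x)"
        using k0[of y] by (simp only: scaleR_diff_right[symmetric] norm_scaleR abs_of_nonneg)
      show "norm (?k y *\<^sub>R g y - ?k y *\<^sub>R g x) \<le> ?k y * (e / 2) + 2 * C * (a ^ m / ?M)"
      proof (cases "dist x y < \<delta>")
        case True
        then have "norm (g y - g x) \<le> e / 2" using d(2)[of y] by (simp add: dist_norm norm_minus_commute)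
        then have "?k y * norm (g y - g x) \<le> ?k y * (e / 2)" using k0 by (rule mult_left_mono)
        moreover have "0 \<le> 2 * C * (a ^ m / ?M)" using C a(1) M by simp
        ultimately show ?thesis unfolding eq by linarith
      next
        case False
        then have "y \<in> S" using y by (simp add: S_def)
        then have "?k y \<le> a ^ m / ?M"
          using a(3)[of y] bump_nonneg[of "x - y"] M by (intro divide_right_mono power_mono) auto
        moreover have "norm (g y - g x) \<le> 2 * C"
          using norm_triangle_ineq4[of "g y" "g x"] g(2)[of y] g(2)[of x] by linarith
        ultimately have "?k y * norm (g y - g x) \<le> (a ^ m / ?M) * (2 * C)"
          using a(1) M by (intro mult_mono) auto
        moreover have "0 \<le> ?k y * (e / 2)" using k0[of y] e by (intro mult_nonneg_nonneg) auto
        ultimately show ?thesis unfolding eq by (simp add: mult.commute)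
      qed
    qed
    also have "\<dots> = (\<integral>y. ?k y \<partial>cell) * (e / 2) + 2 * C * (a ^ m / ?M)"
      using ki by (subst Bochner_Integration.integral_add) auto
    also have "\<dots> \<le> e / 2 + 2 * C * (a ^ m / (b ^ m * v))"
      unfolding k1 using low[of m] C a(1) v b0 M
      by (intro add_mono mult_left_mono divide_left_mono) auto
    also have "\<dots> = e / 2 + 2 * C / v * (a / b) ^ m" by (simp add: power_divide)
    finally show ?thesis .
  qed
  have "(\<lambda>m. 2 * C / v * (a / b) ^ m) \<longlonglongrightarrow> 2 * C / v * 0"
    using a(1) b b0 by (intro tendsto_mult tendsto_const LIMSEQ_realpow_zero) auto
  then have "(\<lambda>m. 2 * C / v * (a / b) ^ m) \<longlonglongrightarrow> 0" by simp
  then have "eventually (\<lambda>m. 2 * C / v * (a / b) ^ m < e / 2) sequentially"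
    using e by (intro order_tendstoD(2)) auto
  then obtain N where "\<And>m. m \<ge> N \<Longrightarrow> 2 * C / v * (a / b) ^ m < e / 2"
    by (auto simp: eventually_sequentially)
  then have "norm (mollify m g x - g x) < e" if "m \<ge> N" for m
    using bound[of m] that by fastforce
  then show "\<exists>no. \<forall>m\<ge>no. norm (mollify m g x - g x) < e" by blast
qed

section \<open>Parseval and Riesz--Fischer\<close>


lemma continuous_trig_vector:
  fixes p :: "real^'n \<Rightarrow> 'b::euclidean_space"
  assumes "\<And>b. \<exists>d. is_trig d (\<lambda>x. p x \<bullet> b)"
  shows "continuous_on UNIV p"
  using assms is_trig_continuous by (subst continuous_on_componentwise) blast

text \<open>Continuous functions tending to \<open>f\<close> almost everywhere are projected onto
  the ball of radius C and then mollified. Mollification converges only for fixed n, so for each n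
  an index with L1 error below 2^-n is chosen, and a subsequence converges almost everywhere. That
  the bound C holds exactly, and not merely in the limit, is what later keeps |I - Q| \<le> theta
  for the approximating matrices.\<close>

lemma trig_approx:
  fixes f :: "real^'n \<Rightarrow> 'b::euclidean_space"
  assumes f: "f \<in> borel_measurable lebesgue" and b: "AE x in lebesgue. norm (f x) \<le> C" and C: "0 \<le> C"
  obtains p :: "nat \<Rightarrow> real^'n \<Rightarrow> 'b" where
    "\<And>m b. \<exists>d. is_trig d (\<lambda>x. p m x \<bullet> b)" "\<And>m x. norm (p m x) \<le> C"
    "AE x in cell. (\<lambda>m. p m x) \<longlonglongrightarrow> f x"
proof -
  obtain N g where N: "negligible N" and g: "\<And>n. continuous_on UNIV (g n)"
    and lim: "\<And>x. x \<notin> N \<Longrightarrow> (\<lambda>n. g n x) \<longlonglongrightarrow> f x"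
    using lebesgue_measurable_imp_measurable_on[OF f, of UNIV] by (auto simp: measurable_on_def)
  define c where "c = closest_point (cball (0::'b) C)"
  have c: "continuous_on UNIV c" unfolding c_def
    using C by (intro continuous_on_closest_point) auto
  have cC: "norm (c y) \<le> C" for y
    using closest_point_in_set[of "cball (0::'b) C" y] C by (auto simp: c_def)
  have cid: "c y = y" if "norm y \<le> C" for y
    using that by (simp add: c_def closest_point_self)
  define h where "h n x = c (g n x)" for n x
  have h: "continuous_on UNIV (h n)" "norm (h n x) \<le> C" for n x
    using c g[of n] cC by (auto simp: h_def[abs_def] intro: continuous_on_compose2)
  have hm: "h n \<in> borel_measurable lebesgue" for n
    by (rule borel_measurable_continuous_lebesgue[OF h(1)])
  have "AE x in lebesgue. x \<notin> N"
    using N by (auto simp: negligible_iff_null_sets intro: AE_not_in)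
  then have hlim: "AE x in lebesgue. (\<lambda>n. h n x) \<longlonglongrightarrow> f x"
    using b
  proof eventually_elim
    case (elim x)
    have "(\<lambda>n. c (g n x)) \<longlonglongrightarrow> c (f x)"
      using c lim[OF elim(1)] by (intro continuous_on_tendsto_compose[OF c]) auto
    then show ?case using cid[OF elim(2)] by (simp add: h_def)
  qed
  have mc: "continuous_on UNIV (mollify m (h n))" for m n
    using is_trig_mollify[OF hm h(2)] by (rule continuous_trig_vector)
  have mm: "mollify m (h n) \<in> borel_measurable cell" for m n
    by (intro measurable_cell borel_measurable_continuous_lebesgue mc)
  have mC: "norm (mollify m (h n) x) \<le> C" for m n x
    by (rule norm_mollify_le[OF hm h(2)])
  have hm': "h n \<in> borel_measurable cell" "f \<in> borel_measurable cell" for n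
    using hm f by (auto intro: measurable_cell)
  have bC: "AE x in cell. norm (f x) \<le> C" by (rule AE_cell[OF b])
  have nd: "norm (y - z) \<le> 2 * C" if "norm y \<le> C" "norm z \<le> C" for y z :: 'b
    using norm_triangle_ineq4[of y z] that by linarith
  have "\<exists>m. (\<integral>x. norm (mollify m (h n) x - h n x) \<partial>cell) < (1/2)^n" for n
  proof -
    have "(\<lambda>m. \<integral>x. norm (mollify m (h n) x - h n x) \<partial>cell) \<longlonglongrightarrow> (\<integral>x. 0 \<partial>(cell :: (real^'n) measure))"
    proof (rule integral_dominated_convergence[where w="\<lambda>_. 2 * C"])
      show "AE x in cell. (\<lambda>m. norm (mollify m (h n) x - h n x)) \<longlonglongrightarrow> 0"
      proof (rule AE_I2)
        fix x :: "real^'n" assume "x \<in> space cell"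
        then have "(\<lambda>m. mollify m (h n) x) \<longlonglongrightarrow> h n x"
          by (intro mollify_tendsto[OF h]) simp
        then show "(\<lambda>m. norm (mollify m (h n) x - h n x)) \<longlonglongrightarrow> 0"
          by (intro tendsto_norm_zero) (simp add: LIM_zero)
      qed
    qed (use mm hm' nd[OF mC h(2)] in auto)
    then have "eventually (\<lambda>m. (\<integral>x. norm (mollify m (h n) x - h n x) \<partial>cell) < (1/2)^n) sequentially"
      by (intro order_tendstoD(2)) auto
    then show ?thesis by (auto simp: eventually_sequentially)
  qed
  then obtain m where m: "\<And>n. (\<integral>x. norm (mollify (m n) (h n) x - h n x) \<partial>cell) < (1/2)^n" by metis
  define u where "u n = mollify (m n) (h n)" for n
  have um: "u n \<in> borel_measurable cell" "norm (u n x) \<le> C" for n x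
    using mm mC by (auto simp: u_def)
  have hf: "(\<lambda>n. \<integral>x. norm (h n x - f x) \<partial>cell) \<longlonglongrightarrow> (\<integral>x. 0 \<partial>(cell :: (real^'n) measure))"
  proof (rule integral_dominated_convergence[where w="\<lambda>_. 2 * C"])
    show "AE x in cell. (\<lambda>n. norm (h n x - f x)) \<longlonglongrightarrow> 0"
      using AE_cell[OF hlim] by eventually_elim (simp add: LIM_zero tendsto_norm_zero)
    show "AE x in cell. norm (norm (h i x - f x)) \<le> 2 * C" for i
      using bC by eventually_elim (use nd h(2) in auto)
  qed (use hm' in auto)
  have i1: "integrable cell (\<lambda>x. norm (u n x - h n x))" for n
    by (rule cell.integrable_const_bound[where B="2 * C"]) (use um hm' nd[OF um(2) h(2)] in auto)
  have i2: "integrable cell (\<lambda>x. norm (h n x - f x))" for n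
  proof (rule cell.integrable_const_bound[where B="2 * C"])
    show "AE x in cell. norm (norm (h n x - f x)) \<le> 2 * C"
      using bC by eventually_elim (use nd h(2) in auto)
  qed (use hm' in auto)
  have i3: "integrable cell (\<lambda>x. u n x - f x)" for n
  proof (rule cell.integrable_const_bound[where B="2 * C"])
    show "AE x in cell. norm (u n x - f x) \<le> 2 * C"
      using bC by eventually_elim (use nd um(2) in auto)
  qed (use um hm' in auto)
  have le: "(\<integral>x. norm (u n x - f x) \<partial>cell) \<le> (1/2)^n + (\<integral>x. norm (h n x - f x) \<partial>cell)" for n
  proof -
    have "(\<integral>x. norm (u n x - f x) \<partial>cell)
        \<le> (\<integral>x. norm (u n x - h n x) + norm (h n x - f x) \<partial>cell)"
    proof (rule integral_mono)
      show "norm (u n x - f x) \<le> norm (u n x - h n x) + norm (h n x - f x)" for x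
        using norm_triangle_ineq[of "u n x - h n x" "h n x - f x"] by simp
    qed (use i1[of n] i2[of n] integrable_norm[OF i3[of n]] in auto)
    also have "\<dots> = (\<integral>x. norm (u n x - h n x) \<partial>cell) + (\<integral>x. norm (h n x - f x) \<partial>cell)"
      using i1 i2 by (intro Bochner_Integration.integral_add)
    finally show ?thesis using m[of n] by (simp add: u_def)
  qed
  have "(\<lambda>n. (1/2)^n + (\<integral>x. norm (h n x - f x) \<partial>cell)) \<longlonglongrightarrow> 0 + (\<integral>x. 0 \<partial>(cell :: (real^'n) measure))"
    by (intro tendsto_add hf LIMSEQ_realpow_zero) auto
  then have "(\<lambda>n. (1/2)^n + (\<integral>x. norm (h n x - f x) \<partial>cell)) \<longlonglongrightarrow> 0" by simp
  then have "(\<lambda>n. \<integral>x. norm (u n x - f x) \<partial>cell) \<longlonglongrightarrow> 0"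
    by (rule tendsto_sandwich[OF _ _ tendsto_const, rotated 2]) (use le in auto)
  then obtain r :: "nat \<Rightarrow> nat" where r: "AE x in cell. (\<lambda>n. u (r n) x - f x) \<longlonglongrightarrow> 0"
    using tendsto_L1_AE_subseq[of cell "\<lambda>n x. u n x - f x", OF i3] by blast
  show thesis
  proof (rule that[of "\<lambda>n. u (r n)"])
    show "\<exists>d. is_trig d (\<lambda>x. u (r n) x \<bullet> b)" for n b
      unfolding u_def by (rule is_trig_mollify[OF hm h(2)])
    show "AE x in cell. (\<lambda>n. u (r n) x) \<longlonglongrightarrow> f x"
      using r by eventually_elim (rule LIM_zero_cancel)
  qed (rule um(2))
qed

lemma norm_on_dominated_convergence:
  assumes w: "square_integrable M w" and "\<And>n. u n \<in> borel_measurable M" "f \<in> borel_measurable M"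
    and lim: "AE x in M. (\<lambda>n. u n x) \<longlonglongrightarrow> f x"
    and b: "\<And>n. AE x in M. \<bar>u n x - f x\<bar> \<le> \<bar>w x\<bar>"
  shows "(\<lambda>n. norm_on M (\<lambda>x. u n x - f x)) \<longlonglongrightarrow> 0"
proof -
  have "(\<lambda>n. \<integral>x. (u n x - f x)\<^sup>2 \<partial>M) \<longlonglongrightarrow> (\<integral>x. 0 \<partial>M)"
  proof (rule integral_dominated_convergence[where w="\<lambda>x. (w x)\<^sup>2"])
    show "AE x in M. (\<lambda>n. (u n x - f x)\<^sup>2) \<longlonglongrightarrow> 0"
      using lim
    proof eventually_elim
      case (elim x)
      then have "(\<lambda>n. (u n x - f x)\<^sup>2) \<longlonglongrightarrow> (f x - f x)\<^sup>2" by (intro tendsto_intros)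
      then show ?case by simp
    qed
    show "AE x in M. norm ((u n x - f x)\<^sup>2) \<le> (w x)\<^sup>2" for n
      using b[of n] by eventually_elim (simp add: abs_le_square_iff)
  qed (use assms in \<open>auto simp: square_integrable_def\<close>)
  then have "(\<lambda>n. sqrt (\<integral>x. (u n x - f x)\<^sup>2 \<partial>M)) \<longlonglongrightarrow> sqrt 0"
    by (intro tendsto_real_sqrt) simp
  then show ?thesis by (simp add: norm_on_def)
qed

text \<open>Cutting off large values makes \<open>trig_approx\<close> applicable; both errors vanish
  by dominated convergence.\<close>

lemma trig_dense:
  assumes f: "f \<in> L2_per" and e: "e > 0"
  obtains d t where "is_trig d t" "norm_on cell (\<lambda>x. f x - t x) < e"
proof -
  have fm: "f \<in> borel_measurable lebesgue" and fs: "square_integrable cell f"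
    using f by (auto simp: L2_per_iff)
  define g where "g n x = (if \<bar>f x\<bar> \<le> real n then f x else 0)" for n x
  have gm: "g n \<in> borel_measurable lebesgue" for n
    unfolding g_def[abs_def] using fm by measurable
  have gb: "\<bar>g n x\<bar> \<le> real n" for n x by (auto simp: g_def)
  have "(\<lambda>n. norm_on cell (\<lambda>x. g n x - f x)) \<longlonglongrightarrow> 0"
  proof (rule norm_on_dominated_convergence[OF fs])
    show "AE x in cell. (\<lambda>n. g n x) \<longlonglongrightarrow> f x"
    proof (rule AE_I2)
      fix x :: "real^'a"
      obtain N :: nat where "\<bar>f x\<bar> \<le> real N" using real_arch_simple by blast
      then have "eventually (\<lambda>n. g n x = f x) sequentially"
        unfolding eventually_sequentially g_def by (intro exI[of _ N]) auto
      then show "(\<lambda>n. g n x) \<longlonglongrightarrow> f x" by (rule tendsto_eventually)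
    qed
  qed (use gm fm in \<open>auto simp: g_def intro: measurable_cell\<close>)
  then have "eventually (\<lambda>n. norm_on cell (\<lambda>x. g n x - f x) < e / 2) sequentially"
    using e by (intro order_tendstoD(2)) auto
  then obtain n where n: "norm_on cell (\<lambda>x. g n x - f x) < e / 2"
    by (auto simp: eventually_sequentially)
  obtain p :: "nat \<Rightarrow> real^'a \<Rightarrow> real" where p: "\<And>m b. \<exists>d. is_trig d (\<lambda>x. p m x \<bullet> b)"
    "\<And>m x. norm (p m x) \<le> real n" "AE x in cell. (\<lambda>m. p m x) \<longlonglongrightarrow> g n x"
    by (rule trig_approx[OF gm, of n "real n"]) (use gb in auto)
  have pt: "\<exists>d. is_trig d (p m)" for m using p(1)[of m 1] by simp
  have ps: "square_integrable cell (p m)" for m using pt square_integrable_trig by blast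
  have gs: "square_integrable cell (g n)"
    by (rule cell.square_integrable_bounded[OF measurable_cell[OF gm]]) (use gb in auto)
  have "(\<lambda>m. norm_on cell (\<lambda>x. p m x - g n x)) \<longlonglongrightarrow> 0"
  proof (rule norm_on_dominated_convergence[OF _ _ _ p(3)])
    show "square_integrable cell (\<lambda>x. 2 * real n)"
      by (rule cell.square_integrable_bounded[where C="2 * real n"]) auto
    show "AE x in cell. \<bar>p m x - g n x\<bar> \<le> \<bar>2 * real n\<bar>" for m
    proof (rule AE_I2)
      fix x show "\<bar>p m x - g n x\<bar> \<le> \<bar>2 * real n\<bar>"
        using p(2)[of m x] gb[of n x] unfolding real_norm_def by linarith
    qed
  qed (use ps gm in \<open>auto intro: measurable_cell simp: square_integrable_def\<close>)
  then have "eventually (\<lambda>m. norm_on cell (\<lambda>x. p m x - g n x) < e / 2) sequentially"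
    using e by (intro order_tendstoD(2)) auto
  then obtain m where m: "norm_on cell (\<lambda>x. p m x - g n x) < e / 2"
    by (auto simp: eventually_sequentially)
  obtain d where d: "is_trig d (p m)" using pt by blast
  have "norm_on cell (\<lambda>x. f x - p m x) = norm_on cell (\<lambda>x. p m x - f x)"
    by (rule norm_on_minus_commute)
  also have "\<dots> = norm_on cell (\<lambda>x. (p m x - g n x) + (g n x - f x))" by simp
  also have "\<dots> \<le> norm_on cell (\<lambda>x. p m x - g n x) + norm_on cell (\<lambda>x. g n x - f x)"
    by (intro norm_on_triangle square_integrable_diff ps gs fs)
  also have "\<dots> < e" using n m by simp
  finally show thesis using that d by blast
qed

lemma square_integrable_trig_sum [simp]: "square_integrable cell (trig_sum d a)"
  by (rule square_integrable_trig[OF is_trig_trig_sum])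

text \<open>The residual of the partial sum is orthogonal to every trigonometric polynomial of
  degree d, in particular to the partial sum minus \<open>t\<close>; Pythagoras does the
  rest.\<close>

lemma trig_sum_best_approx:
  assumes f: "square_integrable cell f" and t: "is_trig d t"
  shows "norm_on cell (\<lambda>x. f x - trig_sum d (coef f) x) \<le> norm_on cell (\<lambda>x. f x - t x)"
proof -
  let ?S = "trig_sum d (coef f)"
  let ?u = "\<lambda>x. f x - ?S x" and ?v = "\<lambda>x. ?S x - t x"
  have u: "square_integrable cell ?u" using f by (intro square_integrable_diff) auto
  have v: "square_integrable cell ?v" by (intro square_integrable_diff square_integrable_trig_sum square_integrable_trig[OF t])
  have "is_trig d ?v" using t by (intro is_trig_diff) auto
  then have "inner_on cell ?v ?u = (\<Sum>k\<in>freq d. coef ?v k * coef ?u k)"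
    using inner_trig_sum[OF u, of d "coef ?v"] is_trig_expand[of d ?v] by simp
  also have "\<dots> = 0"
    using f by (intro sum.neutral) (simp add: coef_diff coef_trig_sum)
  finally have o: "inner_on cell ?v ?u = 0" .
  have "(norm_on cell ?u)\<^sup>2 \<le> (norm_on cell (\<lambda>x. ?u x + ?v x))\<^sup>2"
  proof -
    have uv: "square_integrable cell (\<lambda>x. ?u x + ?v x)" by (rule square_integrable_add[OF u v])
    have "(norm_on cell (\<lambda>x. ?u x + ?v x))\<^sup>2
        = inner_on cell ?u (\<lambda>x. ?u x + ?v x) + inner_on cell ?v (\<lambda>x. ?u x + ?v x)"
      unfolding norm_on_square by (rule inner_on_add[OF u v uv])
    also have "inner_on cell ?u (\<lambda>x. ?u x + ?v x) = inner_on cell ?u ?u + inner_on cell ?v ?u"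
      by (subst inner_on_commute, rule inner_on_add[OF u v u])
    also have "inner_on cell ?v (\<lambda>x. ?u x + ?v x) = inner_on cell ?u ?v + inner_on cell ?v ?v"
      by (subst inner_on_commute, rule inner_on_add[OF u v v])
    also have "inner_on cell ?u ?v = inner_on cell ?v ?u" by (rule inner_on_commute)
    finally have "(norm_on cell (\<lambda>x. ?u x + ?v x))\<^sup>2 = (norm_on cell ?u)\<^sup>2 + (norm_on cell ?v)\<^sup>2"
      unfolding o norm_on_square by simp
    then show ?thesis by simp
  qed
  then have "norm_on cell ?u \<le> norm_on cell (\<lambda>x. ?u x + ?v x)"
    by (rule power2_le_imp_le) simp
  then show ?thesis by simp
qed

lemma trig_sum_coef_tendsto:
  assumes f: "f \<in> L2_per"
  shows "(\<lambda>d. norm_on cell (\<lambda>x. f x - trig_sum d (coef f) x)) \<longlonglongrightarrow> 0"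
proof (rule LIMSEQ_I)
  fix e :: real assume "e > 0"
  then obtain d t where t: "is_trig d t" "norm_on cell (\<lambda>x. f x - t x) < e"
    by (rule trig_dense[OF f])
  have "norm_on cell (\<lambda>x. f x - trig_sum m (coef f) x) < e" if "m \<ge> d" for m
    using trig_sum_best_approx[OF L2_per_square_integrable[OF f] is_trig_mono[OF t(1) that]] t(2)
    by linarith
  then show "\<exists>no. \<forall>m\<ge>no. norm (norm_on cell (\<lambda>x. f x - trig_sum m (coef f) x) - 0) < e"
    by auto
qed

text \<open>Sums over the lattice are limits along the cubes \<open>freq d\<close>, so identities
  between multipliers can be proved by rearranging finite sums before the limit is taken.\<close>

lemma Parseval_inner:
  assumes f: "f \<in> L2_per" and g: "g \<in> L2_per"
  shows "(\<lambda>d. \<Sum>k\<in>freq d. coef f k * coef g k) \<longlonglongrightarrow> inner_on cell f g"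
proof -
  have fs: "square_integrable cell f" and gs: "square_integrable cell g"
    using f g by (auto intro: L2_per_square_integrable)
  have le: "norm ((\<Sum>k\<in>freq d. coef f k * coef g k) - inner_on cell f g)
      \<le> norm_on cell (\<lambda>x. f x - trig_sum d (coef f) x) * norm_on cell g" for d
  proof -
    have "(\<Sum>k\<in>freq d. coef f k * coef g k) = inner_on cell (trig_sum d (coef f)) g"
      by (rule inner_trig_sum[OF gs, symmetric])
    moreover have "inner_on cell (\<lambda>x. f x - trig_sum d (coef f) x) g
        = inner_on cell f g - inner_on cell (trig_sum d (coef f)) g"
      using fs gs by (intro inner_on_diff) auto
    ultimately show ?thesis
      using Cauchy_Schwarz_on[OF square_integrable_diff[OF fs square_integrable_trig_sum] gs, of d "coef f"]
      by simp
  qed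
  have "(\<lambda>d. norm_on cell (\<lambda>x. f x - trig_sum d (coef f) x) * norm_on cell g) \<longlonglongrightarrow> 0 * norm_on cell g"
    by (intro tendsto_mult tendsto_const trig_sum_coef_tendsto f)
  then have 0: "(\<lambda>d. norm_on cell (\<lambda>x. f x - trig_sum d (coef f) x) * norm_on cell g) \<longlonglongrightarrow> 0"
    by (simp only: mult_zero_left)
  have "(\<lambda>d. (\<Sum>k\<in>freq d. coef f k * coef g k) - inner_on cell f g) \<longlonglongrightarrow> 0"
    by (rule Lim_null_comparison[OF always_eventually[OF allI[OF le]] 0])
  then show ?thesis by (rule LIM_zero_cancel)
qed

lemma Parseval_norm:
  "f \<in> L2_per \<Longrightarrow> (\<lambda>d. \<Sum>k\<in>freq d. (coef f k)\<^sup>2) \<longlonglongrightarrow> (norm_on cell f)\<^sup>2"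
  unfolding norm_on_square using Parseval_inner[of f f] by (simp only: power2_eq_square)

lemma freq_Suc: "k \<in> freq n \<Longrightarrow> k \<in> freq (Suc n)"
  using freq_mono[of n "Suc n"] by auto

lemma Bessel: assumes "f \<in> L2_per" shows "(\<Sum>k\<in>freq d. (coef f k)\<^sup>2) \<le> (norm_on cell f)\<^sup>2"
proof (rule incseq_le[OF _ Parseval_norm[OF assms]])
  show "incseq (\<lambda>d. \<Sum>k\<in>freq d. (coef f k)\<^sup>2)"
    by (intro incseq_SucI sum_mono2) (auto intro: freq_Suc)
qed

text \<open>Completeness of the Hartley system; periodicity carries the equality from the cell to
  the whole space.\<close>

lemma coef_eq_imp_AE:
  assumes f: "f \<in> L2_per" and g: "g \<in> L2_per" and eq: "\<And>k. coef f k = coef g k"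
  shows "AE x in lebesgue. f x = g x"
proof -
  let ?h = "\<lambda>x. f x - g x"
  have s: "square_integrable cell f" "square_integrable cell g"
    using f g by (auto intro: L2_per_square_integrable)
  have h: "?h \<in> L2_per" by (rule L2_per_diff[OF f g])
  have "coef ?h k = 0" for k using s eq by (simp add: coef_diff)
  then have "(\<lambda>d. 0) \<longlonglongrightarrow> (norm_on cell ?h)\<^sup>2" using Parseval_norm[OF h] by simp
  then have "norm_on cell ?h = 0" by (simp add: LIMSEQ_const_iff)
  then have "AE x in cell. ?h x = 0"
    by (rule norm_on_eq_0[OF square_integrable_diff[OF s]])
  then show ?thesis
    using f g by (intro ae_periodic_eq_AE) (auto simp: L2_per_iff)
qed

lemma L2_per_complete:
  assumes u: "\<And>n. u n \<in> L2_per"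
    and Cau': "\<And>e. e > 0 \<Longrightarrow> \<exists>N. \<forall>n\<ge>N. \<forall>m\<ge>n. norm_on cell (\<lambda>x. u m x - u n x) \<le> e"
  obtains f where "f \<in> L2_per" "(\<lambda>n. norm_on cell (\<lambda>x. u n x - f x)) \<longlonglongrightarrow> 0"
proof -
  have us: "square_integrable cell (u n)" and um: "u n \<in> borel_measurable lebesgue"
    and up: "ae_periodic (u n)" for n
    using u by (auto simp: L2_per_iff)
  have Cau: "\<exists>N. \<forall>m\<ge>N. \<forall>n\<ge>N. norm_on cell (\<lambda>x. u m x - u n x) \<le> e" if e: "e > 0" for e
  proof -
    obtain N where N: "\<And>m n. n \<ge> N \<Longrightarrow> m \<ge> n \<Longrightarrow> norm_on cell (\<lambda>x. u m x - u n x) \<le> e"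
      using Cau'[OF e] by blast
    have "norm_on cell (\<lambda>x. u m x - u n x) \<le> e" if mn: "m \<ge> N" "n \<ge> N" for m n
    proof (cases "n \<le> m")
      case True
      show ?thesis by (rule N[OF mn(2) True])
    next
      case False
      then have "m \<le> n" by simp
      then show ?thesis by (subst norm_on_minus_commute) (rule N[OF mn(1)])
    qed
    then show ?thesis by blast
  qed
  show thesis
  proof (rule cell.square_integrable_Cauchy_subseq[OF us Cau])
    fix r :: "nat \<Rightarrow> nat"
    assume r: "AE x in cell. convergent (\<lambda>n. u (r n) x)"
      and lim: "\<And>f. f \<in> borel_measurable cell \<Longrightarrow> AE x in cell. (\<lambda>n. u (r n) x) \<longlonglongrightarrow> f x \<Longrightarrow>
        square_integrable cell f \<and> (\<lambda>n. norm_on cell (\<lambda>x. u n x - f x)) \<longlonglongrightarrow> 0"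
    \<comment> \<open>The limit is taken on the whole space. Where the sequence diverges,
      \<open>lim\<close> is unspecified, but it depends on the sequence alone, so periodicity
      survives there too.\<close>
    define f where "f x = lim (\<lambda>n. u (r n) x)" for x
    have fm: "f \<in> borel_measurable lebesgue"
      unfolding f_def[abs_def] by (rule borel_measurable_lim_metric) (rule um)
    have fp: "ae_periodic f"
      unfolding ae_periodic_def
    proof (intro allI impI)
      fix k :: "real^'a" assume "\<forall>i. k $ i \<in> \<int>"
      then have "AE x in lebesgue. \<forall>n. u n (x + k) = u n x"
        using up by (subst AE_all_countable) (auto simp: ae_periodic_def)
      then show "AE x in lebesgue. f (x + k) = f x"
        by eventually_elim (simp add: f_def)
    qed
    have "AE x in cell. (\<lambda>n. u (r n) x) \<longlonglongrightarrow> f x"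
      using r by eventually_elim (simp add: f_def convergent_LIMSEQ_iff)
    from lim[OF measurable_cell[OF fm] this]
    have fs: "square_integrable cell f" and l: "(\<lambda>n. norm_on cell (\<lambda>x. u n x - f x)) \<longlonglongrightarrow> 0"
      by blast+
    have "f \<in> L2_per" using fm fp fs by (simp add: L2_per_iff)
    then show thesis using l by (rule that)
  qed
qed

lemma coef_tendsto:
  assumes u: "\<And>n. square_integrable cell (u n)" and f: "square_integrable cell f"
    and lim: "(\<lambda>n. norm_on cell (\<lambda>x. u n x - f x)) \<longlonglongrightarrow> 0"
  shows "(\<lambda>n. coef (u n) k) \<longlonglongrightarrow> coef f k"
proof (rule LIM_zero_cancel, rule Lim_null_comparison[OF always_eventually lim], rule allI)
  fix n show "norm (coef (u n) k - coef f k) \<le> norm_on cell (\<lambda>x. u n x - f x)"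
    using abs_coef_le[OF square_integrable_diff[OF u f], of n k] u f by (simp add: coef_diff)
qed

text \<open>The squared distance of two partial sums is the difference of the sums of squared
  coefficients, which increase and are bounded. So the partial sums are Cauchy.\<close>

lemma Riesz_Fischer:
  assumes b: "\<And>d. (\<Sum>k\<in>freq d. (c k)\<^sup>2) \<le> B"
  obtains f where "f \<in> L2_per" "\<And>k. coef f k = c k"
proof -
  let ?P = "\<lambda>d. \<Sum>k\<in>freq d. (c k)\<^sup>2"
  have inc: "incseq ?P"
    by (intro incseq_SucI sum_mono2) (auto intro: freq_Suc)
  have "convergent ?P"
    using inc b by (intro Bseq_mono_convergent incseq_bounded[of ?P B]) (auto simp: incseq_def)
  then have Cau: "Cauchy ?P" by (rule convergent_Cauchy)
  have eq: "(norm_on cell (\<lambda>x. trig_sum m c x - trig_sum n c x))\<^sup>2 = ?P m - ?P n" if "n \<le> m" for m n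
  proof -
    \<comment> \<open>The difference is again a trigonometric sum, with the low frequencies deleted,
      so \<open>norm_trig_sum\<close> gives its norm.\<close>
    have "(\<lambda>x. trig_sum m c x - trig_sum n c x) = trig_sum m (\<lambda>k. if k \<in> freq n then 0 else c k)"
    proof
      fix x
      have "trig_sum m c x = trig_sum n c x + (\<Sum>k\<in>freq m - freq n. c k * hart k x)"
        unfolding trig_sum_def using freq_mono[OF that] by (subst sum.subset_diff) auto
      moreover have "trig_sum m (\<lambda>k. if k \<in> freq n then 0 else c k) x = (\<Sum>k\<in>freq m - freq n. c k * hart k x)"
        unfolding trig_sum_def by (intro sum.mono_neutral_cong_right) auto
      ultimately show "trig_sum m c x - trig_sum n c x = trig_sum m (\<lambda>k. if k \<in> freq n then 0 else c k) x"
        by simp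
    qed
    then have "(norm_on cell (\<lambda>x. trig_sum m c x - trig_sum n c x))\<^sup>2
        = (\<Sum>k\<in>freq m. (if k \<in> freq n then 0 else c k)\<^sup>2)"
      by (simp add: norm_trig_sum)
    also have "\<dots> = (\<Sum>k\<in>freq m - freq n. (c k)\<^sup>2)"
      by (intro sum.mono_neutral_cong_right) auto
    also have "\<dots> = ?P m - ?P n" using freq_mono[OF that] by (subst sum_diff) auto
    finally show ?thesis .
  qed
  have Cau': "\<exists>N. \<forall>n\<ge>N. \<forall>m\<ge>n. norm_on cell (\<lambda>x. trig_sum m c x - trig_sum n c x) \<le> e" if "e > 0" for e
  proof -
    have "0 < e\<^sup>2" using that by simp
    from CauchyD[OF Cau this]
    obtain N where N: "\<And>m n. m \<ge> N \<Longrightarrow> n \<ge> N \<Longrightarrow> \<bar>?P m - ?P n\<bar> < e\<^sup>2"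
      unfolding real_norm_def by blast
    have "norm_on cell (\<lambda>x. trig_sum m c x - trig_sum n c x) \<le> e" if "n \<ge> N" "m \<ge> n" for m n
    proof (rule power2_le_imp_le)
      show "(norm_on cell (\<lambda>x. trig_sum m c x - trig_sum n c x))\<^sup>2 \<le> e\<^sup>2"
        unfolding eq[OF that(2)] using N[of m n] that by linarith
    qed (use \<open>e > 0\<close> in simp)
    then show ?thesis by blast
  qed
  obtain f where f: "f \<in> L2_per" and lim: "(\<lambda>n. norm_on cell (\<lambda>x. trig_sum n c x - f x)) \<longlonglongrightarrow> 0"
    by (rule L2_per_complete[OF is_trig_L2_per[OF is_trig_trig_sum] Cau'])
  have "coef f k = c k" for k
  proof -
    have "(\<lambda>n. coef (trig_sum n c) k) \<longlonglongrightarrow> coef f k"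
      by (rule coef_tendsto[OF square_integrable_trig_sum L2_per_square_integrable[OF f] lim])
    moreover obtain d where d: "k \<in> freq d" using freq_exhaust by blast
    have "eventually (\<lambda>n. coef (trig_sum n c) k = c k) sequentially"
      unfolding eventually_sequentially
      by (intro exI[of _ d]) (auto simp: coef_trig_sum dest: subsetD[OF freq_mono d])
    then have "(\<lambda>n. coef (trig_sum n c) k) \<longlonglongrightarrow> c k" by (rule tendsto_eventually)
    ultimately show ?thesis by (rule LIMSEQ_unique)
  qed
  with f show thesis by (rule that)
qed

section \<open>Weak derivatives and the Poisson equation\<close>


lemma partial_deriv_eq:
  assumes "(f has_derivative D) (at x)" shows "partial_deriv i f x = D (axis i 1)"
  using frechet_derivative_at[OF assms] by (simp add: partial_deriv_def)

lemma phase_has_derivative: "(phase k has_derivative phase k) (at x)"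
  unfolding phase_def by (auto intro!: derivative_eq_intros)

lemma hart_has_derivative: "(hart k has_derivative (\<lambda>h. phase k h * hart (- k) x)) (at x)"
proof -
  have "((\<lambda>x. cos (phase k x) + sin (phase k x)) has_derivative
      (\<lambda>h. phase k h * (- sin (phase k x)) + phase k h * cos (phase k x))) (at x)"
    by (intro has_derivative_add has_derivative_cos has_derivative_sin phase_has_derivative)
  moreover have "(\<lambda>h. phase k h * (- sin (phase k x)) + phase k h * cos (phase k x))
      = (\<lambda>h. phase k h * hart (- k) x)"
    by (simp add: hart_def algebra_simps)
  ultimately show ?thesis by (simp add: hart_def[abs_def])
qed

lemma partial_deriv_hart:
  "partial_deriv i (\<lambda>x. c * hart k x) = (\<lambda>x. (2 * pi * c * of_int (k $ i)) * hart (- k) x)"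
proof
  fix x
  have "((\<lambda>x. c * hart k x) has_derivative (\<lambda>h. c * (phase k h * hart (- k) x))) (at x)"
    by (intro has_derivative_mult_right hart_has_derivative)
  from partial_deriv_eq[OF this] show
    "partial_deriv i (\<lambda>x. c * hart k x) x = (2 * pi * c * of_int (k $ i)) * hart (- k) x"
    by (simp add: phase_axis)
qed

text \<open>Multiples of Hartley functions are closed under partial differentiation, so smoothness
  reduces to one application of the chain rule.\<close>

lemma iter_partial_hart_exists: "\<exists>c m. iter_partial is (hart k) = (\<lambda>x. c * hart m x)"
proof (induction "is")
  case Nil
  then show ?case by (intro exI[of _ 1] exI[of _ k]) simp
next
  case (Cons i "is")
  then obtain c m where "iter_partial is (hart k) = (\<lambda>x. c * hart m x)" by blast
  then have "iter_partial (i # is) (hart k) = (\<lambda>x. (2 * pi * c * of_int (m $ i)) * hart (- m) x)"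
    by (simp only: iter_partial.simps partial_deriv_hart)
  then show ?case by blast
qed

lemma iter_partial_hart1: "iter_partial [i] (hart k) = (\<lambda>x. (2 * pi * of_int (k $ i)) * hart (- k) x)"
  using partial_deriv_hart[of i 1 k] by simp

lemma iter_partial_hart2:
  "iter_partial [i, j] (hart k) = (\<lambda>x. (- 4 * pi\<^sup>2 * of_int (k $ i) * of_int (k $ j)) * hart k x)"
  using iter_partial_hart1[of j k] partial_deriv_hart[of i "2 * pi * of_int (k $ j)" "- k"]
  by (simp add: power2_eq_square mult_ac)

lemma hart_smooth: "hart k \<in> smooth_per"
proof -
  have "iter_partial is (hart k) differentiable at x" for "is" x
  proof -
    obtain c m where "iter_partial is (hart k) = (\<lambda>x. c * hart m x)"
      using iter_partial_hart_exists by blast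
    moreover have "((\<lambda>x. c * hart m x) has_derivative (\<lambda>h. c * (phase m h * hart (- m) x))) (at x)"
      by (intro has_derivative_mult_right hart_has_derivative)
    ultimately show ?thesis by (auto simp: differentiable_def)
  qed
  then show ?thesis using int_periodic_hart[of k] by (simp add: smooth_per_def int_periodic_def)
qed

section \<open>Integration by parts on the torus\<close>

lemma continuous_bounded_on_cbox:
  fixes f :: "'a::euclidean_space \<Rightarrow> real"
  assumes "continuous_on UNIV f"
  obtains K where "\<And>x. x \<in> cbox a b \<Longrightarrow> \<bar>f x\<bar> \<le> K"
proof -
  have "compact (f ` cbox a b)"
    using assms by (intro compact_continuous_image) (auto intro: continuous_on_subset)
  then have "bounded (f ` cbox a b)" by (rule compact_imp_bounded)
  then show thesis using that by (auto simp: bounded_iff)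
qed

text \<open>Difference quotients have integral zero by translation invariance and converge to the
  derivative. The mean value theorem dominates them by a bound for the derivative.\<close>

lemma integral_partial_deriv_eq_0:
  fixes g :: "real^'n \<Rightarrow> real"
  assumes d: "\<And>x. g differentiable at x" and per: "int_periodic g"
    and c: "continuous_on UNIV (partial_deriv i g)"
  shows "integral\<^sup>L cell (partial_deriv i g) = 0"
proof -
  let ?D = "partial_deriv i g"
  have gc: "continuous_on UNIV g"
    using d by (simp add: continuous_on_eq_continuous_at differentiable_imp_continuous_within)
  have line: "((\<lambda>t. g (x + axis i t)) has_real_derivative ?D (x + axis i t)) (at t)" for x t
  proof -
    obtain F where F: "(g has_derivative F) (at (x + axis i t))" using d by (auto simp: differentiable_def)
    have "((\<lambda>t. x + t *\<^sub>R axis i 1) has_derivative (\<lambda>s. s *\<^sub>R axis i 1)) (at t)"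
      by (auto intro!: derivative_eq_intros)
    moreover have ax: "t *\<^sub>R axis i 1 = (axis i t :: real^'n)" for t by (simp add: axis_def vec_eq_iff)
    ultimately have "((\<lambda>t. g (x + axis i t)) has_derivative (\<lambda>s. F (axis i s))) (at t)"
      using has_derivative_compose[of "\<lambda>t. x + axis i t" "axis i" t UNIV g F] F by simp
    moreover have "F (axis i s) = ?D (x + axis i t) * s" for s
      using has_derivative_linear[OF F] partial_deriv_eq[OF F, of i] ax[of s, symmetric]
      by (simp add: linear_scale)
    ultimately show ?thesis by (simp add: has_field_derivative_def)
  qed
  \<comment> \<open>The increments \<open>e n\<close> are at most 1, so \<open>cbox 0 2\<close>
    contains every intermediate point reached from the cell.\<close>
  obtain B where B: "\<And>x. x \<in> cbox 0 2 \<Longrightarrow> \<bar>?D x\<bar> \<le> B"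
    by (rule continuous_bounded_on_cbox[OF c]) blast
  define e where "e n = (1 / real (Suc n))" for n
  have e: "0 < e n" "e n \<le> 1" for n by (auto simp: e_def)
  have elim: "e \<longlonglongrightarrow> 0" unfolding e_def[abs_def] using LIMSEQ_Suc[OF lim_1_over_n] by simp
  define q where "q n x = (g (x + axis i (e n)) - g x) / e n" for n x
  have gs: "continuous_on UNIV (\<lambda>x. g (x + v))" for v
    by (intro continuous_on_compose2[OF gc] continuous_intros) auto
  have gi: "integrable cell (\<lambda>x. g (x + v))" for v
  proof -
    obtain K where K: "\<And>x. x \<in> cbox 0 1 \<Longrightarrow> \<bar>g (x + v)\<bar> \<le> K"
      by (rule continuous_bounded_on_cbox[OF gs]) blast
    show ?thesis
    proof (rule cell.integrable_const_bound[where B=K])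
      show "AE x in cell. norm (g (x + v)) \<le> K"
        using K by (intro AE_I2) (auto simp: unit_cell_def mem_box_cart less_imp_le)
    qed (intro measurable_cell borel_measurable_continuous_lebesgue gs)
  qed
  have q0: "integral\<^sup>L cell (q n) = 0" for n
    using gi[of "axis i (e n)"] gi[of 0] integral_cell_translation[OF gc per, of "axis i (e n)"]
    unfolding q_def by simp
  have "(\<lambda>n. integral\<^sup>L cell (q n)) \<longlonglongrightarrow> integral\<^sup>L cell ?D"
  proof (rule integral_dominated_convergence[where w="\<lambda>_. B"])
    show "?D \<in> borel_measurable cell"
      by (intro measurable_cell borel_measurable_continuous_lebesgue c)
    show "q n \<in> borel_measurable cell" for n
      unfolding q_def[abs_def] using e[of n]
      by (intro measurable_cell borel_measurable_continuous_lebesgue continuous_intros gs gc) auto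
    show "AE x in cell. (\<lambda>n. q n x) \<longlonglongrightarrow> ?D x"
    proof (rule AE_I2)
      fix x
      have a0: "axis i 0 = (0 :: real^'n)" by (simp add: axis_def vec_eq_iff)
      have "((\<lambda>h. (g (x + axis i (0 + h)) - g (x + axis i 0)) / h) \<longlongrightarrow> ?D (x + axis i 0)) (at 0)"
        using line[of x 0] unfolding DERIV_def .
      then have "((\<lambda>h. (g (x + axis i h) - g x) / h) \<longlongrightarrow> ?D x) (at 0)" by (simp add: a0)
      moreover have "filterlim e (at 0) sequentially"
        using elim e(1) by (auto simp: filterlim_at less_imp_neq[symmetric])
      ultimately show "(\<lambda>n. q n x) \<longlonglongrightarrow> ?D x"
        unfolding q_def by (rule filterlim_compose)
    qed
    show "AE x in cell. norm (q n x) \<le> B" for n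
    proof (rule AE_I2)
      fix x :: "real^'n" assume "x \<in> space cell"
      then have x: "\<And>j. 0 < x $ j \<and> x $ j < 1" by (simp add: unit_cell_def)
      obtain z where z: "0 < z" "z < e n"
        "g (x + axis i (e n)) - g (x + axis i 0) = (e n - 0) * ?D (x + axis i z)"
        using MVT2[OF e(1)[of n] line[of x]] by blast
      have a0: "axis i 0 = (0 :: real^'n)" by (simp add: axis_def vec_eq_iff)
      have "x + axis i z \<in> cbox 0 2"
        using x z(1,2) e(2)[of n]
        by (auto simp: mem_box_cart axis_def intro: less_imp_le) (smt (verit) x)+
      moreover have "q n x = ?D (x + axis i z)"
        using z e(1)[of n] by (simp add: q_def a0)
      ultimately show "norm (q n x) \<le> B" using B by simp
    qed
  qed auto
  then show ?thesis using q0 by (simp add: LIMSEQ_const_iff)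
qed

lemma iter_partial_append: "iter_partial is (partial_deriv i f) = iter_partial (is @ [i]) f"
  by (induction "is") auto

lemma smooth_per_differentiable: "f \<in> smooth_per \<Longrightarrow> f differentiable at x"
  unfolding smooth_per_def by (metis (mono_tags, lifting) iter_partial.simps(1) mem_Collect_eq)

lemma smooth_per_int_periodic: "f \<in> smooth_per \<Longrightarrow> int_periodic f"
  by (simp add: smooth_per_def int_periodic_def)

lemma smooth_per_continuous: "f \<in> smooth_per \<Longrightarrow> continuous_on S f"
  by (meson continuous_at_imp_continuous_on differentiable_imp_continuous_within smooth_per_differentiable)

lemma partial_deriv_smooth: assumes f: "f \<in> smooth_per" shows "partial_deriv i f \<in> smooth_per"
  unfolding smooth_per_def
proof (intro CollectI conjI allI impI)
  fix "is" x
  show "iter_partial is (partial_deriv i f) differentiable (at x)"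
    using f by (simp add: iter_partial_append smooth_per_def)
next
  fix x k :: "real^'a" assume k: "\<forall>i. k $ i \<in> \<int>"
  obtain D where D: "(f has_derivative D) (at (x + k))"
    using smooth_per_differentiable[OF f] by (auto simp: differentiable_def)
  have "((\<lambda>y. y + k) has_derivative (\<lambda>h. h)) (at x)" by (auto intro!: derivative_eq_intros)
  from has_derivative_compose[OF this D] have "((\<lambda>y. f (y + k)) has_derivative D) (at x)" .
  moreover have "(\<lambda>y. f (y + k)) = f" using f k by (auto simp: smooth_per_def)
  ultimately have "(f has_derivative D) (at x)" by simp
  then show "partial_deriv i f (x + k) = partial_deriv i f x"
    using D by (simp add: partial_deriv_eq)
qed

lemma smooth_per_L2_per: assumes f: "f \<in> smooth_per" shows "f \<in> L2_per"
proof -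
  obtain K where K: "\<And>x. x \<in> cbox 0 1 \<Longrightarrow> \<bar>f x\<bar> \<le> K"
    by (rule continuous_bounded_on_cbox[OF smooth_per_continuous[OF f]]) blast
  have m: "f \<in> borel_measurable lebesgue"
    by (intro borel_measurable_continuous_lebesgue smooth_per_continuous f)
  have "AE x in cell. \<bar>f x\<bar> \<le> K"
    using K by (intro AE_I2) (auto simp: unit_cell_def mem_box_cart less_imp_le)
  then have "square_integrable cell f"
    by (rule cell.square_integrable_bounded[OF measurable_cell[OF m]])
  then show ?thesis
    using m ae_periodic_int_periodic[OF smooth_per_int_periodic[OF f]] by (simp add: L2_per_iff)
qed

text \<open>Integrate the derivative of the product of \<open>f\<close> with \<open>hart k\<close>
  over the cell. The frequency becomes - k because \<open>hart k\<close> differentiates to a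
  multiple of \<open>hart (- k)\<close>.\<close>

lemma coef_partial_deriv:
  assumes f: "f \<in> smooth_per"
  shows "coef (partial_deriv i f) k = - 2 * pi * of_int (k $ i) * coef f (- k)"
proof -
  let ?g = "\<lambda>x. f x * hart k x"
  let ?c = "2 * pi * of_int (k $ i)"
  have pd: "partial_deriv i ?g = (\<lambda>x. partial_deriv i f x * hart k x + ?c * (f x * hart (- k) x))"
  proof
    fix x
    obtain D where D: "(f has_derivative D) (at x)"
      using smooth_per_differentiable[OF f] by (auto simp: differentiable_def)
    show "partial_deriv i ?g x = partial_deriv i f x * hart k x + ?c * (f x * hart (- k) x)"
      using partial_deriv_eq[OF has_derivative_mult[OF D hart_has_derivative], of i]
        partial_deriv_eq[OF D, of i] by (simp add: phase_axis mult_ac)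
  qed
  have s: "square_integrable cell f" "square_integrable cell (partial_deriv i f)"
    using f by (auto intro!: L2_per_square_integrable smooth_per_L2_per partial_deriv_smooth)
  have "integral\<^sup>L cell (partial_deriv i ?g) = 0"
  proof (rule integral_partial_deriv_eq_0)
    show "?g differentiable at x" for x
      using smooth_per_differentiable[OF f] smooth_per_differentiable[OF hart_smooth]
      by (intro differentiable_mult)
    show "int_periodic ?g"
      using smooth_per_int_periodic[OF f] int_periodic_hart[of k] by (simp add: int_periodic_def)
    show "continuous_on UNIV (partial_deriv i ?g)"
      unfolding pd by (intro continuous_intros smooth_per_continuous f partial_deriv_smooth)
  qed
  then have "coef (partial_deriv i f) k + ?c * coef f (- k) = 0"
    unfolding pd coef_def inner_on_def
    using square_integrable_mult[OF s(2) square_integrable_hart, of k]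
      square_integrable_mult[OF s(1) square_integrable_hart, of "- k"] by simp
  then show ?thesis by simp
qed

section \<open>Weak derivatives as multipliers on the coefficients\<close>

lemma coef_iter_partial1:
  "f \<in> smooth_per \<Longrightarrow> coef (iter_partial [i] f) k = - 2 * pi * of_int (k $ i) * coef f (- k)"
  by (simp add: coef_partial_deriv)

lemma coef_iter_partial2:
  "f \<in> smooth_per \<Longrightarrow>
    coef (iter_partial [i, j] f) k = - 4 * pi\<^sup>2 * of_int (k $ i) * of_int (k $ j) * coef f k"
  by (simp add: coef_partial_deriv partial_deriv_smooth power2_eq_square)

text \<open>Testing with \<open>hart k\<close> reads off the coefficients. Conversely Parseval
  applies to any smooth test function, and substituting - k for k matches the two multipliers up to
  sign.\<close>

lemma has_weak_deriv1_iff: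
  assumes f: "f \<in> L2_per" and g: "g \<in> L2_per"
  shows "has_weak_deriv [i] f g \<longleftrightarrow> (\<forall>k. coef g k = - 2 * pi * of_int (k $ i) * coef f (- k))"
proof
  assume w: "has_weak_deriv [i] f g"
  show "\<forall>k. coef g k = - 2 * pi * of_int (k $ i) * coef f (- k)"
  proof
    fix k
    have "inner_on cell f (\<lambda>x. (2 * pi * of_int (k $ i)) * hart (- k) x) = - coef g k"
      using bspec[OF w[unfolded has_weak_deriv_def] hart_smooth[of k]]
      by (simp only: iter_partial_hart1 L2_inner_eq coef_def) simp
    then show "coef g k = - 2 * pi * of_int (k $ i) * coef f (- k)"
      by (simp add: inner_on_commute[of _ f] inner_on_cmult coef_def)
  qed
next
  assume c: "\<forall>k. coef g k = - 2 * pi * of_int (k $ i) * coef f (- k)"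
  show "has_weak_deriv [i] f g"
    unfolding has_weak_deriv_def
  proof
    fix \<phi> :: "real^'a \<Rightarrow> real" assume p: "\<phi> \<in> smooth_per"
    have pL: "\<phi> \<in> L2_per" "iter_partial [i] \<phi> \<in> L2_per"
      using p by (auto intro!: smooth_per_L2_per partial_deriv_smooth)
    have "(\<Sum>k\<in>freq d. coef f k * coef (iter_partial [i] \<phi>) k) = - (\<Sum>k\<in>freq d. coef g k * coef \<phi> k)" for d
    proof -
      have "(\<Sum>k\<in>freq d. coef f k * coef (iter_partial [i] \<phi>) k)
          = (\<Sum>k\<in>freq d. coef f (- k) * coef (iter_partial [i] \<phi>) (- k))"
        by (rule sum.reindex_bij_witness[of _ uminus uminus]) auto
      also have "\<dots> = - (\<Sum>k\<in>freq d. coef g k * coef \<phi> k)"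
        unfolding sum_negf[symmetric]
        by (intro sum.cong refl) (simp add: c coef_iter_partial1[OF p] del: iter_partial.simps)
      finally show ?thesis .
    qed
    then have "(\<lambda>d. - (\<Sum>k\<in>freq d. coef g k * coef \<phi> k)) \<longlonglongrightarrow> inner_on cell f (iter_partial [i] \<phi>)"
      using Parseval_inner[OF f pL(2)] by simp
    moreover have "(\<lambda>d. - (\<Sum>k\<in>freq d. coef g k * coef \<phi> k)) \<longlonglongrightarrow> - inner_on cell g \<phi>"
      by (intro tendsto_minus Parseval_inner g pL)
    ultimately show "L2_inner f (iter_partial [i] \<phi>) = (- 1) ^ length [i] * L2_inner g \<phi>"
      using LIMSEQ_unique by (fastforce simp: L2_inner_eq simp del: iter_partial.simps)
  qed
qed

lemma has_weak_deriv2_iff: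
  assumes f: "f \<in> L2_per" and g: "g \<in> L2_per"
  shows "has_weak_deriv [i, j] f g
    \<longleftrightarrow> (\<forall>k. coef g k = - 4 * pi\<^sup>2 * of_int (k $ i) * of_int (k $ j) * coef f k)"
proof
  assume w: "has_weak_deriv [i, j] f g"
  show "\<forall>k. coef g k = - 4 * pi\<^sup>2 * of_int (k $ i) * of_int (k $ j) * coef f k"
  proof
    fix k
    have "inner_on cell f (\<lambda>x. (- 4 * pi\<^sup>2 * of_int (k $ i) * of_int (k $ j)) * hart k x) = coef g k"
      using bspec[OF w[unfolded has_weak_deriv_def] hart_smooth[of k]]
      by (simp only: iter_partial_hart2 L2_inner_eq coef_def) simp
    then show "coef g k = - 4 * pi\<^sup>2 * of_int (k $ i) * of_int (k $ j) * coef f k"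
      by (simp only: inner_on_commute[of _ f] inner_on_cmult coef_def)
  qed
next
  assume c: "\<forall>k. coef g k = - 4 * pi\<^sup>2 * of_int (k $ i) * of_int (k $ j) * coef f k"
  show "has_weak_deriv [i, j] f g"
    unfolding has_weak_deriv_def
  proof
    fix \<phi> :: "real^'a \<Rightarrow> real" assume p: "\<phi> \<in> smooth_per"
    have pL: "\<phi> \<in> L2_per" "iter_partial [i, j] \<phi> \<in> L2_per"
      using p by (auto intro!: smooth_per_L2_per partial_deriv_smooth)
    have "(\<Sum>k\<in>freq d. coef f k * coef (iter_partial [i, j] \<phi>) k) = (\<Sum>k\<in>freq d. coef g k * coef \<phi> k)" for d
      by (intro sum.cong refl) (simp add: c coef_iter_partial2[OF p] del: iter_partial.simps)
    then have "(\<lambda>d. \<Sum>k\<in>freq d. coef g k * coef \<phi> k) \<longlonglongrightarrow> inner_on cell f (iter_partial [i, j] \<phi>)"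
      using Parseval_inner[OF f pL(2)] by simp
    from LIMSEQ_unique[OF this Parseval_inner[OF g pL(1)]]
    show "L2_inner f (iter_partial [i, j] \<phi>) = (- 1) ^ length [i, j] * L2_inner g \<phi>"
      by (simp add: L2_inner_eq del: iter_partial.simps)
  qed
qed

lemma has_weak_deriv_Nil: "has_weak_deriv [] f f"
  by (simp add: has_weak_deriv_def)

lemma H_per2_iff:
  "f \<in> H_per 2 \<longleftrightarrow> f \<in> L2_per
    \<and> (\<forall>i. \<exists>g\<in>L2_per. \<forall>k. coef g k = - 2 * pi * of_int (k $ i) * coef f (- k))
    \<and> (\<forall>i j. \<exists>g\<in>L2_per. \<forall>k. coef g k = - 4 * pi\<^sup>2 * of_int (k $ i) * of_int (k $ j) * coef f k)"
    (is "_ \<longleftrightarrow> _ \<and> ?P \<and> ?Q")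
proof (cases "f \<in> L2_per")
  case True
  have "(\<forall>is. length is \<le> 2 \<longrightarrow> (\<exists>g\<in>L2_per. has_weak_deriv is f g))
      \<longleftrightarrow> (\<forall>i. \<exists>g\<in>L2_per. has_weak_deriv [i] f g) \<and> (\<forall>i j. \<exists>g\<in>L2_per. has_weak_deriv [i, j] f g)"
    (is "?L \<longleftrightarrow> ?R")
  proof
    assume ?L
    then show ?R by (metis One_nat_def Suc_1 Suc_le_mono le0 length_Cons list.size(3))
  next
    assume R: ?R
    show ?L
    proof (intro allI impI)
      fix "is" :: "'a list" assume "length is \<le> 2"
      then consider "is = []" | i where "is = [i]" | i j where "is = [i, j]"
        by (auto simp: numeral_2_eq_2 le_Suc_eq length_Suc_conv)
      then show "\<exists>g\<in>L2_per. has_weak_deriv is f g"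
      proof cases
        case 1
        then show ?thesis using True has_weak_deriv_Nil by blast
      qed (use R in blast)+
    qed
  qed
  then show ?thesis
    using True has_weak_deriv1_iff[OF True] has_weak_deriv2_iff[OF True] by (simp add: H_per_def)
qed (simp add: H_per_def)

lemma H_per2_L2_per: "f \<in> H_per 2 \<Longrightarrow> f \<in> L2_per"
  by (simp add: H_per_def)

text \<open>Coefficients determine a weak derivative up to a null set, so these two facts capture
  the arbitrary representative chosen in \<open>weak_deriv\<close>.\<close>

lemma weak_deriv2:
  assumes f: "f \<in> H_per 2"
  shows "weak_deriv [i, j] f \<in> L2_per"
    and "coef (weak_deriv [i, j] f) k = - 4 * pi\<^sup>2 * of_int (k $ i) * of_int (k $ j) * coef f k"
proof -
  have "\<exists>g. g \<in> L2_per \<and> has_weak_deriv [i, j] f g"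
    using f unfolding H_per_def by (auto dest!: spec[of _ "[i, j]"])
  then have "weak_deriv [i, j] f \<in> L2_per \<and> has_weak_deriv [i, j] f (weak_deriv [i, j] f)"
    unfolding weak_deriv_def by (rule someI_ex)
  then show "weak_deriv [i, j] f \<in> L2_per"
    "coef (weak_deriv [i, j] f) k = - 4 * pi\<^sup>2 * of_int (k $ i) * of_int (k $ j) * coef f k"
    using has_weak_deriv2_iff[OF H_per2_L2_per[OF f]] by auto
qed

lemma norm_int_vec: "(norm (int_vec k))\<^sup>2 = (\<Sum>i\<in>UNIV. (of_int (k $ i))\<^sup>2)"
  by (subst power2_norm_eq_inner) (simp add: inner_vec_def power2_eq_square)

lemma norm_int_vec_ge_1: assumes "k \<noteq> 0" shows "1 \<le> (norm (int_vec k))\<^sup>2"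
proof -
  obtain i where i: "k $ i \<noteq> 0" using assms by (auto simp: vec_eq_iff)
  then have "1 \<le> \<bar>k $ i\<bar>" by linarith
  then have "1 \<le> (k $ i)\<^sup>2" by (metis abs_le_square_iff abs_one one_power2)
  then have "(1::real) \<le> (of_int (k $ i))\<^sup>2" by (metis of_int_1_le_iff of_int_power)
  also have "\<dots> \<le> (norm (int_vec k))\<^sup>2"
    unfolding norm_int_vec by (rule member_le_sum) auto
  finally show ?thesis .
qed

lemma laplacian_L2_per: assumes "f \<in> H_per 2" shows "laplacian f \<in> L2_per"
  unfolding laplacian_def[abs_def] by (intro L2_per_sum weak_deriv2 assms)

lemma coef_laplacian:
  assumes f: "f \<in> H_per 2"
  shows "coef (laplacian f) k = - 4 * pi\<^sup>2 * (norm (int_vec k))\<^sup>2 * coef f k"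
proof -
  have "coef (laplacian f) k = (\<Sum>i\<in>UNIV. coef (weak_deriv [i, i] f) k)"
    unfolding laplacian_def[abs_def] by (intro coef_sum L2_per_square_integrable weak_deriv2 f)
  also have "\<dots> = (\<Sum>i\<in>UNIV. (- 4 * pi\<^sup>2 * coef f k) * (of_int (k $ i))\<^sup>2)"
    by (simp add: weak_deriv2[OF f] power2_eq_square[of "of_int _"] mult_ac)
  also have "\<dots> = - 4 * pi\<^sup>2 * (norm (int_vec k))\<^sup>2 * coef f k"
    unfolding norm_int_vec sum_distrib_left[symmetric] by simp
  finally show ?thesis .
qed

lemma sum_swap_outer:
  fixes f :: "'i \<Rightarrow> 'j \<Rightarrow> 'k \<Rightarrow> 'a::comm_monoid_add"
  shows "(\<Sum>i\<in>I. \<Sum>j\<in>J. \<Sum>k\<in>K. f i j k) = (\<Sum>k\<in>K. \<Sum>i\<in>I. \<Sum>j\<in>J. f i j k)"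
proof -
  have "(\<Sum>i\<in>I. \<Sum>j\<in>J. \<Sum>k\<in>K. f i j k) = (\<Sum>i\<in>I. \<Sum>k\<in>K. \<Sum>j\<in>J. f i j k)"
    by (intro sum.cong refl sum.swap)
  also have "\<dots> = (\<Sum>k\<in>K. \<Sum>i\<in>I. \<Sum>j\<in>J. f i j k)"
    by (rule sum.swap)
  finally show ?thesis .
qed

text \<open>Frequency by frequency, since the squares of k_i k_j sum to |k|^4. On the torus there is
  no boundary term, hence equality.\<close>

lemma Miranda_Talenti:
  assumes f: "f \<in> H_per 2"
  shows "(\<Sum>i\<in>UNIV. \<Sum>j\<in>UNIV. (norm_on cell (weak_deriv [i, j] f))\<^sup>2) = (norm_on cell (laplacian f))\<^sup>2"
proof (rule LIMSEQ_unique)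
  show "(\<lambda>d. \<Sum>i\<in>UNIV. \<Sum>j\<in>UNIV. \<Sum>k\<in>freq d. (coef (weak_deriv [i, j] f) k)\<^sup>2)
      \<longlonglongrightarrow> (\<Sum>i\<in>UNIV. \<Sum>j\<in>UNIV. (norm_on cell (weak_deriv [i, j] f))\<^sup>2)"
    by (intro tendsto_sum Parseval_norm weak_deriv2 f)
  have "(\<Sum>i\<in>UNIV. \<Sum>j\<in>UNIV. \<Sum>k\<in>freq d. (coef (weak_deriv [i, j] f) k)\<^sup>2)
      = (\<Sum>k\<in>freq d. (coef (laplacian f) k)\<^sup>2)" for d
  proof -
    have "(\<Sum>i\<in>UNIV. \<Sum>j\<in>UNIV. \<Sum>k\<in>freq d. (coef (weak_deriv [i, j] f) k)\<^sup>2)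
        = (\<Sum>k\<in>freq d. \<Sum>i\<in>UNIV. \<Sum>j\<in>UNIV. (coef (weak_deriv [i, j] f) k)\<^sup>2)"
      by (rule sum_swap_outer)
    also have "\<dots> = (\<Sum>k\<in>freq d. (coef (laplacian f) k)\<^sup>2)"
    proof (intro sum.cong refl)
      fix k :: "int^'a"
      have "((norm (int_vec k))\<^sup>2)\<^sup>2 = (\<Sum>i\<in>UNIV. \<Sum>j\<in>UNIV. (of_int (k $ i) * of_int (k $ j))\<^sup>2)"
        unfolding norm_int_vec by (subst power2_eq_square) (simp add: sum_product power_mult_distrib)
      then show "(\<Sum>i\<in>UNIV. \<Sum>j\<in>UNIV. (coef (weak_deriv [i, j] f) k)\<^sup>2) = (coef (laplacian f) k)\<^sup>2"
        by (simp add: weak_deriv2[OF f] coef_laplacian[OF f] power_mult_distrib sum_distrib_left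
            sum_distrib_right mult_ac)
    qed
    finally show ?thesis .
  qed
  then show "(\<lambda>d. \<Sum>i\<in>UNIV. \<Sum>j\<in>UNIV. \<Sum>k\<in>freq d. (coef (weak_deriv [i, j] f) k)\<^sup>2)
      \<longlonglongrightarrow> (norm_on cell (laplacian f))\<^sup>2"
    using Parseval_norm[OF laplacian_L2_per[OF f]] by simp
qed

lemma hart_H_per2: "hart k \<in> H_per 2"
  unfolding H_per2_iff
proof (intro conjI allI)
  fix i
  show "\<exists>g\<in>L2_per. \<forall>l. coef g l = - 2 * pi * of_int (l $ i) * coef (hart k) (- l)"
    by (intro bexI[of _ "\<lambda>x. (2 * pi * of_int (k $ i)) * hart (- k) x"] L2_per_cmult hart_L2_per)
       (auto simp: coef_cmult coef_hart)
next
  fix i j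
  show "\<exists>g\<in>L2_per. \<forall>l. coef g l = - 4 * pi\<^sup>2 * of_int (l $ i) * of_int (l $ j) * coef (hart k) l"
    by (intro bexI[of _ "\<lambda>x. (- 4 * pi\<^sup>2 * of_int (k $ i) * of_int (k $ j)) * hart k x"]
        L2_per_cmult hart_L2_per)
       (auto simp only: coef_cmult coef_hart if_True if_False mult_zero_right split: if_splits)
qed (rule hart_L2_per)

text \<open>Here \<open>s\<close> is negation for first derivatives, whose multipliers pair k with -
  k, and the identity otherwise.\<close>

lemma Riesz_Fischer_dominated:
  assumes g: "g \<in> L2_per" and b: "\<And>k. \<bar>c k\<bar> \<le> \<bar>coef g (s k)\<bar>" and s: "s = id \<or> s = uminus"
  obtains f where "f \<in> L2_per" "\<And>k. coef f k = c k"
proof (rule Riesz_Fischer[of c "(norm_on cell g)\<^sup>2"])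
  fix d
  have "(\<Sum>k\<in>freq d. (c k)\<^sup>2) \<le> (\<Sum>k\<in>freq d. (coef g (s k))\<^sup>2)"
    using b by (intro sum_mono) (simp add: abs_le_square_iff)
  also have "\<dots> = (\<Sum>k\<in>freq d. (coef g k)\<^sup>2)"
    using s by (elim disjE; intro sum.reindex_bij_witness[of _ s s]) auto
  also have "\<dots> \<le> (norm_on cell g)\<^sup>2" by (rule Bessel[OF g])
  finally show "(\<Sum>k\<in>freq d. (c k)\<^sup>2) \<le> (norm_on cell g)\<^sup>2" .
qed (rule that)

lemma Poisson:
  assumes g: "g \<in> L2_per" and g0: "coef g 0 = 0"
  obtains u where "u \<in> H_per0 2" "AE x in lebesgue. laplacian u x = g x"
proof -
  \<comment> \<open>The multiplier of the inverse Laplacian; division by zero makes the solution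
    have mean 0.\<close>
  let ?c = "\<lambda>k. - coef g k / (4 * pi\<^sup>2 * (norm (int_vec k))\<^sup>2)"
  have pi1: "1 \<le> pi" using pi_gt3 by linarith
  then have pi2: "1 \<le> pi\<^sup>2" by simp
  have D: "1 \<le> (norm (int_vec k))\<^sup>2" "1 \<le> 4 * pi\<^sup>2 * (norm (int_vec k))\<^sup>2" if "k \<noteq> 0" for k :: "int^'a"
    using norm_int_vec_ge_1[OF that] pi2 mult_mono[of 1 "4 * pi\<^sup>2" 1 "(norm (int_vec k))\<^sup>2"] by auto
  have le: "\<bar>r * ?c k\<bar> \<le> \<bar>coef g k\<bar>" if r: "\<bar>r\<bar> \<le> 4 * pi\<^sup>2 * (norm (int_vec k))\<^sup>2" for r k
  proof (cases "k = 0")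
    case False
    then have "\<bar>r * ?c k\<bar> = \<bar>r\<bar> / (4 * pi\<^sup>2 * (norm (int_vec k))\<^sup>2) * \<bar>coef g k\<bar>"
      by (simp add: abs_mult)
    also have "\<dots> \<le> 1 * \<bar>coef g k\<bar>"
      using r D[OF False] by (intro mult_right_mono) (auto simp: divide_le_eq_1)
    finally show ?thesis by simp
  qed simp
  have ki: "\<bar>of_int (k $ i)\<bar> \<le> norm (int_vec k)" for k :: "int^'a" and i
    using component_le_norm_cart[of "int_vec k" i] by simp
  obtain u where u: "u \<in> L2_per" "\<And>k. coef u k = ?c k"
  proof (rule Riesz_Fischer_dominated[OF g, of ?c id])
    show "\<bar>?c k\<bar> \<le> \<bar>coef g (id k)\<bar>" for k
      using le[of 1 k] D[of k] by (cases "k = 0") auto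
  qed auto
  have d1: "\<exists>v\<in>L2_per. \<forall>k. coef v k = - 2 * pi * of_int (k $ i) * coef u (- k)" for i
  proof -
    obtain v where "v \<in> L2_per" "\<And>k. coef v k = - 2 * pi * of_int (k $ i) * ?c (- k)"
    proof (rule Riesz_Fischer_dominated[OF g, of "\<lambda>k. - 2 * pi * of_int (k $ i) * ?c (- k)" uminus])
      fix k :: "int^'a"
      show "\<bar>- 2 * pi * of_int (k $ i) * ?c (- k)\<bar> \<le> \<bar>coef g (- k)\<bar>"
      proof (cases "k = 0")
        case False
        \<comment> \<open>Nonzero lattice vectors have length at least 1, so the first-order
          multiplier is controlled by that of the Laplacian.\<close>
        have "norm (int_vec k) \<le> (norm (int_vec k))\<^sup>2"
          using D(1)[OF False] by (metis abs_le_square_iff abs_norm_cancel abs_one mult_left_mono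
            mult_cancel_left1 norm_ge_zero one_power2 power2_eq_square)
        then have "\<bar>of_int (k $ i)\<bar> \<le> (norm (int_vec k))\<^sup>2" using ki[of k i] by linarith
        moreover have "2 * pi \<le> 4 * pi\<^sup>2"
          using pi1 mult_left_mono[OF pi1, of pi] by (simp add: power2_eq_square)
        ultimately have "2 * pi * \<bar>of_int (k $ i)\<bar> \<le> 4 * pi\<^sup>2 * (norm (int_vec k))\<^sup>2"
          by - (rule mult_mono, auto)
        then show ?thesis
          by (intro le) (simp add: abs_mult int_vec_minus)
      qed (simp add: g0)
    qed auto
    then show ?thesis using u(2) by auto
  qed
  have d2: "\<exists>v\<in>L2_per. \<forall>k. coef v k = - 4 * pi\<^sup>2 * of_int (k $ i) * of_int (k $ j) * coef u k" for i j
  proof -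
    obtain v where "v \<in> L2_per" "\<And>k. coef v k = - 4 * pi\<^sup>2 * of_int (k $ i) * of_int (k $ j) * ?c k"
    proof (rule Riesz_Fischer_dominated[OF g, of "\<lambda>k. - 4 * pi\<^sup>2 * of_int (k $ i) * of_int (k $ j) * ?c k" id])
      fix k :: "int^'a"
      have "\<bar>of_int (k $ i)\<bar> * \<bar>of_int (k $ j)\<bar> \<le> (norm (int_vec k))\<^sup>2"
        unfolding power2_eq_square by (intro mult_mono ki) auto
      then have "\<bar>- 4 * pi\<^sup>2 * of_int (k $ i) * of_int (k $ j)\<bar> \<le> 4 * pi\<^sup>2 * (norm (int_vec k))\<^sup>2"
        by (simp add: abs_mult)
      then show "\<bar>- 4 * pi\<^sup>2 * of_int (k $ i) * of_int (k $ j) * ?c k\<bar> \<le> \<bar>coef g (id k)\<bar>"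
        unfolding id_apply by (rule le)
    qed auto
    then show ?thesis using u(2) by auto
  qed
  have uH: "u \<in> H_per 2" using u(1) d1 d2 by (simp add: H_per2_iff)
  have "cell_integral u = 0" using u(2)[of 0] g0 by (simp add: cell_integral_eq coef_0)
  then have uH0: "u \<in> H_per0 2" using uH by (simp add: H_per0_def)
  have "coef (laplacian u) k = coef g k" for k
    using g0 D(1)[of k] by (cases "k = 0") (auto simp: coef_laplacian[OF uH] u(2))
  then have "AE x in lebesgue. laplacian u x = g x"
    by (intro coef_eq_imp_AE laplacian_L2_per uH g)
  with uH0 show thesis by (rule that)
qed

section \<open>Matrix fields close to the identity\<close>


lemma matrix_inner: "X \<bullet> Y = (\<Sum>i\<in>UNIV. \<Sum>j\<in>UNIV. X $ i $ j * Y $ i $ j)" for X Y :: "real^'n^'m"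
  by (simp add: inner_vec_def)

lemma matrix_norm_sq: "(norm X)\<^sup>2 = (\<Sum>i\<in>UNIV. \<Sum>j\<in>UNIV. (X $ i $ j)\<^sup>2)" for X :: "real^'n^'m"
  by (subst power2_norm_eq_inner) (simp add: matrix_inner power2_eq_square)

lemma borel_measurable_matrix_component:
  fixes X :: "'a \<Rightarrow> real^'n^'m"
  assumes "X \<in> borel_measurable M" shows "(\<lambda>x. X x $ i $ j) \<in> borel_measurable M"
proof -
  have "(\<lambda>x. X x \<bullet> axis i (axis j 1)) \<in> borel_measurable M"
    using assms by (intro borel_measurable_inner) auto
  then show ?thesis by (simp add: inner_axis)
qed

lemma abs_matrix_component_le: "\<bar>X $ i $ j\<bar> \<le> norm X" for X :: "real^'n^'m"
  using component_le_norm_cart[of "X $ i" j] Finite_Cartesian_Product.norm_nth_le[of X i] by linarith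

text \<open>
  The Fourier multiplier of \<open>D\<^sup>2 \<Delta>\<^sup>-\<^sup>1\<close>; division by zero makes it vanish at frequency \<open>0\<close>.
\<close>

definition riesz_symbol :: "int^'n \<Rightarrow> real^'n^'n" where
  "riesz_symbol k = (\<chi> i j. of_int (k $ i) * of_int (k $ j) / (norm (int_vec k))\<^sup>2)"

lemma riesz_symbol_nth: "riesz_symbol k $ i $ j = of_int (k $ i) * of_int (k $ j) / (norm (int_vec k))\<^sup>2"
  by (simp add: riesz_symbol_def)

lemma riesz_symbol_0 [simp]: "riesz_symbol 0 = 0"
  by (simp add: riesz_symbol_def vec_eq_iff)

lemma norm_outer_product: "norm ((\<chi> i j. v $ i * v $ j) :: real^'n^'n) = (norm (v :: real^'n))\<^sup>2"
proof (rule power2_eq_imp_eq)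
  have "((norm v)\<^sup>2)\<^sup>2 = (\<Sum>i\<in>UNIV. (v $ i)\<^sup>2) * (\<Sum>j\<in>UNIV. (v $ j)\<^sup>2)"
  proof -
    have "(norm v)\<^sup>2 = (\<Sum>i\<in>UNIV. (v $ i)\<^sup>2)"
      by (subst power2_norm_eq_inner) (simp add: inner_vec_def power2_eq_square)
    then show ?thesis by (simp only: power2_eq_square[of "\<Sum>i\<in>UNIV. (v $ i)\<^sup>2"])
  qed
  then show "(norm (\<chi> i j. v $ i * v $ j))\<^sup>2 = ((norm v)\<^sup>2)\<^sup>2"
    by (simp add: matrix_norm_sq sum_product power_mult_distrib)
qed auto

lemma norm_riesz_symbol_le: "norm (riesz_symbol k) \<le> 1"
proof (cases "k = 0")
  case False
  have "riesz_symbol k = (1 / (norm (int_vec k))\<^sup>2) *\<^sub>R (\<chi> i j. int_vec k $ i * int_vec k $ j)"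
    by (simp add: riesz_symbol_def vec_eq_iff)
  then show ?thesis using False by (simp add: norm_outer_product del: int_vec_nth)
qed simp

lemma trace_riesz_symbol: "k \<noteq> 0 \<Longrightarrow> mat 1 \<bullet> riesz_symbol k = 1"
  by (simp add: matrix_inner mat_def riesz_symbol_nth if_distrib[where f="\<lambda>x. x * _"] cong: if_cong)
     (simp add: sum_divide_distrib[symmetric] norm_int_vec[unfolded power2_eq_square, symmetric]
        power2_eq_square)

text \<open>For nonzero k the symbol is the orthogonal projection onto the line of k and has
  Frobenius norm 1. Applying Cauchy-Schwarz to whole matrices instead of entries avoids a factor
  depending on the dimension.\<close>

lemma riesz_symbol_contract:
  "(\<Sum>i\<in>UNIV. \<Sum>j\<in>UNIV. riesz_symbol k $ i $ j * c i j)\<^sup>2 \<le> (\<Sum>i\<in>UNIV. \<Sum>j\<in>UNIV. (c i j)\<^sup>2)"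
proof -
  let ?G = "\<chi> i j. c i j"
  have "\<bar>riesz_symbol k \<bullet> ?G\<bar> \<le> norm (riesz_symbol k) * norm ?G" by (rule Cauchy_Schwarz_ineq2)
  also have "\<dots> \<le> 1 * norm ?G" by (intro mult_right_mono norm_riesz_symbol_le) auto
  finally have "(riesz_symbol k \<bullet> ?G)\<^sup>2 \<le> (norm ?G)\<^sup>2" by (simp add: abs_le_square_iff[symmetric])
  then show ?thesis by (simp add: matrix_inner matrix_norm_sq)
qed

lemma riesz_exists:
  fixes g :: "'n \<Rightarrow> 'n \<Rightarrow> real^'n \<Rightarrow> real"
  assumes g: "\<And>i j. g i j \<in> L2_per"
  obtains w where "w \<in> L2_per"
    "\<And>k. coef w k = (\<Sum>i\<in>UNIV. \<Sum>j\<in>UNIV. riesz_symbol k $ i $ j * coef (g i j) k)"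
proof -
  show thesis
  proof (rule Riesz_Fischer)
    fix d
    have "(\<Sum>k\<in>freq d. (\<Sum>i\<in>UNIV. \<Sum>j\<in>UNIV. riesz_symbol k $ i $ j * coef (g i j) k)\<^sup>2)
        \<le> (\<Sum>k\<in>freq d. \<Sum>i\<in>UNIV. \<Sum>j\<in>UNIV. (coef (g i j) k)\<^sup>2)"
      by (intro sum_mono riesz_symbol_contract)
    also have "\<dots> = (\<Sum>i\<in>UNIV. \<Sum>j\<in>UNIV. \<Sum>k\<in>freq d. (coef (g i j) k)\<^sup>2)"
      by (rule sum_swap_outer[symmetric])
    also have "\<dots> \<le> (\<Sum>i\<in>UNIV. \<Sum>j\<in>UNIV. (norm_on cell (g i j))\<^sup>2)"
      by (intro sum_mono Bessel g)
    finally show "(\<Sum>k\<in>freq d. (\<Sum>i\<in>UNIV. \<Sum>j\<in>UNIV. riesz_symbol k $ i $ j * coef (g i j) k)\<^sup>2)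
        \<le> (\<Sum>i\<in>UNIV. \<Sum>j\<in>UNIV. (norm_on cell (g i j))\<^sup>2)" .
  qed (rule that)
qed

lemma riesz_norm_le:
  fixes g :: "'n \<Rightarrow> 'n \<Rightarrow> real^'n \<Rightarrow> real"
  assumes g: "\<And>i j. g i j \<in> L2_per" and w: "w \<in> L2_per"
    and c: "\<And>k. coef w k = (\<Sum>i\<in>UNIV. \<Sum>j\<in>UNIV. riesz_symbol k $ i $ j * coef (g i j) k)"
  shows "(norm_on cell w)\<^sup>2 \<le> (\<Sum>i\<in>UNIV. \<Sum>j\<in>UNIV. (norm_on cell (g i j))\<^sup>2)"
proof (rule LIMSEQ_le)
  show "(\<lambda>d. \<Sum>k\<in>freq d. (coef w k)\<^sup>2) \<longlonglongrightarrow> (norm_on cell w)\<^sup>2" by (rule Parseval_norm[OF w])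
  show "(\<lambda>d. \<Sum>i\<in>UNIV. \<Sum>j\<in>UNIV. \<Sum>k\<in>freq d. (coef (g i j) k)\<^sup>2)
      \<longlonglongrightarrow> (\<Sum>i\<in>UNIV. \<Sum>j\<in>UNIV. (norm_on cell (g i j))\<^sup>2)"
    by (intro tendsto_sum Parseval_norm g)
  have "(\<Sum>k\<in>freq d. (coef w k)\<^sup>2) \<le> (\<Sum>i\<in>UNIV. \<Sum>j\<in>UNIV. \<Sum>k\<in>freq d. (coef (g i j) k)\<^sup>2)" for d
  proof -
    have "(\<Sum>k\<in>freq d. (coef w k)\<^sup>2) \<le> (\<Sum>k\<in>freq d. \<Sum>i\<in>UNIV. \<Sum>j\<in>UNIV. (coef (g i j) k)\<^sup>2)"
      unfolding c by (intro sum_mono riesz_symbol_contract)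
    also have "\<dots> = (\<Sum>i\<in>UNIV. \<Sum>j\<in>UNIV. \<Sum>k\<in>freq d. (coef (g i j) k)\<^sup>2)"
      by (rule sum_swap_outer[symmetric])
    finally show ?thesis .
  qed
  then show "\<exists>N. \<forall>n\<ge>N. (\<Sum>k\<in>freq n. (coef w k)\<^sup>2) \<le> (\<Sum>i\<in>UNIV. \<Sum>j\<in>UNIV. \<Sum>k\<in>freq n. (coef (g i j) k)\<^sup>2)"
    by blast
qed

text \<open>Summing the squares of the entries under the integral lets the Frobenius bound enter
  once, not once per entry.\<close>

lemma norm_on_matrix_mult:
  fixes X :: "real^'n \<Rightarrow> real^'m^'l"
  assumes X: "X \<in> borel_measurable cell" and b: "AE x in cell. norm (X x) \<le> \<theta>" and w: "square_integrable cell w"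
  shows "(\<Sum>i\<in>UNIV. \<Sum>j\<in>UNIV. (norm_on cell (\<lambda>x. X x $ i $ j * w x))\<^sup>2) \<le> \<theta>\<^sup>2 * (norm_on cell w)\<^sup>2"
proof -
  have s: "square_integrable cell (\<lambda>x. X x $ i $ j * w x)" for i j
  proof (rule square_integrable_bounded_mult[OF w borel_measurable_matrix_component[OF X]])
    show "AE x in cell. \<bar>X x $ i $ j\<bar> \<le> \<theta>"
      using b by eventually_elim (use abs_matrix_component_le order_trans in blast)
  qed
  have i: "integrable cell (\<lambda>x. (X x $ i $ j * w x)\<^sup>2)" for i j
    using s by (simp add: square_integrable_def)
  have "(\<Sum>i\<in>UNIV. \<Sum>j\<in>UNIV. (norm_on cell (\<lambda>x. X x $ i $ j * w x))\<^sup>2)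
      = (\<integral>x. (\<Sum>i\<in>UNIV. \<Sum>j\<in>UNIV. (X x $ i $ j * w x)\<^sup>2) \<partial>cell)"
    using i by (simp add: norm_on_def Bochner_Integration.integral_sum)
  also have "\<dots> \<le> (\<integral>x. \<theta>\<^sup>2 * (w x)\<^sup>2 \<partial>cell)"
  proof (rule integral_mono_AE)
    show "AE x in cell. (\<Sum>i\<in>UNIV. \<Sum>j\<in>UNIV. (X x $ i $ j * w x)\<^sup>2) \<le> \<theta>\<^sup>2 * (w x)\<^sup>2"
      using b
    proof eventually_elim
      case (elim x)
      have "(\<Sum>i\<in>UNIV. \<Sum>j\<in>UNIV. (X x $ i $ j * w x)\<^sup>2) = (norm (X x))\<^sup>2 * (w x)\<^sup>2"
        by (simp add: matrix_norm_sq power_mult_distrib sum_distrib_right)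
      also have "\<dots> \<le> \<theta>\<^sup>2 * (w x)\<^sup>2" using elim by (intro mult_right_mono power_mono) auto
      finally show ?case .
    qed
  qed (use i w in \<open>auto simp: square_integrable_def\<close>)
  also have "\<dots> = \<theta>\<^sup>2 * (norm_on cell w)\<^sup>2" by (simp add: norm_on_def)
  finally show ?thesis .
qed

text \<open>Applied to \<open>B\<close> = gamma A with \<open>\<theta>\<close> = sqrt (1 - delta);
  \<open>cordes_at\<close> supplies the bound.\<close>

locale near_identity =
  fixes B :: "real^'n \<Rightarrow> real^'n^'n" and \<theta> :: real
  assumes B_measurable: "B \<in> borel_measurable lebesgue" and B_periodic: "ae_periodic B"
    and B_near: "AE x in lebesgue. norm (mat 1 - B x) \<le> \<theta>" and \<theta>: "0 \<le> \<theta>" "\<theta> < 1"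
begin

text \<open>
  The equation \<open>D\<^sup>2 : (B w) = 0\<close>, read off from the Hartley coefficients.
\<close>

definition adjoint_null :: "(real^'n \<Rightarrow> real) \<Rightarrow> bool" where
  "adjoint_null w \<longleftrightarrow>
     (\<forall>k. (\<Sum>i\<in>UNIV. \<Sum>j\<in>UNIV. of_int (k $ i) * of_int (k $ j) * coef (\<lambda>x. B x $ i $ j * w x) k) = 0)"

lemma B_bounded: "AE x in lebesgue. norm (B x) \<le> norm (mat 1 :: real^'n^'n) + \<theta>"
  using B_near
proof eventually_elim
  case (elim x)
  then show ?case using norm_triangle_ineq4[of "mat 1 :: real^'n^'n" "mat 1 - B x"] by simp
qed

lemma component_mult_L2_per:
  fixes X :: "real^'n \<Rightarrow> real^'n^'n"
  assumes X: "X \<in> borel_measurable lebesgue" "ae_periodic X" "AE x in lebesgue. norm (X x) \<le> C"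
    and w: "w \<in> L2_per"
  shows "(\<lambda>x. X x $ i $ j * w x) \<in> L2_per"
  unfolding L2_per_iff
proof (intro conjI)
  have m: "(\<lambda>x. X x $ i $ j) \<in> borel_measurable lebesgue"
    by (rule borel_measurable_matrix_component[OF X(1)])
  then show "(\<lambda>x. X x $ i $ j * w x) \<in> borel_measurable lebesgue"
    using w by (auto simp: L2_per_iff)
  show "ae_periodic (\<lambda>x. X x $ i $ j * w x)"
    using w by (intro ae_periodic_compose2[OF X(2), where h="\<lambda>Y z. Y $ i $ j * z"]) (simp add: L2_per_iff)
  show "square_integrable cell (\<lambda>x. X x $ i $ j * w x)"
  proof (rule square_integrable_bounded_mult[OF L2_per_square_integrable[OF w] measurable_cell[OF m]])
    show "AE x in cell. \<bar>X x $ i $ j\<bar> \<le> C"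
      using AE_cell[OF X(3)] by eventually_elim (use abs_matrix_component_le order_trans in blast)
  qed
qed

lemma B_mult_L2_per: "w \<in> L2_per \<Longrightarrow> (\<lambda>x. B x $ i $ j * w x) \<in> L2_per"
  by (rule component_mult_L2_per[OF B_measurable B_periodic B_bounded])

definition defect :: "real^'n \<Rightarrow> real^'n^'n" where "defect x = mat 1 - B x"

lemma defect_measurable: "defect \<in> borel_measurable lebesgue"
  unfolding defect_def[abs_def] using B_measurable by measurable

lemma defect_bounded: "AE x in lebesgue. norm (defect x) \<le> \<theta>"
  using B_near by (simp add: defect_def)

lemma defect_mult_L2_per: "w \<in> L2_per \<Longrightarrow> (\<lambda>x. defect x $ i $ j * w x) \<in> L2_per"
  using ae_periodic_compose[OF B_periodic, of "\<lambda>Y. mat 1 - Y"]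
  by (intro component_mult_L2_per[OF defect_measurable _ defect_bounded]) (simp_all add: defect_def[abs_def])

lemma coef_defect:
  assumes w: "w \<in> L2_per"
  shows "coef (\<lambda>x. defect x $ i $ j * w x) k = mat 1 $ i $ j * coef w k - coef (\<lambda>x. B x $ i $ j * w x) k"
proof -
  have "(\<lambda>x. defect x $ i $ j * w x) = (\<lambda>x. mat 1 $ i $ j * w x - B x $ i $ j * w x)"
    by (simp add: defect_def left_diff_distrib)
  then show ?thesis
    using w by (simp only:) (subst coef_diff,
      auto intro!: L2_per_square_integrable B_mult_L2_per L2_per_cmult simp: coef_cmult)
qed

text \<open>Write B = I - defect and divide by |k|^2: the identity contributes exactly
  \<open>coef w k\<close>, because the symbol has trace 1. Frequency 0 imposes nothing in either
  form, so the mean of \<open>w\<close> remains free.\<close>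

lemma adjoint_null_iff:
  assumes w: "w \<in> L2_per"
  shows "adjoint_null w \<longleftrightarrow>
    (\<forall>k. k \<noteq> 0 \<longrightarrow>
      coef w k = (\<Sum>i\<in>UNIV. \<Sum>j\<in>UNIV. riesz_symbol k $ i $ j * coef (\<lambda>x. defect x $ i $ j * w x) k))"
proof -
  let ?b = "\<lambda>k. \<Sum>i\<in>UNIV. \<Sum>j\<in>UNIV. of_int (k $ i) * of_int (k $ j) * coef (\<lambda>x. B x $ i $ j * w x) k"
  have "(?b k = 0) = (coef w k
      = (\<Sum>i\<in>UNIV. \<Sum>j\<in>UNIV. riesz_symbol k $ i $ j * coef (\<lambda>x. defect x $ i $ j * w x) k))"
    if "k \<noteq> 0" for k
  proof -
    have "(\<Sum>i\<in>UNIV. \<Sum>j\<in>UNIV. riesz_symbol k $ i $ j * coef (\<lambda>x. defect x $ i $ j * w x) k)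
        = (mat 1 \<bullet> riesz_symbol k) * coef w k - ?b k / (norm (int_vec k))\<^sup>2"
      unfolding coef_defect[OF w] matrix_inner
      by (simp add: right_diff_distrib sum_subtractf sum_distrib_right sum_distrib_left
          sum_divide_distrib riesz_symbol_nth mult_ac)
    then show ?thesis using that by (auto simp: trace_riesz_symbol)
  qed
  note iff = this
  have 0: "?b 0 = 0" by simp
  show ?thesis
    unfolding adjoint_null_def
  proof (intro iffI allI impI)
    fix k :: "int^'n" assume "\<forall>k. ?b k = 0" "k \<noteq> 0"
    then show "coef w k = (\<Sum>i\<in>UNIV. \<Sum>j\<in>UNIV. riesz_symbol k $ i $ j * coef (\<lambda>x. defect x $ i $ j * w x) k)"
      using iff[of k] by simp
  next
    fix k :: "int^'n"
    assume r: "\<forall>k. k \<noteq> 0 \<longrightarrow>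
      coef w k = (\<Sum>i\<in>UNIV. \<Sum>j\<in>UNIV. riesz_symbol k $ i $ j * coef (\<lambda>x. defect x $ i $ j * w x) k)"
    show "?b k = 0"
    proof (cases "k = 0")
      case True
      show ?thesis unfolding True by (rule 0)
    next
      case False
      with r iff[OF False] show ?thesis by blast
    qed
  qed
qed

lemma defect_contraction:
  assumes w: "w \<in> L2_per" and v: "v \<in> L2_per"
    and c: "\<And>k. coef w k = (\<Sum>i\<in>UNIV. \<Sum>j\<in>UNIV. riesz_symbol k $ i $ j * coef (\<lambda>x. defect x $ i $ j * v x) k)"
  shows "norm_on cell w \<le> \<theta> * norm_on cell v"
proof (rule power2_le_imp_le)
  have "(norm_on cell w)\<^sup>2 \<le> (\<Sum>i\<in>UNIV. \<Sum>j\<in>UNIV. (norm_on cell (\<lambda>x. defect x $ i $ j * v x))\<^sup>2)"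
    by (rule riesz_norm_le[OF defect_mult_L2_per[OF v] w c])
  also have "\<dots> \<le> \<theta>\<^sup>2 * (norm_on cell v)\<^sup>2"
    by (intro norm_on_matrix_mult measurable_cell defect_measurable AE_cell[OF defect_bounded]
        L2_per_square_integrable v)
  finally show "(norm_on cell w)\<^sup>2 \<le> (\<theta> * norm_on cell v)\<^sup>2" by (simp add: power_mult_distrib)
qed (use \<theta> in auto)

text \<open>Mean zero makes the fixed-point equation hold at frequency 0 too, where the symbol
  vanishes. A linear contraction has no fixed point but 0.\<close>

lemma adjoint_null_unique:
  assumes w: "w \<in> L2_per" "adjoint_null w" "coef w 0 = 0"
  shows "AE x in lebesgue. w x = 0"
proof -
  have "coef w k = (\<Sum>i\<in>UNIV. \<Sum>j\<in>UNIV. riesz_symbol k $ i $ j * coef (\<lambda>x. defect x $ i $ j * w x) k)" for k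
    using w adjoint_null_iff[OF w(1)] by (cases "k = 0") auto
  then have "norm_on cell w \<le> \<theta> * norm_on cell w" by (rule defect_contraction[OF w(1) w(1)])
  then have "(1 - \<theta>) * norm_on cell w \<le> 0" by (simp add: algebra_simps)
  then have "norm_on cell w = 0"
    using \<theta> norm_on_nonneg[of cell w] by (simp add: mult_le_0_iff)
  then have "AE x in cell. w x = 0" by (rule norm_on_eq_0[OF L2_per_square_integrable[OF w(1)]])
  then show ?thesis
    using w(1) by (intro ae_periodic_eq_AE[of w "\<lambda>x. 0"]) (auto simp: L2_per_iff)
qed

lemma adjoint_null_diff:
  assumes "w \<in> L2_per" "v \<in> L2_per" "adjoint_null w" "adjoint_null v"
  shows "adjoint_null (\<lambda>x. w x - c * v x)"
proof -
  have "coef (\<lambda>x. B x $ i $ j * (w x - c * v x)) k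
      = coef (\<lambda>x. B x $ i $ j * w x) k - c * coef (\<lambda>x. B x $ i $ j * v x) k" for i j k
  proof -
    have "(\<lambda>x. B x $ i $ j * (w x - c * v x)) = (\<lambda>x. B x $ i $ j * w x - c * (B x $ i $ j * v x))"
      by (simp add: algebra_simps)
    then show ?thesis
      using assms by (simp only:) (subst coef_diff,
        auto intro!: L2_per_square_integrable B_mult_L2_per L2_per_cmult simp: coef_cmult)
  qed
  then have "(\<Sum>i\<in>UNIV. \<Sum>j\<in>UNIV. of_int (k $ i) * of_int (k $ j) * coef (\<lambda>x. B x $ i $ j * (w x - c * v x)) k)
      = (\<Sum>i\<in>UNIV. \<Sum>j\<in>UNIV. of_int (k $ i) * of_int (k $ j) * coef (\<lambda>x. B x $ i $ j * w x) k)
        - c * (\<Sum>i\<in>UNIV. \<Sum>j\<in>UNIV. of_int (k $ i) * of_int (k $ j) * coef (\<lambda>x. B x $ i $ j * v x) k)" for k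
    by (simp add: right_diff_distrib sum_subtractf sum_distrib_left mult_ac)
  then show ?thesis using assms(3,4) by (simp add: adjoint_null_def)
qed

lemma adjoint_null_proportional:
  assumes "w \<in> L2_per" "v \<in> L2_per" "adjoint_null w" "adjoint_null v" "coef v 0 = 1"
  shows "AE x in lebesgue. w x = coef w 0 * v x"
proof -
  have s: "square_integrable cell w" "square_integrable cell v"
    using assms by (auto intro: L2_per_square_integrable)
  have "coef (\<lambda>x. w x - coef w 0 * v x) 0 = 0"
    using assms s by (simp add: coef_diff square_integrable_cmult coef_cmult)
  then have "AE x in lebesgue. w x - coef w 0 * v x = 0"
    using assms by (intro adjoint_null_unique adjoint_null_diff L2_per_diff L2_per_cmult)
  then show ?thesis by simp
qed

text \<open>Picard iteration starting from the constant 1; the term added at frequency 0 prescribes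
  the mean. The fixed-point equation is verified on coefficients, which pass to the L2
  limit.\<close>

lemma adjoint_null_exists:
  obtains w where "w \<in> L2_per" "adjoint_null w" "coef w 0 = 1"
proof -
  let ?R = "\<lambda>v k. \<Sum>i\<in>UNIV. \<Sum>j\<in>UNIV. riesz_symbol k $ i $ j * coef (\<lambda>x. defect x $ i $ j * v x) k"
  have "\<exists>w. w \<in> L2_per \<and> (\<forall>k. coef w k = (if k = 0 then 1 else 0) + ?R v k)" if v: "v \<in> L2_per" for v
  proof -
    obtain w where w: "w \<in> L2_per" "\<And>k. coef w k = ?R v k"
      
    proof (rule riesz_exists[of "\<lambda>i j x. defect x $ i $ j * v x", OF defect_mult_L2_per[OF v]])
    qed (rule that)
    show ?thesis
      using w by (intro exI[of _ "\<lambda>x. 1 + w x"])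
        (auto simp: coef_add coef_const L2_per_add L2_per_square_integrable)
  qed
  note ex = this
  \<comment> \<open>The value is determined only up to a null set, but all that follows uses
    membership in \<open>L2_per\<close> and the coefficients.\<close>
  define T where "T v = (SOME w. w \<in> L2_per \<and> (\<forall>k. coef w k = (if k = 0 then 1 else 0) + ?R v k))" for v
  have T0: "T v \<in> L2_per \<and> (\<forall>k. coef (T v) k = (if k = 0 then 1 else 0) + ?R v k)" if "v \<in> L2_per" for v
    unfolding T_def by (rule someI_ex[OF ex[OF that]])
  have T: "T v \<in> L2_per" "coef (T v) k = (if k = 0 then 1 else 0) + ?R v k" if "v \<in> L2_per" for v k
    using T0[OF that] by blast+
  define u where "u n = (T ^^ n) (\<lambda>x. 1)" for n
  have u: "u n \<in> L2_per" for n unfolding u_def by (induction n) (auto intro: T)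
  have us: "square_integrable cell (u n)" for n by (rule L2_per_square_integrable[OF u])
  have uS: "u (Suc n) = T (u n)" for n by (simp add: u_def)
  have ds: "(\<lambda>x. defect x $ i $ j * u n x) \<in> L2_per" for n i j by (rule defect_mult_L2_per[OF u])
  have Rd: "?R (\<lambda>x. u m x - u n x) k = ?R (u m) k - ?R (u n) k" for m n k
  proof -
    have "coef (\<lambda>x. defect x $ i $ j * (u m x - u n x)) k
      = coef (\<lambda>x. defect x $ i $ j * u m x) k - coef (\<lambda>x. defect x $ i $ j * u n x) k" for i j
      using ds by (simp add: right_diff_distrib coef_diff L2_per_square_integrable)
    then show ?thesis by (simp add: right_diff_distrib sum_subtractf)
  qed
  let ?d = "\<lambda>m n. norm_on cell (\<lambda>x. u m x - u n x)"
  have step: "?d (Suc m) (Suc n) \<le> \<theta> * ?d m n" for m n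
  proof (rule defect_contraction)
    show "coef (\<lambda>x. u (Suc m) x - u (Suc n) x) k = ?R (\<lambda>x. u m x - u n x) k" for k
      unfolding Rd using us by (simp add: coef_diff uS[of m] uS[of n] T u L2_per_square_integrable)
  qed (intro L2_per_diff u)+
  have geo: "?d (n + m) n \<le> \<theta> ^ n * ?d m 0" for m n
  proof (induction n)
    case (Suc n)
    have "?d (Suc n + m) (Suc n) \<le> \<theta> * ?d (n + m) n" using step[of "n + m" n] by simp
    also have "\<dots> \<le> \<theta> * (\<theta> ^ n * ?d m 0)" using Suc \<theta> by (intro mult_left_mono) auto
    finally show ?case by simp
  qed simp
  \<comment> \<open>The sum of the geometric series of increments, that is, the solution of D =
    \<open>\<theta>\<close> D + \<open>?d 1 0\<close>.\<close>
  define D where "D = ?d 1 0 / (1 - \<theta>)"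
  have D: "?d m 0 \<le> D" for m
  proof (induction m)
    case 0
    have "?d 0 0 = 0" by (simp add: norm_on_def)
    then show ?case using \<theta> by (simp add: D_def)
  next
    case (Suc m)
    have "?d (Suc m) 0 = norm_on cell (\<lambda>x. (u (Suc m) x - u (Suc 0) x) + (u (Suc 0) x - u 0 x))" by simp
    also have "\<dots> \<le> ?d (Suc m) (Suc 0) + ?d (Suc 0) 0"
      by (intro norm_on_triangle square_integrable_diff us)
    also have "\<dots> \<le> \<theta> * ?d m 0 + ?d 1 0" using step[of m 0] by simp
    also have "\<dots> \<le> \<theta> * D + (1 - \<theta>) * D" using Suc \<theta> by (intro add_mono mult_left_mono) (auto simp: D_def)
    also have "\<dots> = D" by (simp add: algebra_simps)
    finally show ?case .
  qed
  have Cau: "\<exists>N. \<forall>n\<ge>N. \<forall>m\<ge>n. ?d m n \<le> e" if "e > 0" for e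
  proof -
    have "(\<lambda>n. \<theta> ^ n * D) \<longlonglongrightarrow> 0 * D" using \<theta> by (intro tendsto_mult tendsto_const LIMSEQ_realpow_zero) auto
    then have "eventually (\<lambda>n. \<theta> ^ n * D < e) sequentially"
      using that by (intro order_tendstoD(2)) auto
    then obtain N where N: "\<And>n. n \<ge> N \<Longrightarrow> \<theta> ^ n * D < e" by (auto simp: eventually_sequentially)
    have "?d m n \<le> e" if "n \<ge> N" "n \<le> m" for m n
    proof -
      have "?d m n \<le> \<theta> ^ n * ?d (m - n) 0" using geo[of n "m - n"] that(2) by simp
      also have "\<dots> \<le> \<theta> ^ n * D" using D \<theta> by (intro mult_left_mono) auto
      finally show ?thesis using N[OF that(1)] by linarith
    qed
    then show ?thesis by blast
  qed
  obtain w where w: "w \<in> L2_per" and lim: "(\<lambda>n. norm_on cell (\<lambda>x. u n x - w x)) \<longlonglongrightarrow> 0"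
    by (rule L2_per_complete[OF u Cau])
  have ws: "square_integrable cell w" by (rule L2_per_square_integrable[OF w])
  have cw: "coef w k = (if k = 0 then 1 else 0) + ?R w k" for k
  proof (rule LIMSEQ_unique)
    have "(\<lambda>n. coef (u n) k) \<longlonglongrightarrow> coef w k" by (rule coef_tendsto[OF us ws lim])
    then show "(\<lambda>n. coef (u (Suc n)) k) \<longlonglongrightarrow> coef w k" by (rule LIMSEQ_Suc)
    have "(\<lambda>n. coef (\<lambda>x. defect x $ i $ j * u n x) k) \<longlonglongrightarrow> coef (\<lambda>x. defect x $ i $ j * w x) k" for i j
    proof (rule coef_tendsto)
      show "square_integrable cell (\<lambda>x. defect x $ i $ j * u n x)" for n
        by (rule L2_per_square_integrable[OF ds])
      show "square_integrable cell (\<lambda>x. defect x $ i $ j * w x)"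
        by (rule L2_per_square_integrable[OF defect_mult_L2_per[OF w]])
      have "norm_on cell (\<lambda>x. defect x $ i $ j * u n x - defect x $ i $ j * w x)
          \<le> norm_on cell (\<lambda>x. u n x - w x)" for n
      proof (rule norm_on_mono)
        show "square_integrable cell (\<lambda>x. u n x - w x)" by (intro square_integrable_diff us ws)
        show "(\<lambda>x. defect x $ i $ j * u n x - defect x $ i $ j * w x) \<in> borel_measurable cell"
          by (intro square_integrable_measurable square_integrable_diff L2_per_square_integrable ds
              defect_mult_L2_per w)
        show "AE x in cell. \<bar>defect x $ i $ j * u n x - defect x $ i $ j * w x\<bar> \<le> \<bar>u n x - w x\<bar>"
          using AE_cell[OF defect_bounded]
        proof eventually_elim
          case (elim x)
          then have "\<bar>defect x $ i $ j\<bar> \<le> 1" using abs_matrix_component_le[of "defect x" i j] \<theta> by linarith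
          then have "\<bar>defect x $ i $ j\<bar> * \<bar>u n x - w x\<bar> \<le> 1 * \<bar>u n x - w x\<bar>" by (intro mult_right_mono) auto
          then show ?case by (simp add: right_diff_distrib[symmetric] abs_mult)
        qed
      qed
      then show "(\<lambda>n. norm_on cell (\<lambda>x. defect x $ i $ j * u n x - defect x $ i $ j * w x)) \<longlonglongrightarrow> 0"
        by (intro tendsto_sandwich[OF _ _ tendsto_const lim]) auto
    qed
    then have "(\<lambda>n. (if k = 0 then 1 else 0) + ?R (u n) k) \<longlonglongrightarrow> (if k = 0 then 1 else 0) + ?R w k"
      by (intro tendsto_intros)
    then show "(\<lambda>n. coef (u (Suc n)) k) \<longlonglongrightarrow> (if k = 0 then 1 else 0) + ?R w k"
      by (simp add: uS T u)
  qed
  have "adjoint_null w" using cw by (simp add: adjoint_null_iff[OF w])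
  moreover have "coef w 0 = 1" using cw[of 0] by simp
  ultimately show thesis using w that by blast
qed

lemma inner_hessian:
  assumes w: "w \<in> L2_per" and f: "f \<in> H_per 2"
  shows "L2_inner w (\<lambda>x. B x \<bullet> hessian f x)
    = (\<Sum>i\<in>UNIV. \<Sum>j\<in>UNIV. inner_on cell (\<lambda>x. B x $ i $ j * w x) (weak_deriv [i, j] f))"
proof -
  have i: "integrable cell (\<lambda>x. B x $ i $ j * w x * weak_deriv [i, j] f x)" for i j
    by (intro square_integrable_mult L2_per_square_integrable B_mult_L2_per w weak_deriv2 f)
  have "(\<lambda>x. w x * (B x \<bullet> hessian f x))
      = (\<lambda>x. \<Sum>i\<in>UNIV. \<Sum>j\<in>UNIV. B x $ i $ j * w x * weak_deriv [i, j] f x)"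
    by (simp add: matrix_inner hessian_def sum_distrib_left mult_ac)
  then have "L2_inner w (\<lambda>x. B x \<bullet> hessian f x)
      = (\<integral>x. (\<Sum>i\<in>UNIV. \<Sum>j\<in>UNIV. B x $ i $ j * w x * weak_deriv [i, j] f x) \<partial>cell)"
    by (simp add: L2_inner_eq inner_on_def)
  also have "\<dots> = (\<Sum>i\<in>UNIV. \<Sum>j\<in>UNIV. inner_on cell (\<lambda>x. B x $ i $ j * w x) (weak_deriv [i, j] f))"
    using i by (simp add: inner_on_def Bochner_Integration.integral_sum)
  finally show ?thesis .
qed

text \<open>At each frequency the Hessian contributes k_i k_j times a common scalar, so the sum over
  i and j is a multiple of the one that \<open>adjoint_null\<close> annihilates; Parseval then
  passes to the limit.\<close>

lemma adjoint_null_orthogonal: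
  assumes w: "w \<in> L2_per" and n: "adjoint_null w" and f: "f \<in> H_per 2"
  shows "L2_inner w (\<lambda>x. B x \<bullet> hessian f x) = 0"
proof -
  have "(\<lambda>d. \<Sum>i\<in>UNIV. \<Sum>j\<in>UNIV. \<Sum>k\<in>freq d. coef (\<lambda>x. B x $ i $ j * w x) k * coef (weak_deriv [i, j] f) k)
      \<longlonglongrightarrow> L2_inner w (\<lambda>x. B x \<bullet> hessian f x)"
    unfolding inner_hessian[OF w f] by (intro tendsto_sum Parseval_inner B_mult_L2_per w weak_deriv2 f)
  moreover have "(\<Sum>i\<in>UNIV. \<Sum>j\<in>UNIV. \<Sum>k\<in>freq d. coef (\<lambda>x. B x $ i $ j * w x) k * coef (weak_deriv [i, j] f) k) = 0"
    for d
  proof -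
    have "(\<Sum>i\<in>UNIV. \<Sum>j\<in>UNIV. \<Sum>k\<in>freq d. coef (\<lambda>x. B x $ i $ j * w x) k * coef (weak_deriv [i, j] f) k)
        = (\<Sum>k\<in>freq d. \<Sum>i\<in>UNIV. \<Sum>j\<in>UNIV. coef (\<lambda>x. B x $ i $ j * w x) k * coef (weak_deriv [i, j] f) k)"
      by (rule sum_swap_outer)
    also have "\<dots> = (\<Sum>k\<in>freq d. (- 4 * pi\<^sup>2 * coef f k) * 0)"
    proof (intro sum.cong refl)
      fix k :: "int^'n"
      have "(\<Sum>i\<in>UNIV. \<Sum>j\<in>UNIV. coef (\<lambda>x. B x $ i $ j * w x) k * coef (weak_deriv [i, j] f) k)
          = (- 4 * pi\<^sup>2 * coef f k) *
            (\<Sum>i\<in>UNIV. \<Sum>j\<in>UNIV. of_int (k $ i) * of_int (k $ j) * coef (\<lambda>x. B x $ i $ j * w x) k)"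
        unfolding weak_deriv2(2)[OF f] sum_distrib_left by (intro sum.cong refl) (simp add: mult_ac)
      then show "(\<Sum>i\<in>UNIV. \<Sum>j\<in>UNIV. coef (\<lambda>x. B x $ i $ j * w x) k * coef (weak_deriv [i, j] f) k)
          = (- 4 * pi\<^sup>2 * coef f k) * 0"
        using n by (simp only: adjoint_null_def)
    qed
    finally show ?thesis by simp
  qed
  ultimately show ?thesis by (simp add: LIMSEQ_const_iff)
qed

lemma hart_H_per0: "k \<noteq> 0 \<Longrightarrow> hart k \<in> H_per0 2"
  using hart_H_per2[of k] by (simp add: H_per0_def cell_integral_eq integral_hart)

text \<open>Hartley functions of nonzero frequency are admissible test functions, and each isolates
  the condition at its own frequency.\<close>

lemma orthogonal_adjoint_null:
  assumes w: "w \<in> L2_per" and o: "\<And>f. f \<in> H_per0 2 \<Longrightarrow> L2_inner w (\<lambda>x. B x \<bullet> hessian f x) = 0"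
  shows "adjoint_null w"
  unfolding adjoint_null_def
proof
  fix k :: "int^'n"
  show "(\<Sum>i\<in>UNIV. \<Sum>j\<in>UNIV. of_int (k $ i) * of_int (k $ j) * coef (\<lambda>x. B x $ i $ j * w x) k) = 0"
  proof (cases "k = 0")
    case False
    have e: "inner_on cell (\<lambda>x. B x $ i $ j * w x) (weak_deriv [i, j] (hart k))
        = (- 4 * pi\<^sup>2) * (of_int (k $ i) * of_int (k $ j) * coef (\<lambda>x. B x $ i $ j * w x) k)" for i j
    proof -
      let ?c = "- 4 * pi\<^sup>2 * of_int (k $ i) * of_int (k $ j)"
      have L: "weak_deriv [i, j] (hart k) \<in> L2_per" "(\<lambda>x. ?c * hart k x) \<in> L2_per"
        by (intro weak_deriv2 hart_H_per2 L2_per_cmult hart_L2_per)+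
      \<comment> \<open>The chosen weak derivative agrees with the classical one only almost
        everywhere, a difference that the integral does not see.\<close>
      have "AE x in lebesgue. weak_deriv [i, j] (hart k) x = ?c * hart k x"
        by (rule coef_eq_imp_AE[OF L]) (simp only: weak_deriv2[OF hart_H_per2] coef_cmult coef_hart split: if_splits, simp)
      then have "inner_on cell (\<lambda>x. B x $ i $ j * w x) (weak_deriv [i, j] (hart k))
          = inner_on cell (\<lambda>x. B x $ i $ j * w x) (\<lambda>x. ?c * hart k x)"
        using L B_mult_L2_per[OF w, of i j]
        by (intro inner_on_cong_AE AE_cell) (auto simp: L2_per_iff intro: measurable_cell)
      also have "\<dots> = ?c * coef (\<lambda>x. B x $ i $ j * w x) k"
        by (simp only: inner_on_commute[of _ "\<lambda>x. B x $ i $ j * w x"] inner_on_cmult coef_def)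
      finally show ?thesis by (simp add: mult_ac)
    qed
    have "0 = (\<Sum>i\<in>UNIV. \<Sum>j\<in>UNIV. (- 4 * pi\<^sup>2) * (of_int (k $ i) * of_int (k $ j) * coef (\<lambda>x. B x $ i $ j * w x) k))"
      using o[OF hart_H_per0[OF False]] inner_hessian[OF w hart_H_per2, of k] e by simp
    also have "\<dots> = (- 4 * pi\<^sup>2) * (\<Sum>i\<in>UNIV. \<Sum>j\<in>UNIV. of_int (k $ i) * of_int (k $ j) * coef (\<lambda>x. B x $ i $ j * w x) k)"
      by (simp only: sum_distrib_left)
    finally show ?thesis by simp
  qed simp
qed

end

section \<open>Nonnegativity\<close>


lemma norm_on_matrix_norm:
  fixes H :: "'a \<Rightarrow> real^'n^'m"
  assumes H: "\<And>i j. square_integrable M (\<lambda>x. H x $ i $ j)"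
  shows "square_integrable M (\<lambda>x. norm (H x))"
    and "(norm_on M (\<lambda>x. norm (H x)))\<^sup>2 = (\<Sum>i\<in>UNIV. \<Sum>j\<in>UNIV. (norm_on M (\<lambda>x. H x $ i $ j))\<^sup>2)"
proof -
  have [measurable]: "(\<lambda>x. H x $ i $ j) \<in> borel_measurable M" for i j
    by (rule square_integrable_measurable[OF H])
  have i: "integrable M (\<lambda>x. (H x $ i $ j)\<^sup>2)" for i j by (rule square_integrableD[OF H])
  have "(\<lambda>x. norm (H x)) = (\<lambda>x. sqrt (\<Sum>i\<in>UNIV. \<Sum>j\<in>UNIV. (H x $ i $ j)\<^sup>2))"
    unfolding matrix_norm_sq[symmetric] by simp
  then have "(\<lambda>x. norm (H x)) \<in> borel_measurable M" by simp
  then show "square_integrable M (\<lambda>x. norm (H x))"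
    using i by (simp add: square_integrable_def matrix_norm_sq)
  show "(norm_on M (\<lambda>x. norm (H x)))\<^sup>2 = (\<Sum>i\<in>UNIV. \<Sum>j\<in>UNIV. (norm_on M (\<lambda>x. H x $ i $ j))\<^sup>2)"
    using i by (simp add: norm_on_def matrix_norm_sq Bochner_Integration.integral_sum sum_nonneg)
qed

section \<open>Second-order conditions at a maximum\<close>

text \<open>If c were positive, g' would be positive just to the right of its zero at 0, and g would
  increase there.\<close>

lemma second_derivative_at_max:
  fixes g g' :: "real \<Rightarrow> real"
  assumes g: "\<And>t. (g has_real_derivative g' t) (at t)" and c: "(g' has_real_derivative c) (at 0)"
    and max: "\<And>t. g t \<le> g 0"
  shows "c \<le> 0"
proof (rule ccontr)
  assume "\<not> c \<le> 0"
  then have "c > 0" by simp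
  then obtain d where d: "d > 0" "\<And>h. 0 < h \<Longrightarrow> h < d \<Longrightarrow> g' 0 < g' (0 + h)"
    using DERIV_pos_inc_right[OF c] by blast
  have g0: "g' 0 = 0" using DERIV_local_max[OF g[of 0], of 1] max by auto
  obtain z where z: "0 < z" "z < d / 2" "g (d / 2) - g 0 = (d / 2 - 0) * g' z"
    using MVT2[of 0 "d / 2" g g'] d(1) g by auto
  then have "g' z > 0" using d(2)[of z] g0 by simp
  then have "g (d / 2) - g 0 > 0" unfolding z(3) using d(1) by simp
  then show False using max[of "d / 2"] by simp
qed

text \<open>Testing with combinations of two basis vectors gives K_ij^2 \<le> K_ii K_jj, and the
  double sum of the right-hand sides is the square of the trace.\<close>

lemma psd_norm_le_trace:
  fixes K :: "real^'n^'n"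
  assumes sym: "\<And>i j. K $ i $ j = K $ j $ i"
    and psd: "\<And>\<xi>. 0 \<le> (\<Sum>i\<in>UNIV. \<Sum>j\<in>UNIV. \<xi> $ i * \<xi> $ j * K $ i $ j)"
  shows "norm K \<le> mat 1 \<bullet> K"
proof -
  have tr: "mat 1 \<bullet> K = (\<Sum>i\<in>UNIV. K $ i $ i)"
    by (simp add: matrix_inner mat_def if_distrib[where f="\<lambda>x. x * _"] cong: if_cong)
  have quad: "0 \<le> s\<^sup>2 * K $ i $ i + 2 * s * t * K $ i $ j + t\<^sup>2 * K $ j $ j" for i j s t
  proof -
    let ?x = "axis i s + axis j t :: real^'n"
    have row: "(\<Sum>b\<in>UNIV. ?x $ b * y $ b) = s * y $ i + t * y $ j" for y :: "real^'n"
    proof -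
      have "(\<Sum>b\<in>UNIV. ?x $ b * y $ b) = ?x \<bullet> y" by (simp add: inner_vec_def)
      then show ?thesis by (simp add: inner_add_left inner_axis')
    qed
    have "(\<Sum>a\<in>UNIV. \<Sum>b\<in>UNIV. ?x $ a * ?x $ b * K $ a $ b)
        = (\<Sum>a\<in>UNIV. ?x $ a * (\<chi> a. \<Sum>b\<in>UNIV. ?x $ b * K $ a $ b) $ a)"
      by (simp add: sum_distrib_left mult.assoc)
    also have "\<dots> = s * (s * K $ i $ i + t * K $ i $ j) + t * (s * K $ j $ i + t * K $ j $ j)"
      unfolding row by (simp only: vec_lambda_beta row)
    also have "\<dots> = s\<^sup>2 * K $ i $ i + 2 * s * t * K $ i $ j + t\<^sup>2 * K $ j $ j"
      unfolding sym[of j i] by (simp add: power2_eq_square algebra_simps)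
    finally show ?thesis using psd[of ?x] by simp
  qed
  have diag: "0 \<le> K $ i $ i" for i using quad[of 1 i 0 i] by simp
  have off: "(K $ i $ j)\<^sup>2 \<le> K $ i $ i * K $ j $ j" for i j
  proof (cases "K $ j $ j = 0")
    case True
    have "K $ i $ j = 0"
    proof (rule ccontr)
      assume "K $ i $ j \<noteq> 0"
      moreover have "0 \<le> K $ i $ i + 2 * (- (K $ i $ i + 1) / (2 * K $ i $ j)) * K $ i $ j"
        using quad[of 1 i "- (K $ i $ i + 1) / (2 * K $ i $ j)" j] True by simp
      ultimately show False by (simp add: field_simps)
    qed
    then show ?thesis using True by simp
  next
    case False
    then have p: "K $ j $ j > 0" using diag[of j] by linarith
    have "0 \<le> (K $ j $ j)\<^sup>2 * K $ i $ i + 2 * K $ j $ j * (- K $ i $ j) * K $ i $ j + (- K $ i $ j)\<^sup>2 * K $ j $ j"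
      by (rule quad)
    then have "0 \<le> K $ j $ j * (K $ i $ i * K $ j $ j - (K $ i $ j)\<^sup>2)"
      by (simp add: power2_eq_square algebra_simps)
    then show ?thesis using p by (simp add: zero_le_mult_iff)
  qed
  show ?thesis
  proof (rule power2_le_imp_le)
    have "(norm K)\<^sup>2 \<le> (\<Sum>i\<in>UNIV. \<Sum>j\<in>UNIV. K $ i $ i * K $ j $ j)"
      unfolding matrix_norm_sq by (intro sum_mono off)
    also have "\<dots> = (mat 1 \<bullet> K)\<^sup>2" unfolding tr by (simp add: sum_product power2_eq_square)
    finally show "(norm K)\<^sup>2 \<le> (mat 1 \<bullet> K)\<^sup>2" .
    show "0 \<le> mat 1 \<bullet> K" unfolding tr by (intro sum_nonneg diag)
  qed
qed

section \<open>Trigonometric Hessians and their maximum principle\<close>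

text \<open>
  For a trigonometric polynomial \<open>f\<close> of degree at most \<open>d\<close>, this is \<open>D\<^sup>2 \<Delta>\<^sup>-\<^sup>1 f\<close>.
\<close>

definition trig_hess :: "nat \<Rightarrow> (real^'n \<Rightarrow> real) \<Rightarrow> real^'n \<Rightarrow> real^'n^'n" where
  "trig_hess d f x = (\<chi> i j. trig_sum d (\<lambda>k. riesz_symbol k $ i $ j * coef f k) x)"

lemma trig_hess_nth: "trig_hess d f x $ i $ j = trig_sum d (\<lambda>k. riesz_symbol k $ i $ j * coef f k) x"
  by (simp add: trig_hess_def)

lemma trig_hess_alt: "trig_hess d f x = (\<Sum>k\<in>freq d. (coef f k * hart k x) *\<^sub>R riesz_symbol k)"
  by (simp add: trig_hess_def trig_sum_def vec_eq_iff sum_component mult_ac)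

lemma is_trig_coef_0: "is_trig d f \<Longrightarrow> k \<notin> freq d \<Longrightarrow> coef f k = 0"
  using is_trig_expand[of d f] by (metis coef_trig_sum)

lemma trig_hess_mono:
  assumes "is_trig d f" "d \<le> e" shows "trig_hess e f x = trig_hess d f x"
  unfolding trig_hess_alt
  using is_trig_coef_0[OF assms(1)] freq_mono[OF assms(2)]
  by (intro sum.mono_neutral_right) auto

lemma trig_hess_add:
  assumes "square_integrable cell f" "square_integrable cell g"
  shows "trig_hess d (\<lambda>x. f x + g x) y = trig_hess d f y + trig_hess d g y"
  unfolding trig_hess_alt
  by (simp add: coef_add[OF assms] distrib_right scaleR_add_left sum.distrib)

text \<open>The Laplacian undoes its inverse on functions of mean zero; on coefficients this is the
  trace 1 of the symbol.\<close>

lemma trace_trig_hess: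
  assumes f: "is_trig d f" and f0: "coef f 0 = 0" shows "mat 1 \<bullet> trig_hess d f x = f x"
proof -
  have "mat 1 \<bullet> trig_hess d f x = (\<Sum>k\<in>freq d. (coef f k * hart k x) * (mat 1 \<bullet> riesz_symbol k))"
    by (simp add: trig_hess_alt inner_sum_right)
  also have "\<dots> = (\<Sum>k\<in>freq d. coef f k * hart k x)"
  proof (intro sum.cong refl)
    fix k :: "int^'a"
    show "(coef f k * hart k x) * (mat 1 \<bullet> riesz_symbol k) = coef f k * hart k x"
      using f0 by (cases "k = 0") (auto simp: trace_riesz_symbol)
  qed
  also have "\<dots> = f x" using is_trig_expand[OF f] by (metis trig_sum_def)
  finally show ?thesis .
qed

lemma square_integrable_trig_hess: "square_integrable cell (\<lambda>x. trig_hess d f x $ i $ j)"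
  by (simp add: trig_hess_nth)

lemma norm_trig_hess_le:
  assumes f: "is_trig d f"
  shows "norm_on cell (\<lambda>x. norm (trig_hess d f x)) \<le> norm_on cell f"
proof (rule power2_le_imp_le)
  have "(norm_on cell (\<lambda>x. norm (trig_hess d f x)))\<^sup>2
      = (\<Sum>i\<in>UNIV. \<Sum>j\<in>UNIV. \<Sum>k\<in>freq d. (riesz_symbol k $ i $ j * coef f k)\<^sup>2)"
    unfolding norm_on_matrix_norm(2)[OF square_integrable_trig_hess] trig_hess_nth norm_trig_sum ..
  also have "\<dots> = (\<Sum>k\<in>freq d. \<Sum>i\<in>UNIV. \<Sum>j\<in>UNIV. (riesz_symbol k $ i $ j * coef f k)\<^sup>2)"
    by (rule sum_swap_outer)
  also have "\<dots> = (\<Sum>k\<in>freq d. (norm (riesz_symbol k))\<^sup>2 * (coef f k)\<^sup>2)"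
    by (simp add: matrix_norm_sq power_mult_distrib sum_distrib_right)
  also have "\<dots> \<le> (\<Sum>k\<in>freq d. 1\<^sup>2 * (coef f k)\<^sup>2)"
    by (intro sum_mono mult_right_mono power_mono norm_riesz_symbol_le) auto
  also have "\<dots> = (norm_on cell f)\<^sup>2"
    using is_trig_expand[OF f] norm_trig_sum[of d "coef f"] by simp
  finally show "(norm_on cell (\<lambda>x. norm (trig_hess d f x)))\<^sup>2 \<le> (norm_on cell f)\<^sup>2" .
qed simp

lemma int_periodic_cbox: assumes "int_periodic f" obtains y where "y \<in> cbox 0 1" "f x = f y"
proof -
  let ?k = "int_vec (\<chi> i. \<lfloor>x $ i\<rfloor>)"
  have "f ((x - ?k) + ?k) = f (x - ?k)" using assms int_vec_Ints unfolding int_periodic_def by blast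
  moreover have "x - ?k \<in> cbox 0 1"
    by (simp add: mem_box_cart frac_def[symmetric] less_imp_le[OF frac_lt_1])
  ultimately show thesis using that by simp
qed

text \<open>\<open>trig_hess d f\<close> is the Hessian of \<open>?p\<close>, the inverse Laplacian
  of the part of \<open>f\<close> up to degree d. By periodicity \<open>?p\<close> has a global
  maximum, and there the second derivative along every line is at most 0.\<close>

lemma trig_hess_nonpos_at_max:
  fixes f :: "real^'n \<Rightarrow> real"
  obtains x0 where "\<And>\<xi>. (\<Sum>i\<in>UNIV. \<Sum>j\<in>UNIV. \<xi> $ i * \<xi> $ j * trig_hess d f x0 $ i $ j) \<le> 0"
proof -
  let ?a = "\<lambda>k. - coef f k / (4 * pi\<^sup>2 * (norm (int_vec k))\<^sup>2)"
  let ?p = "trig_sum d ?a :: real^'n \<Rightarrow> real"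
  have pt: "is_trig d ?p" by simp
  have "\<exists>x\<in>cbox 0 1. \<forall>y\<in>cbox 0 1. ?p y \<le> ?p x"
  proof (rule continuous_attains_sup)
    show "cbox 0 (1 :: real^'n) \<noteq> {}" by (simp add: box_ne_empty Basis_vec_def inner_axis)
  qed (auto simp only: compact_cbox intro: is_trig_continuous[OF pt])
  then obtain x0 where x0: "\<And>y. y \<in> cbox 0 1 \<Longrightarrow> ?p y \<le> ?p x0" by blast
  have max: "?p y \<le> ?p x0" for y
  proof -
    obtain z where "z \<in> cbox 0 1" "?p y = ?p z"
      by (rule int_periodic_cbox[OF is_trig_periodic[OF pt]])
    then show ?thesis using x0 by simp
  qed
  show thesis
  proof
    fix \<xi> :: "real^'n"
    \<comment> \<open>The addition theorem makes \<open>?p\<close> along the line through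
      \<open>x0\<close> in direction \<xi> an explicit finite sum in t; \<open>?g'\<close> is its
      derivative and \<open>?c\<close> its second derivative at 0.\<close>
    let ?g = "\<lambda>t. \<Sum>k\<in>freq d. ?a k * (cos (t * phase k \<xi>) * hart k x0 + sin (t * phase k \<xi>) * hart (- k) x0)"
    let ?g' = "\<lambda>t. \<Sum>k\<in>freq d. ?a k * (- sin (t * phase k \<xi>) * phase k \<xi> * hart k x0
      + cos (t * phase k \<xi>) * phase k \<xi> * hart (- k) x0)"
    let ?c = "\<Sum>k\<in>freq d. ?a k * (- (phase k \<xi> * phase k \<xi> * hart k x0))"
    have g: "?p (x0 + t *\<^sub>R \<xi>) = ?g t" for t
      by (simp add: trig_sum_def hart_add_right phase_scaleR_right)
    have "?c \<le> 0"
    proof (rule second_derivative_at_max)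
      show "(?g has_real_derivative ?g' t) (at t)" for t
        by (intro DERIV_sum DERIV_cmult DERIV_add) (auto intro!: derivative_eq_intros)
      have "(?g' has_real_derivative (\<Sum>k\<in>freq d. ?a k *
          (- (cos (0 * phase k \<xi>) * phase k \<xi>) * phase k \<xi> * hart k x0
            + (- sin (0 * phase k \<xi>) * phase k \<xi>) * phase k \<xi> * hart (- k) x0))) (at 0)"
        by (intro DERIV_sum DERIV_cmult DERIV_add) (auto intro!: derivative_eq_intros)
      then show "(?g' has_real_derivative ?c) (at 0)" by simp
      show "?g t \<le> ?g 0" for t
        using max[of "x0 + t *\<^sub>R \<xi>"] g[of t] g[of 0] by simp
    qed
    also have "?c = (\<Sum>i\<in>UNIV. \<Sum>j\<in>UNIV. \<xi> $ i * \<xi> $ j * trig_hess d f x0 $ i $ j)"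
    proof -
      have k: "?a k * (- (phase k \<xi> * phase k \<xi> * hart k x0))
          = (\<Sum>i\<in>UNIV. \<Sum>j\<in>UNIV. \<xi> $ i * \<xi> $ j * (riesz_symbol k $ i $ j * coef f k * hart k x0))" for k
      proof -
        have "(int_vec k \<bullet> \<xi>) * (int_vec k \<bullet> \<xi>)
            = (\<Sum>i\<in>UNIV. \<Sum>j\<in>UNIV. (of_int (k $ i) * \<xi> $ i) * (of_int (k $ j) * \<xi> $ j))"
          by (simp add: inner_vec_def sum_product)
        then have "(\<Sum>i\<in>UNIV. \<Sum>j\<in>UNIV. \<xi> $ i * \<xi> $ j * (riesz_symbol k $ i $ j * coef f k * hart k x0))
            = (int_vec k \<bullet> \<xi>) * (int_vec k \<bullet> \<xi>) * (coef f k * hart k x0 / (norm (int_vec k))\<^sup>2)"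
          unfolding riesz_symbol_nth by (simp add: sum_distrib_right sum_distrib_left mult_ac)
        then show ?thesis by (cases "k = 0") (simp_all add: phase_def power2_eq_square)
      qed
      have "?c = (\<Sum>k\<in>freq d. \<Sum>i\<in>UNIV. \<Sum>j\<in>UNIV. \<xi> $ i * \<xi> $ j * (riesz_symbol k $ i $ j * coef f k * hart k x0))"
        by (simp only: k)
      also have "\<dots> = (\<Sum>i\<in>UNIV. \<Sum>j\<in>UNIV. \<Sum>k\<in>freq d. \<xi> $ i * \<xi> $ j * (riesz_symbol k $ i $ j * coef f k * hart k x0))"
        by (rule sum_swap_outer[symmetric])
      also have "\<dots> = (\<Sum>i\<in>UNIV. \<Sum>j\<in>UNIV. \<xi> $ i * \<xi> $ j * trig_hess d f x0 $ i $ j)"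
        by (simp add: trig_hess_nth trig_sum_def sum_distrib_left)
      finally show ?thesis .
    qed
    finally show "(\<Sum>i\<in>UNIV. \<Sum>j\<in>UNIV. \<xi> $ i * \<xi> $ j * trig_hess d f x0 $ i $ j) \<le> 0" .
  qed
qed

text \<open>With K = - D^2 phi positive semidefinite, (I - Q) : K \<le> |K| \<le> tr K = I : K,
  hence Q : K \<ge> 0. Nearness to the identity takes the place of ellipticity.\<close>

lemma trig_maximum_principle:
  fixes Q :: "real^'n \<Rightarrow> real^'n^'n"
  assumes Q: "\<And>x. norm (mat 1 - Q x) \<le> 1"
  obtains x0 where "Q x0 \<bullet> trig_hess d f x0 \<le> 0"
proof -
  obtain x0 where x0: "\<And>\<xi>. (\<Sum>i\<in>UNIV. \<Sum>j\<in>UNIV. \<xi> $ i * \<xi> $ j * trig_hess d f x0 $ i $ j) \<le> 0"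
    by (rule trig_hess_nonpos_at_max[of d f]) blast
  let ?K = "- trig_hess d f x0"
  have le: "norm ?K \<le> mat 1 \<bullet> ?K"
  proof (rule psd_norm_le_trace)
    show "?K $ i $ j = ?K $ j $ i" for i j by (simp add: trig_hess_nth riesz_symbol_nth mult.commute)
    show "0 \<le> (\<Sum>i\<in>UNIV. \<Sum>j\<in>UNIV. \<xi> $ i * \<xi> $ j * ?K $ i $ j)" for \<xi>
      using x0[of \<xi>] by (simp add: sum_negf)
  qed
  have "(mat 1 - Q x0) \<bullet> ?K \<le> norm (mat 1 - Q x0) * norm ?K" by (rule norm_cauchy_schwarz)
  also have "\<dots> \<le> 1 * norm ?K" by (intro mult_right_mono Q) auto
  finally have "0 \<le> Q x0 \<bullet> ?K" using le by (simp add: inner_diff_left)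
  then show thesis using that[of x0] by simp
qed

section \<open>Neumann series for trigonometric coefficients\<close>

lemma norm_on_sub_mean:
  fixes f :: "real^'n \<Rightarrow> real"
  assumes f: "square_integrable cell f"
  shows "norm_on cell (\<lambda>x. f x - coef f 0) \<le> norm_on cell f"
proof -
  have "trig_sum 0 (coef f) = (\<lambda>x. coef f 0)"
  proof -
    have "(freq 0 :: (int^'n) set) = {0}" by (auto simp: freq_def vec_eq_iff)
    then show ?thesis by (simp add: trig_sum_def fun_eq_iff)
  qed
  then show ?thesis
    using trig_sum_best_approx[OF f is_trig_const[of 0 0]] by simp
qed

lemma is_trig_matrix_inner:
  assumes "\<And>i j. is_trig q (\<lambda>x. N x $ i $ j)"
  shows "is_trig (d + q) (\<lambda>x. N x \<bullet> trig_hess d f x)"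
  unfolding matrix_inner trig_hess_nth
  using is_trig_mult[OF assms is_trig_trig_sum] by (intro is_trig_sum) (simp add: add.commute)

text \<open>Write e = I : H = Q : H + (I - Q) : H with H = \<open>trig_hess d e\<close>. The mean of
  the last term is split off as \<kappa>, so that the rest again has mean zero and the step can be
  repeated. Multiplication by I - Q adds q to the degree.\<close>

lemma Neumann_step:
  fixes Q :: "real^'n \<Rightarrow> real^'n^'n"
  assumes Qt: "\<And>i j. is_trig q (\<lambda>x. (mat 1 - Q x) $ i $ j)" and Q: "\<And>x. norm (mat 1 - Q x) \<le> \<theta>"
    and e: "is_trig d e" "coef e 0 = 0"
  obtains \<kappa> e' where "is_trig (d + q) e'" "coef e' 0 = 0" "norm_on cell e' \<le> \<theta> * norm_on cell e"
    "\<And>x. e x = \<kappa> + Q x \<bullet> trig_hess d e x + e' x"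
proof -
  let ?g = "\<lambda>x. (mat 1 - Q x) \<bullet> trig_hess d e x"
  have g: "is_trig (d + q) ?g" by (rule is_trig_matrix_inner[OF Qt])
  have gs: "square_integrable cell ?g" by (rule square_integrable_trig[OF g])
  have th: "0 \<le> \<theta>" using Q[of 0] norm_ge_zero[of "mat 1 - Q 0"] by linarith
  have "norm_on cell ?g \<le> norm_on cell (\<lambda>x. \<theta> * norm (trig_hess d e x))"
  proof (rule norm_on_mono)
    show "square_integrable cell (\<lambda>x. \<theta> * norm (trig_hess d e x))"
      by (intro square_integrable_cmult norm_on_matrix_norm square_integrable_trig_hess)
    show "?g \<in> borel_measurable cell" by (rule square_integrable_measurable[OF gs])
    show "AE x in cell. \<bar>?g x\<bar> \<le> \<bar>\<theta> * norm (trig_hess d e x)\<bar>"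
    proof (rule AE_I2)
      fix x
      have "\<bar>?g x\<bar> \<le> norm (mat 1 - Q x) * norm (trig_hess d e x)" by (rule Cauchy_Schwarz_ineq2)
      also have "\<dots> \<le> \<theta> * norm (trig_hess d e x)" by (intro mult_right_mono Q) auto
      finally show "\<bar>?g x\<bar> \<le> \<bar>\<theta> * norm (trig_hess d e x)\<bar>" by linarith
    qed
  qed
  also have "\<dots> = \<theta> * norm_on cell (\<lambda>x. norm (trig_hess d e x))" using th by (simp add: norm_on_cmult)
  also have "\<dots> \<le> \<theta> * norm_on cell e" by (intro mult_left_mono norm_trig_hess_le e th)
  finally have gn: "norm_on cell ?g \<le> \<theta> * norm_on cell e" .
  show thesis
  proof (rule that[of "\<lambda>x. ?g x - coef ?g 0" "coef ?g 0"])
    show "is_trig (d + q) (\<lambda>x. ?g x - coef ?g 0)" by (intro is_trig_diff g is_trig_const)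
    show "coef (\<lambda>x. ?g x - coef ?g 0) 0 = 0"
      using gs by (subst coef_diff) (auto simp: coef_const L2_per_square_integrable)
    show "norm_on cell (\<lambda>x. ?g x - coef ?g 0) \<le> \<theta> * norm_on cell e"
      using norm_on_sub_mean[OF gs] gn by linarith
    show "e x = coef ?g 0 + Q x \<bullet> trig_hess d e x + (?g x - coef ?g 0)" for x
      using trace_trig_hess[OF e, of x] by (simp add: inner_diff_left)
  qed
qed

text \<open>
  Each step raises the degree only by the fixed amount \<open>q\<close>. The supremum norm of the remainder
  therefore exceeds its \<open>L\<^sup>2\<close> norm, which is \<open>O(\<theta>\<^sup>J)\<close>, at most by a factor polynomial in \<open>J\<close>.
\<close>

lemma Neumann_iterate:
  fixes Q :: "real^'n \<Rightarrow> real^'n^'n"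
  assumes Qt: "\<And>i j. is_trig q (\<lambda>x. (mat 1 - Q x) $ i $ j)" and Q: "\<And>x. norm (mat 1 - Q x) \<le> \<theta>"
    and f: "is_trig d f" "coef f 0 = 0"
  shows "\<exists>F c e. is_trig (d + J * q) F \<and> is_trig (d + J * q) e \<and> coef e 0 = 0
    \<and> norm_on cell e \<le> \<theta> ^ J * norm_on cell f \<and> norm_on cell F \<le> (\<Sum>m<J. \<theta> ^ m) * norm_on cell f
    \<and> (\<forall>x. f x = c + Q x \<bullet> trig_hess (d + J * q) F x + e x)"
proof (induction J)
  case 0
  have "norm_on cell (\<lambda>x::real^'n. 0) = 0" by (simp add: norm_on_def)
  moreover have "coef (\<lambda>x::real^'n. 0) k = 0" for k by (simp add: coef_const)
  ultimately show ?case
    using f by (intro exI[of _ "\<lambda>x. 0"] exI[of _ 0] exI[of _ f]) (auto intro: is_trig_const simp: trig_hess_alt)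
next
  case (Suc J)
  then obtain F c e where F: "is_trig (d + J * q) F" and e: "is_trig (d + J * q) e" "coef e 0 = 0"
    and en: "norm_on cell e \<le> \<theta> ^ J * norm_on cell f"
    and Fn: "norm_on cell F \<le> (\<Sum>m<J. \<theta> ^ m) * norm_on cell f"
    and eq: "\<And>x. f x = c + Q x \<bullet> trig_hess (d + J * q) F x + e x" by blast
  obtain \<kappa> e' where e': "is_trig (d + J * q + q) e'" "coef e' 0 = 0" "norm_on cell e' \<le> \<theta> * norm_on cell e"
    and eq': "\<And>x. e x = \<kappa> + Q x \<bullet> trig_hess (d + J * q) e x + e' x"
    by (rule Neumann_step[OF Qt Q e]) blast
  have th: "0 \<le> \<theta>" using Q[of 0] norm_ge_zero[of "mat 1 - Q 0"] by linarith
  have D: "d + J * q + q = d + Suc J * q" "d + J * q \<le> d + Suc J * q" by simp_all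
  let ?F = "\<lambda>x. F x + e x"
  have Ft: "is_trig (d + J * q) ?F" by (intro is_trig_add F e)
  have s: "square_integrable cell F" "square_integrable cell e"
    using F e by (auto intro: square_integrable_trig)
  show ?case
  proof (intro exI conjI allI)
    show "is_trig (d + Suc J * q) ?F" by (rule is_trig_mono[OF Ft D(2)])
    show "is_trig (d + Suc J * q) e'" using e'(1) unfolding D(1) .
    show "coef e' 0 = 0" by fact
    have "\<theta> * norm_on cell e \<le> \<theta> * (\<theta> ^ J * norm_on cell f)" by (intro mult_left_mono en th)
    then show "norm_on cell e' \<le> \<theta> ^ Suc J * norm_on cell f" using e'(3) by simp
    show "norm_on cell ?F \<le> (\<Sum>m<Suc J. \<theta> ^ m) * norm_on cell f"
      using norm_on_triangle[OF s] en Fn by (simp add: distrib_right)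
    show "f x = (c + \<kappa>) + Q x \<bullet> trig_hess (d + Suc J * q) ?F x + e' x" for x
      unfolding trig_hess_add[OF s] trig_hess_mono[OF F D(2)] trig_hess_mono[OF e(1) D(2)] inner_add_right
      using eq[of x] eq'[of x] by simp
  qed
qed

text \<open>With rho the n-th root of \<theta>, the expression is the n-th power of (a + b J) rho^J,
  which tends to 0.\<close>

lemma polynomial_times_geometric_tendsto_0:
  assumes "0 \<le> \<theta>" "\<theta> < (1::real)" "n > 0"
  shows "(\<lambda>J. (a + b * real J) ^ n * \<theta> ^ J) \<longlonglongrightarrow> 0"
proof -
  define \<rho> where "\<rho> = root n \<theta>"
  have r: "0 \<le> \<rho>" "\<rho> < 1" "\<rho> ^ n = \<theta>" using assms by (auto simp: \<rho>_def)
  have "(\<lambda>J. (a * \<rho> ^ J + b * (real J * \<rho> ^ J)) ^ n) \<longlonglongrightarrow> (a * 0 + b * 0) ^ n"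
    using r by (intro tendsto_intros LIMSEQ_realpow_zero powser_times_n_limit_0) auto
  moreover have "(a * \<rho> ^ J + b * (real J * \<rho> ^ J)) ^ n = (a + b * real J) ^ n * \<theta> ^ J" for J
  proof -
    have "a * \<rho> ^ J + b * (real J * \<rho> ^ J) = (a + b * real J) * \<rho> ^ J" by (simp add: algebra_simps)
    then show ?thesis by (simp add: power_mult_distrib r(3)[symmetric] power_mult[symmetric] mult.commute)
  qed
  ultimately show ?thesis using assms(3) by (simp add: zero_power)
qed

text \<open>The bound on \<open>F\<close> involves only \<open>f\<close> and \<theta>, neither the
  degree q nor \<epsilon>. It therefore stays fixed when Q is sent to B.\<close>

lemma trig_solve:
  fixes Q :: "real^'n \<Rightarrow> real^'n^'n"
  assumes Qt: "\<And>i j. is_trig q (\<lambda>x. (mat 1 - Q x) $ i $ j)" and Q: "\<And>x. norm (mat 1 - Q x) \<le> \<theta>"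
    and th: "\<theta> < 1" and f: "is_trig d f" and eps: "\<epsilon> > 0"
  obtains D F c where "is_trig D F" "norm_on cell F \<le> norm_on cell f / (1 - \<theta>)"
    "\<And>x. \<bar>f x - c - Q x \<bullet> trig_hess D F x\<bar> \<le> \<epsilon>"
proof -
  have th0: "0 \<le> \<theta>" using Q[of 0] norm_ge_zero[of "mat 1 - Q 0"] by linarith
  have fs: "square_integrable cell f" by (rule square_integrable_trig[OF f])
  let ?f = "\<lambda>x. f x - coef f 0"
  have f': "is_trig d ?f" "coef ?f 0 = 0" "norm_on cell ?f \<le> norm_on cell f"
    using fs by (auto intro!: is_trig_diff f is_trig_const norm_on_sub_mean
        simp: coef_diff L2_per_square_integrable coef_const)
  \<comment> \<open>\<open>?B J\<close> bounds the supremum of the remainder after J steps: the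
    factor of \<open>is_trig_sup_le\<close> at degree d + J q, times the L2 bound.\<close>
  let ?B = "\<lambda>J. 2 * (2 * real (d + J * q) + 1) ^ CARD('n) * (\<theta> ^ J * norm_on cell f)"
  have "(\<lambda>J. (2 * norm_on cell f) * (((2 * real d + 1) + (2 * real q) * real J) ^ CARD('n) * \<theta> ^ J))
      \<longlonglongrightarrow> (2 * norm_on cell f) * 0"
    by (intro tendsto_mult tendsto_const polynomial_times_geometric_tendsto_0 th0 th) simp
  then have "?B \<longlonglongrightarrow> 0" by (simp add: algebra_simps)
  then have "eventually (\<lambda>J. ?B J < \<epsilon>) sequentially" using eps by (intro order_tendstoD(2)) auto
  then obtain J where J: "?B J < \<epsilon>" by (auto simp: eventually_sequentially)
  obtain F c e where F: "is_trig (d + J * q) F" and e: "is_trig (d + J * q) e"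
    and en: "norm_on cell e \<le> \<theta> ^ J * norm_on cell ?f"
    and Fn: "norm_on cell F \<le> (\<Sum>m<J. \<theta> ^ m) * norm_on cell ?f"
    and eq: "\<And>x. ?f x = c + Q x \<bullet> trig_hess (d + J * q) F x + e x"
    using Neumann_iterate[OF Qt Q f'(1,2), of J] by blast
  show thesis
  proof (rule that[OF F, of "c + coef f 0"])
    have "(\<Sum>m<J. \<theta> ^ m) \<le> 1 / (1 - \<theta>)"
      using th th0 by (simp add: sum_gp_strict divide_right_mono)
    then have "(\<Sum>m<J. \<theta> ^ m) * norm_on cell ?f \<le> 1 / (1 - \<theta>) * norm_on cell f"
      using f'(3) th by (intro mult_mono) auto
    then show "norm_on cell F \<le> norm_on cell f / (1 - \<theta>)" using Fn by simp
    fix x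
    have "\<bar>e x\<bar> \<le> 2 * (2 * real (d + J * q) + 1) ^ CARD('n) * norm_on cell e" by (rule is_trig_sup_le[OF e])
    also have "\<dots> \<le> ?B J"
      using en mult_left_mono[OF f'(3), of "\<theta> ^ J"] th0 by (intro mult_left_mono) auto
    finally have "\<bar>e x\<bar> \<le> \<epsilon>" using J by linarith
    then show "\<bar>f x - (c + coef f 0) - Q x \<bullet> trig_hess (d + J * q) F x\<bar> \<le> \<epsilon>"
      using eq[of x] by simp
  qed
qed

context near_identity
begin

text \<open>The argument of \<open>adjoint_null_orthogonal\<close>, with a finite sum in place of
  the Parseval limit because the Hessian is trigonometric.\<close>

lemma adjoint_null_trig_hess:
  assumes w: "w \<in> L2_per" and n: "adjoint_null w"
  shows "integrable cell (\<lambda>x. w x * (B x \<bullet> trig_hess d f x))"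
    and "(\<integral>x. w x * (B x \<bullet> trig_hess d f x) \<partial>cell) = 0"
proof -
  have bs: "square_integrable cell (\<lambda>x. B x $ i $ j * w x)" for i j
    by (intro L2_per_square_integrable B_mult_L2_per w)
  have i: "integrable cell (\<lambda>x. trig_hess d f x $ i $ j * (B x $ i $ j * w x))" for i j
    by (intro square_integrable_mult square_integrable_trig_hess bs)
  have e: "(\<lambda>x. w x * (B x \<bullet> trig_hess d f x))
      = (\<lambda>x. \<Sum>i\<in>UNIV. \<Sum>j\<in>UNIV. trig_hess d f x $ i $ j * (B x $ i $ j * w x))"
    by (simp add: matrix_inner sum_distrib_left mult_ac)
  show "integrable cell (\<lambda>x. w x * (B x \<bullet> trig_hess d f x))"
    unfolding e using i by (intro Bochner_Integration.integrable_sum)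
  have "(\<integral>x. w x * (B x \<bullet> trig_hess d f x) \<partial>cell)
      = (\<Sum>i\<in>UNIV. \<Sum>j\<in>UNIV. inner_on cell (\<lambda>x. trig_hess d f x $ i $ j) (\<lambda>x. B x $ i $ j * w x))"
    unfolding e using i by (simp add: Bochner_Integration.integral_sum inner_on_def)
  also have "\<dots> = (\<Sum>i\<in>UNIV. \<Sum>j\<in>UNIV. \<Sum>k\<in>freq d.
      riesz_symbol k $ i $ j * coef f k * coef (\<lambda>x. B x $ i $ j * w x) k)"
    unfolding trig_hess_nth by (simp add: inner_trig_sum[OF bs])
  also have "\<dots> = (\<Sum>k\<in>freq d. \<Sum>i\<in>UNIV. \<Sum>j\<in>UNIV.
      riesz_symbol k $ i $ j * coef f k * coef (\<lambda>x. B x $ i $ j * w x) k)"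
    by (rule sum_swap_outer)
  also have "\<dots> = (\<Sum>k\<in>freq d. coef f k / (norm (int_vec k))\<^sup>2 * 0)"
  proof (intro sum.cong refl)
    fix k :: "int^'n"
    have "(\<Sum>i\<in>UNIV. \<Sum>j\<in>UNIV. riesz_symbol k $ i $ j * coef f k * coef (\<lambda>x. B x $ i $ j * w x) k)
        = coef f k / (norm (int_vec k))\<^sup>2 *
          (\<Sum>i\<in>UNIV. \<Sum>j\<in>UNIV. of_int (k $ i) * of_int (k $ j) * coef (\<lambda>x. B x $ i $ j * w x) k)"
      unfolding riesz_symbol_nth sum_distrib_left by (intro sum.cong refl) simp
    then show "(\<Sum>i\<in>UNIV. \<Sum>j\<in>UNIV. riesz_symbol k $ i $ j * coef f k * coef (\<lambda>x. B x $ i $ j * w x) k)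
        = coef f k / (norm (int_vec k))\<^sup>2 * 0"
      using n by (simp only: adjoint_null_def)
  qed
  finally show "(\<integral>x. w x * (B x \<bullet> trig_hess d f x) \<partial>cell) = 0" by simp
qed

text \<open>Pair the approximate equation f = c + Q : H with \<open>w\<close>, whose mean is 1. The
  constant contributes c \<ge> - \<epsilon>, the residual costs at most \<epsilon> times the norm of
  \<open>w\<close>, and since \<open>w\<close> is orthogonal to B : H, only (Q - B) : H is left of
  the main term.\<close>

lemma adjoint_null_trig_lower:
  fixes Q :: "real^'n \<Rightarrow> real^'n^'n"
  assumes w: "w \<in> L2_per" "adjoint_null w" "coef w 0 = 1"
    and Qt: "\<And>i j. is_trig q (\<lambda>x. (mat 1 - Q x) $ i $ j)" and Q: "\<And>x. norm (mat 1 - Q x) \<le> \<theta>"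
    and f: "is_trig d f" "\<And>x. 0 \<le> f x" and eps: "\<epsilon> > 0"
  shows "- \<epsilon> * (1 + norm_on cell w)
      - norm_on cell (\<lambda>x. norm (Q x - B x) * w x) * (norm_on cell f / (1 - \<theta>)) \<le> inner_on cell w f"
proof -
  obtain D F c where F: "is_trig D F" "norm_on cell F \<le> norm_on cell f / (1 - \<theta>)"
    and eq: "\<And>x. \<bar>f x - c - Q x \<bullet> trig_hess D F x\<bar> \<le> \<epsilon>"
    by (rule trig_solve[OF Qt Q \<theta>(2) f(1) eps]) blast
  let ?H = "trig_hess D F"
  let ?e = "\<lambda>x. f x - c - Q x \<bullet> ?H x"
  have Q1: "norm (mat 1 - Q x) \<le> 1" for x using Q[of x] \<theta> by linarith
  \<comment> \<open>At this point f \<ge> 0 while Q : H \<le> 0, so the approximate equation gives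
    the lower bound for c.\<close>
  obtain x0 where "Q x0 \<bullet> ?H x0 \<le> 0" by (rule trig_maximum_principle[OF Q1])
  then have c: "- \<epsilon> \<le> c" using eq[of x0] f(2)[of x0] by linarith
  have ws: "square_integrable cell w" by (rule L2_per_square_integrable[OF w(1)])
  have fs: "square_integrable cell f" by (rule square_integrable_trig[OF f(1)])
  have Qm: "Q \<in> borel_measurable lebesgue"
  proof -
    have "continuous_on UNIV (\<lambda>x. (mat 1 - Q x) $ i $ j)" for i j by (rule is_trig_continuous[OF Qt])
    then have "continuous_on UNIV (\<lambda>x. mat 1 - (mat 1 - Q x))"
      by (intro continuous_on_diff continuous_on_const continuous_on_vec_lambda[of _ "\<lambda>i x. (mat 1 - Q x) $ i", simplified vec_lambda_eta]
          continuous_on_vec_lambda[of _ "\<lambda>j x. (mat 1 - Q x) $ _ $ j", simplified vec_lambda_eta])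
    then show ?thesis by (simp add: borel_measurable_continuous_lebesgue)
  qed
  have QBm: "(\<lambda>x. norm (Q x - B x)) \<in> borel_measurable cell"
    using Qm B_measurable by (intro measurable_cell) measurable
  have QBs: "square_integrable cell (\<lambda>x. norm (Q x - B x) * w x)"
  proof (rule square_integrable_bounded_mult[OF ws QBm])
    show "AE x in cell. \<bar>norm (Q x - B x)\<bar> \<le> 2 * \<theta>"
      using AE_cell[OF B_near]
    proof eventually_elim
      case (elim x)
      have "norm (Q x - B x) = norm ((mat 1 - B x) - (mat 1 - Q x))" by simp
      also have "\<dots> \<le> norm (mat 1 - B x) + norm (mat 1 - Q x)" by (rule norm_triangle_ineq4)
      finally show ?case using elim Q[of x] by simp
    qed
  qed
  have Hs: "square_integrable cell (\<lambda>x. norm (?H x))"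
    by (intro norm_on_matrix_norm square_integrable_trig_hess)
  have cs: "square_integrable cell (\<lambda>x::real^'n. c)" by (rule L2_per_square_integrable[OF L2_per_const])
  have QH: "is_trig (D + q) (\<lambda>x. (mat 1 - Q x) \<bullet> ?H x)" by (rule is_trig_matrix_inner[OF Qt])
  have "is_trig D (\<lambda>x. mat 1 \<bullet> ?H x)"
    unfolding matrix_inner trig_hess_nth by (intro is_trig_sum is_trig_cmult is_trig_trig_sum)
  then have IH: "is_trig (D + q) (\<lambda>x. mat 1 \<bullet> ?H x)" by (rule is_trig_mono) simp
  have "is_trig (D + q) (\<lambda>x. Q x \<bullet> ?H x)"
    using is_trig_diff[OF IH QH] by (simp add: inner_diff_left)
  then have QHs: "square_integrable cell (\<lambda>x. Q x \<bullet> ?H x)" by (rule square_integrable_trig)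
  have es: "square_integrable cell ?e" by (intro square_integrable_diff fs cs QHs)
  have "(\<lambda>x. w x * f x) = (\<lambda>x. c * w x + w x * ?e x + (w x * (Q x \<bullet> ?H x) - w x * (B x \<bullet> ?H x)) + w x * (B x \<bullet> ?H x))"
    by (simp add: algebra_simps)
  then have "inner_on cell w f
      = (\<integral>x. c * w x + w x * ?e x + (w x * (Q x \<bullet> ?H x) - w x * (B x \<bullet> ?H x)) + w x * (B x \<bullet> ?H x) \<partial>cell)"
    unfolding inner_on_def by (rule arg_cong)
  also have "\<dots> = c * (\<integral>x. w x \<partial>cell) + inner_on cell w ?e
      + (\<integral>x. w x * (Q x \<bullet> ?H x) - w x * (B x \<bullet> ?H x) \<partial>cell) + 0"
    using adjoint_null_trig_hess[OF w(1,2), of D F] square_integrable_mult[OF ws es]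
      square_integrable_mult[OF ws QHs] cell.square_integrable_integrable[OF ws]
    by (simp add: inner_on_def)
  finally have main: "inner_on cell w f = c + inner_on cell w ?e
      + (\<integral>x. w x * (Q x \<bullet> ?H x) - w x * (B x \<bullet> ?H x) \<partial>cell)"
    using w(3) by (simp add: coef_0)
  have "\<bar>inner_on cell w ?e\<bar> \<le> norm_on cell w * norm_on cell ?e" by (rule Cauchy_Schwarz_on[OF ws es])
  moreover have "norm_on cell ?e \<le> norm_on cell (\<lambda>x::real^'n. \<epsilon>)"
  proof (rule norm_on_mono)
    show "AE x in cell. \<bar>?e x\<bar> \<le> \<bar>\<epsilon>\<bar>" using eq eps by (intro AE_I2) simp
  qed (rule L2_per_square_integrable[OF L2_per_const], rule square_integrable_measurable[OF es])
  then have "norm_on cell w * norm_on cell ?e \<le> norm_on cell w * \<epsilon>"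
    using eps by (intro mult_left_mono) (auto simp: norm_on_const)
  ultimately have t1: "\<bar>inner_on cell w ?e\<bar> \<le> norm_on cell w * \<epsilon>" by linarith
  have "\<bar>\<integral>x. w x * (Q x \<bullet> ?H x) - w x * (B x \<bullet> ?H x) \<partial>cell\<bar>
      \<le> (\<integral>x. \<bar>norm (Q x - B x) * w x\<bar> * norm (?H x) \<partial>cell)"
    unfolding real_norm_def[symmetric]
  proof (rule norm_integral_le)
    show "integrable cell (\<lambda>x. w x * (Q x \<bullet> ?H x) - w x * (B x \<bullet> ?H x))"
      by (intro Bochner_Integration.integrable_diff square_integrable_mult[OF ws QHs]
          adjoint_null_trig_hess w)
    show "integrable cell (\<lambda>x. norm (norm (Q x - B x) * w x) * norm (?H x))"
      using QBs by (intro square_integrable_mult Hs) (auto simp: square_integrable_def)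
    fix x
    have "w x * (Q x \<bullet> ?H x) - w x * (B x \<bullet> ?H x) = w x * ((Q x - B x) \<bullet> ?H x)"
      by (simp add: inner_diff_left algebra_simps)
    also have "norm \<dots> \<le> \<bar>w x\<bar> * (norm (Q x - B x) * norm (?H x))"
      unfolding real_norm_def abs_mult by (intro mult_left_mono Cauchy_Schwarz_ineq2) auto
    finally show "norm (w x * (Q x \<bullet> ?H x) - w x * (B x \<bullet> ?H x)) \<le> norm (norm (Q x - B x) * w x) * norm (?H x)"
      by (simp add: abs_mult mult_ac)
  qed
  also have "\<dots> = inner_on cell (\<lambda>x. \<bar>norm (Q x - B x) * w x\<bar>) (\<lambda>x. norm (?H x))" by (simp add: inner_on_def)
  also have "\<dots> \<le> norm_on cell (\<lambda>x. \<bar>norm (Q x - B x) * w x\<bar>) * norm_on cell (\<lambda>x. norm (?H x))"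
  proof -
    have "square_integrable cell (\<lambda>x. \<bar>norm (Q x - B x) * w x\<bar>)"
      using QBs by (auto simp: square_integrable_def)
    from Cauchy_Schwarz_on[OF this Hs] show ?thesis by linarith
  qed
  also have "norm_on cell (\<lambda>x. \<bar>norm (Q x - B x) * w x\<bar>) = norm_on cell (\<lambda>x. norm (Q x - B x) * w x)"
    by (simp add: norm_on_def)
  also have "norm_on cell (\<lambda>x. norm (Q x - B x) * w x) * norm_on cell (\<lambda>x. norm (?H x))
      \<le> norm_on cell (\<lambda>x. norm (Q x - B x) * w x) * (norm_on cell f / (1 - \<theta>))"
    using norm_trig_hess_le[OF F(1)] F(2) by (intro mult_left_mono) auto
  finally have t2: "\<bar>\<integral>x. w x * (Q x \<bullet> ?H x) - w x * (B x \<bullet> ?H x) \<partial>cell\<bar>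
      \<le> norm_on cell (\<lambda>x. norm (Q x - B x) * w x) * (norm_on cell f / (1 - \<theta>))" .
  have "- \<epsilon> * (1 + norm_on cell w) = - \<epsilon> - norm_on cell w * \<epsilon>" by (simp add: algebra_simps)
  then show ?thesis using main c t1 t2 by linarith
qed

text \<open>First Q tends to B at fixed \<epsilon>, then \<epsilon> tends to 0. Almost everywhere
  convergence of Q suffices, since |Q - B| |w| is dominated by 2 \<theta> |w|, which is in
  L2.\<close>

lemma adjoint_null_inner_trig_nonneg:
  assumes w: "w \<in> L2_per" "adjoint_null w" "coef w 0 = 1"
    and f: "is_trig d f" "\<And>x. 0 \<le> f x"
  shows "0 \<le> inner_on cell w f"
proof -
  obtain N :: "nat \<Rightarrow> real^'n \<Rightarrow> real^'n^'n" where Nt: "\<And>m b. \<exists>d. is_trig d (\<lambda>x. N m x \<bullet> b)"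
    and N: "\<And>m x. norm (N m x) \<le> \<theta>" and Nlim: "AE x in cell. (\<lambda>m. N m x) \<longlonglongrightarrow> defect x"
  proof (rule trig_approx[OF defect_measurable defect_bounded \<theta>(1)])
  qed (rule that)
  have Nt': "\<exists>q. \<forall>i j. is_trig q (\<lambda>x. N m x $ i $ j)" for m
  proof -
    have "\<exists>d. is_trig d (\<lambda>x. N m x $ i $ j)" for i j
      using Nt[of m "axis i (axis j 1)"] by (simp add: inner_axis)
    then obtain d where d: "\<And>i j. is_trig (d i j) (\<lambda>x. N m x $ i $ j)" by metis
    have "is_trig (\<Sum>i\<in>UNIV. \<Sum>j\<in>UNIV. d i j) (\<lambda>x. N m x $ i $ j)" for i j
    proof (rule is_trig_mono[OF d])
      have "d i j \<le> (\<Sum>j\<in>UNIV. d i j)" by (rule member_le_sum) auto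
      also have "\<dots> \<le> (\<Sum>i\<in>UNIV. \<Sum>j\<in>UNIV. d i j)" by (rule member_le_sum) auto
      finally show "d i j \<le> (\<Sum>i\<in>UNIV. \<Sum>j\<in>UNIV. d i j)" .
    qed
    then show ?thesis by blast
  qed
  have Nc: "N m \<in> borel_measurable cell" for m
    using Nt by (intro measurable_cell borel_measurable_continuous_lebesgue continuous_trig_vector)
  have ws: "square_integrable cell w" by (rule L2_per_square_integrable[OF w(1)])
  let ?\<eta> = "\<lambda>m. norm_on cell (\<lambda>x. norm (defect x - N m x) * w x)"
  let ?C = "norm_on cell f / (1 - \<theta>)"
  have "(\<lambda>m. norm_on cell (\<lambda>x. norm (defect x - N m x) * w x - 0)) \<longlonglongrightarrow> 0"
  proof (rule norm_on_dominated_convergence[where w="\<lambda>x. 2 * \<theta> * w x" and f="\<lambda>x. 0"])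
    show "square_integrable cell (\<lambda>x. 2 * \<theta> * w x)" using ws by (rule square_integrable_cmult)
    show "(\<lambda>x. norm (defect x - N m x) * w x) \<in> borel_measurable cell" for m
      using Nc[of m] measurable_cell[OF defect_measurable] square_integrable_measurable[OF ws] by measurable
    show "AE x in cell. (\<lambda>m. norm (defect x - N m x) * w x) \<longlonglongrightarrow> 0"
      using Nlim
    proof eventually_elim
      case (elim x)
      have "(\<lambda>m. norm (defect x - N m x) * w x) \<longlonglongrightarrow> norm (defect x - defect x) * w x"
        by (intro tendsto_intros elim)
      then show ?case by simp
    qed
    show "AE x in cell. \<bar>norm (defect x - N m x) * w x - 0\<bar> \<le> \<bar>2 * \<theta> * w x\<bar>" for m
      using AE_cell[OF defect_bounded]
    proof eventually_elim
      case (elim x)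
      have "norm (defect x - N m x) \<le> 2 * \<theta>"
        using norm_triangle_ineq4[of "defect x" "N m x"] elim N[of m x] by linarith
      then have "norm (defect x - N m x) * \<bar>w x\<bar> \<le> 2 * \<theta> * \<bar>w x\<bar>" by (intro mult_right_mono) auto
      then show ?case using \<theta> by (simp add: abs_mult)
    qed
  qed simp
  then have eta: "?\<eta> \<longlonglongrightarrow> 0" by simp
  have low: "- \<epsilon> * (1 + norm_on cell w) - ?\<eta> m * ?C \<le> inner_on cell w f" if "\<epsilon> > 0" for m \<epsilon>
  proof -
    obtain q where q: "\<And>i j. is_trig q (\<lambda>x. N m x $ i $ j)" using Nt' by blast
    have d: "(mat 1 - N m x) - B x = defect x - N m x" for x by (simp add: defect_def)
    have "- \<epsilon> * (1 + norm_on cell w) - norm_on cell (\<lambda>x. norm ((mat 1 - N m x) - B x) * w x) * ?C \<le> inner_on cell w f"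
      by (rule adjoint_null_trig_lower[OF w, of q "\<lambda>x. mat 1 - N m x", OF _ _ f that]) (use q N in simp_all)
    then show ?thesis unfolding d .
  qed
  have low2: "- \<epsilon> * (1 + norm_on cell w) \<le> inner_on cell w f" if "\<epsilon> > 0" for \<epsilon>
  proof (rule LIMSEQ_le_const2)
    show "(\<lambda>m. - \<epsilon> * (1 + norm_on cell w) - ?\<eta> m * ?C) \<longlonglongrightarrow> - \<epsilon> * (1 + norm_on cell w)"
      using tendsto_diff[OF tendsto_const tendsto_mult[OF eta tendsto_const[of ?C]], of "- \<epsilon> * (1 + norm_on cell w)"]
      by simp
    show "\<exists>N. \<forall>m\<ge>N. - \<epsilon> * (1 + norm_on cell w) - ?\<eta> m * ?C \<le> inner_on cell w f"
      using low[OF that] by blast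
  qed
  show ?thesis
  proof (rule field_le_epsilon)
    fix e :: real assume "e > 0"
    moreover have N: "1 + norm_on cell w > 0" by (simp add: add_pos_nonneg)
    ultimately have "- (e / (1 + norm_on cell w)) * (1 + norm_on cell w) \<le> inner_on cell w f"
      by (intro low2) simp
    moreover have "- (e / (1 + norm_on cell w)) * (1 + norm_on cell w) = - e" using N by simp
    ultimately show "0 \<le> inner_on cell w f + e" by linarith
  qed
qed

text \<open>Test \<open>w\<close> with nonnegative trigonometric polynomials tending to the
  indicator of the set where \<open>w\<close> is negative.\<close>

lemma adjoint_null_nonneg:
  assumes w: "w \<in> L2_per" "adjoint_null w" "coef w 0 = 1"
  shows "AE x in lebesgue. 0 \<le> w x"
proof -
  have ws: "square_integrable cell w" by (rule L2_per_square_integrable[OF w(1)])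
  have wm: "w \<in> borel_measurable lebesgue" and wp: "ae_periodic w" using w(1) by (auto simp: L2_per_iff)
  \<comment> \<open>The indicator lowered by 1/2: approximants bounded by 1/2 in absolute value take
    values in [0,1] once 1/2 is added back.\<close>
  define s where "s x = (if w x < 0 then 1 / 2 else - 1 / 2 :: real)" for x
  have sm: "s \<in> borel_measurable lebesgue" unfolding s_def[abs_def] using wm by measurable
  obtain p :: "nat \<Rightarrow> real^'n \<Rightarrow> real" where pt: "\<And>m b. \<exists>d. is_trig d (\<lambda>x. p m x \<bullet> b)"
    and pb: "\<And>m x. norm (p m x) \<le> 1 / 2" and pl: "AE x in cell. (\<lambda>m. p m x) \<longlonglongrightarrow> s x"
    by (rule trig_approx[OF sm, of "1 / 2"]) (auto simp: s_def)
  have "0 \<le> inner_on cell w (\<lambda>x. p m x + 1 / 2)" for m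
  proof -
    obtain d where "is_trig d (p m)" using pt[of m 1] by auto
    moreover have "0 \<le> p m x + 1 / 2" for x
      using pb[of m x] unfolding real_norm_def by linarith
    ultimately show ?thesis
      by (intro adjoint_null_inner_trig_nonneg[OF w, of d] is_trig_add is_trig_const)
  qed
  moreover have "(\<lambda>m. inner_on cell w (\<lambda>x. p m x + 1 / 2)) \<longlonglongrightarrow> inner_on cell w (\<lambda>x. s x + 1 / 2)"
    unfolding inner_on_def
  proof (rule integral_dominated_convergence[where w="\<lambda>x. \<bar>w x\<bar>"])
    have "p m \<in> borel_measurable cell" for m
      using pt by (intro measurable_cell borel_measurable_continuous_lebesgue continuous_trig_vector)
    then show "(\<lambda>x. w x * (p m x + 1 / 2)) \<in> borel_measurable cell" for m
      using measurable_cell[OF wm] by measurable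
    show "(\<lambda>x. w x * (s x + 1 / 2)) \<in> borel_measurable cell"
      using measurable_cell[OF wm] measurable_cell[OF sm] by measurable
    show "integrable cell (\<lambda>x. \<bar>w x\<bar>)"
      using cell.square_integrable_integrable[OF ws] by (rule integrable_abs)
    show "AE x in cell. (\<lambda>m. w x * (p m x + 1 / 2)) \<longlonglongrightarrow> w x * (s x + 1 / 2)"
      using pl by eventually_elim (intro tendsto_intros)
    show "AE x in cell. norm (w x * (p m x + 1 / 2)) \<le> \<bar>w x\<bar>" for m
    proof (rule AE_I2)
      fix x
      have "\<bar>p m x + 1 / 2\<bar> \<le> 1" using pb[of m x] unfolding real_norm_def by linarith
      then have "\<bar>w x\<bar> * \<bar>p m x + 1 / 2\<bar> \<le> \<bar>w x\<bar> * 1" by (intro mult_left_mono) auto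
      then show "norm (w x * (p m x + 1 / 2)) \<le> \<bar>w x\<bar>" by (simp add: abs_mult)
    qed
  qed
  ultimately have "0 \<le> inner_on cell w (\<lambda>x. s x + 1 / 2)" by (intro LIMSEQ_le_const) auto
  moreover have "(\<lambda>x. w x * (s x + 1 / 2)) = (\<lambda>x. - max 0 (- w x))"
    by (auto simp: s_def fun_eq_iff max_def)
  ultimately have le: "(\<integral>x. max 0 (- w x) \<partial>cell) \<le> 0" by (simp add: inner_on_def)
  have i: "integrable cell (\<lambda>x. max 0 (- w x))"
    using cell.square_integrable_integrable[OF ws] by (intro integrable_max) auto
  have "0 \<le> (\<integral>x. max 0 (- w x) \<partial>cell)" by (rule Bochner_Integration.integral_nonneg) simp
  then have "(\<integral>x. max 0 (- w x) \<partial>cell) = 0" using le by linarith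
  then have "AE x in cell. max 0 (- w x) = 0"
    using i by (subst (asm) integral_nonneg_eq_0_iff_AE) auto
  then have "AE x in cell. 0 \<le> w x" by eventually_elim (simp add: max_def split: if_splits)
  then show ?thesis
  proof (rule AE_of_cell)
    fix k :: "real^'n" assume "\<forall>i. k $ i \<in> \<int>"
    then have "AE x in lebesgue. w (x + k) = w x" using wp by (simp add: ae_periodic_def)
    then show "AE x in lebesgue. (0 \<le> w (x + k)) = (0 \<le> w x)" by eventually_elim simp
  qed
qed

end

section \<open>The Cordes condition\<close>


text \<open>Lebesgue measure is not zero, so consequences that do not depend on x, such as l \<le>
  L, hold outright.\<close>

lemma AE_lebesgue_const:
  assumes "AE x in (lebesgue :: (real^'n) measure). P" shows P
proof -
  have "ae_filter (lebesgue :: (real^'n) measure) \<noteq> bot" by (simp add: ae_filter_eq_bot_iff)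
  then show ?thesis using assms by simp
qed

text \<open>The form is nonnegative at v - M v / L. Expanding it and using the upper bound at v and
  at M v gives |M v|^2 / L \<le> L |v|^2.\<close>

lemma symmetric_form_norm_le:
  fixes M :: "real^'n^'n"
  assumes sym: "transpose M = M" and L: "L > 0"
    and b: "\<And>\<xi>. 0 \<le> (M *v \<xi>) \<bullet> \<xi> \<and> (M *v \<xi>) \<bullet> \<xi> \<le> L * (norm \<xi>)\<^sup>2"
  shows "norm (M *v v) \<le> L * norm v"
proof (rule power2_le_imp_le)
  let ?u = "M *v v"
  have s: "(M *v x) \<bullet> y = x \<bullet> (M *v y)" for x y
    using sym by (metis dot_lmul_matrix inner_commute transpose_matrix_vector)
  let ?x = "v - (1 / L) *\<^sub>R ?u"
  have "0 \<le> (M *v ?x) \<bullet> ?x" using b by blast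
  also have "\<dots> = ?u \<bullet> v - 2 / L * (?u \<bullet> ?u) + (1 / L)\<^sup>2 * ((M *v ?u) \<bullet> ?u)"
    using s[of ?u v]
    by (simp add: matrix_vector_mult_diff_distrib matrix_vector_mult_scaleR inner_diff_left
        inner_diff_right power2_eq_square inner_commute[of v] algebra_simps)
  also have "\<dots> \<le> L * (norm v)\<^sup>2 - 2 / L * (norm ?u)\<^sup>2 + (1 / L)\<^sup>2 * (L * (norm ?u)\<^sup>2)"
    using b[of v] b[of ?u] by (simp add: power2_norm_eq_inner mult_left_mono add_mono)
  also have "\<dots> = L * (norm v)\<^sup>2 - (norm ?u)\<^sup>2 / L"
    using L by (simp add: power2_eq_square field_simps)
  finally have "(norm ?u)\<^sup>2 / L \<le> L * (norm v)\<^sup>2" by simp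
  then show "(norm ?u)\<^sup>2 \<le> (L * norm v)\<^sup>2"
    using L by (simp add: power_mult_distrib field_simps power2_eq_square)
qed (use L in simp)

lemma matrix_diag_form: "(M *v axis i 1) \<bullet> axis i 1 = M $ i $ i" for M :: "real^'n^'n"
  by (simp add: matrix_vector_mult_basis inner_axis column_def)

lemma trace_inner: "trace M = mat 1 \<bullet> M" for M :: "real^'n^'n"
  by (simp add: matrix_inner mat_def trace_def if_distrib[where f="\<lambda>x. x * _"] cong: if_cong)

lemma norm_mat_1: "norm (mat 1 :: real^'n^'n) = sqrt (real CARD('n))"
proof -
  have "(mat 1 :: real^'n^'n) \<bullet> mat 1 = real CARD('n)"
    unfolding trace_inner[symmetric] by (simp add: trace_def mat_def)
  then show ?thesis by (simp add: norm_eq_sqrt_inner)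
qed

text \<open>The pointwise condition behind \<open>elliptic\<close>; admitting the zero vector, where
  it is trivial, saves a side condition.\<close>

definition elliptic_at :: "real \<Rightarrow> real \<Rightarrow> real^'n^'n \<Rightarrow> bool" where
  "elliptic_at l L M \<longleftrightarrow> transpose M = M \<and>
     (\<forall>\<xi>. l * (norm \<xi>)\<^sup>2 \<le> (M *v \<xi>) \<bullet> \<xi> \<and> (M *v \<xi>) \<bullet> \<xi> \<le> L * (norm \<xi>)\<^sup>2)"

lemma elliptic_iff:
  "A \<in> elliptic l L \<longleftrightarrow> A \<in> Linf_per \<and> (AE x in lebesgue. elliptic_at l L (A x))"
proof -
  have "elliptic_at l L M \<longleftrightarrow> transpose M = M \<and> (\<forall>\<xi>. \<xi> \<noteq> 0 \<longrightarrow>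
      l * (norm \<xi>)\<^sup>2 \<le> (M *v \<xi>) \<bullet> \<xi> \<and> (M *v \<xi>) \<bullet> \<xi> \<le> L * (norm \<xi>)\<^sup>2)" for M :: "real^'a^'a"
    unfolding elliptic_at_def by (metis inner_zero_right mult_zero_right norm_zero order_refl zero_power2)
  then show ?thesis by (simp add: elliptic_def)
qed

context
  fixes l L :: real and M :: "real^'n^'n"
  assumes l: "l > 0" and L: "L > 0" and M: "elliptic_at l L M"
begin

lemma elliptic_at_diag: "l \<le> M $ i $ i" "M $ i $ i \<le> L"
  using M matrix_diag_form[of M i] unfolding elliptic_at_def
  by (metis norm_axis_1 mult.right_neutral one_power2)+

lemma elliptic_at_le: "l \<le> L"
  using elliptic_at_diag[of undefined] by linarith

lemma elliptic_at_trace: "real CARD('n) * l \<le> trace M" "trace M \<le> real CARD('n) * L"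
  unfolding trace_def using sum_mono[of UNIV "\<lambda>i::'n. l" "\<lambda>i. M $ i $ i"]
    sum_mono[of UNIV "\<lambda>i. M $ i $ i" "\<lambda>i::'n. L"] elliptic_at_diag by auto

lemma elliptic_at_norm_lower: "real CARD('n) * l\<^sup>2 \<le> (norm M)\<^sup>2"
proof -
  have "real CARD('n) * l\<^sup>2 = (\<Sum>i\<in>(UNIV :: 'n set). l\<^sup>2)" by simp
  also have "\<dots> \<le> (\<Sum>i\<in>UNIV. (M $ i $ i)\<^sup>2)"
    using l elliptic_at_diag by (intro sum_mono power_mono) auto
  also have "\<dots> \<le> (\<Sum>i\<in>UNIV. \<Sum>j\<in>UNIV. (M $ i $ j)\<^sup>2)"
    by (intro sum_mono member_le_sum[of _ _ "\<lambda>j. (M $ _ $ j)\<^sup>2"]) auto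
  finally show ?thesis by (simp add: matrix_norm_sq)
qed

text \<open>By symmetry each row is M applied to a basis vector, so its norm is at most L.\<close>

lemma elliptic_at_norm_upper: "(norm M)\<^sup>2 \<le> real CARD('n) * L\<^sup>2"
proof -
  have sym: "transpose M = M" using M by (simp add: elliptic_at_def)
  have b: "0 \<le> (M *v \<xi>) \<bullet> \<xi> \<and> (M *v \<xi>) \<bullet> \<xi> \<le> L * (norm \<xi>)\<^sup>2" for \<xi>
    using M l unfolding elliptic_at_def by (meson less_imp_le mult_nonneg_nonneg order_trans zero_le_power2)
  have row: "(\<Sum>j\<in>UNIV. (M $ i $ j)\<^sup>2) \<le> L\<^sup>2" for i
  proof -
    have "M *v axis i 1 = M $ i"
      using sym by (simp add: matrix_vector_mult_basis column_def transpose_def vec_eq_iff)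
    then have "norm (M $ i) \<le> L * norm (axis i 1 :: real^'n)"
      using symmetric_form_norm_le[OF sym L b, of "axis i 1"] by simp
    then have "(norm (M $ i))\<^sup>2 \<le> L\<^sup>2" by (intro power_mono) (auto simp: norm_axis_1)
    moreover have "(norm (M $ i))\<^sup>2 = (\<Sum>j\<in>UNIV. (M $ i $ j)\<^sup>2)"
      by (subst power2_norm_eq_inner) (simp add: inner_vec_def power2_eq_square)
    ultimately show ?thesis by simp
  qed
  have "(norm M)\<^sup>2 \<le> (\<Sum>i\<in>(UNIV :: 'n set). L\<^sup>2)" unfolding matrix_norm_sq by (intro sum_mono row)
  then show ?thesis by simp
qed

lemma elliptic_at_pos: "0 < trace M" "0 < (norm M)\<^sup>2"
proof -
  have "0 < real CARD('n) * l" "0 < real CARD('n) * l\<^sup>2" using l by auto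
  then show "0 < trace M" "0 < (norm M)\<^sup>2"
    using elliptic_at_trace(1) elliptic_at_norm_lower by linarith+
qed

text \<open>The bounds for the trace and for the squared norm both carry the factor n, which
  cancels.\<close>

lemma elliptic_at_gamma: "l / L\<^sup>2 \<le> trace M / (norm M)\<^sup>2" "trace M / (norm M)\<^sup>2 \<le> L / l\<^sup>2"
proof -
  have "l / L\<^sup>2 = real CARD('n) * l / (real CARD('n) * L\<^sup>2)" by simp
  also have "\<dots> \<le> trace M / (norm M)\<^sup>2"
    using elliptic_at_trace elliptic_at_norm_upper elliptic_at_pos l by (intro frac_le) auto
  finally show "l / L\<^sup>2 \<le> trace M / (norm M)\<^sup>2" .
  have "trace M / (norm M)\<^sup>2 \<le> real CARD('n) * L / (real CARD('n) * l\<^sup>2)"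
    using elliptic_at_trace elliptic_at_norm_lower elliptic_at_pos l L by (intro frac_le) auto
  also have "\<dots> = L / l\<^sup>2" by simp
  finally show "trace M / (norm M)\<^sup>2 \<le> L / l\<^sup>2" .
qed

text \<open>The norm equals tr M / |M|, and tr M = I : M with |I| = sqrt n. This is where sqrt n in
  the final bounds comes from.\<close>

lemma elliptic_at_normalized_norm: "norm ((trace M / (norm M)\<^sup>2) *\<^sub>R M) \<le> sqrt (real CARD('n))"
proof -
  have "trace M \<le> norm (mat 1 :: real^'n^'n) * norm M" unfolding trace_inner by (rule norm_cauchy_schwarz)
  then have "trace M / norm M \<le> sqrt (real CARD('n))"
    using elliptic_at_pos by (simp add: norm_mat_1 field_simps)
  moreover have "norm ((trace M / (norm M)\<^sup>2) *\<^sub>R M) = trace M / norm M"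
    using elliptic_at_pos by (simp add: power2_eq_square)
  ultimately show ?thesis by simp
qed

text \<open>Expanding the square at the minimizing scalar leaves n - (tr M)^2 / |M|^2, and the
  Cordes condition says that this quotient is at least n - 1 + \<delta>.\<close>

lemma cordes_at:
  assumes c: "(norm M)\<^sup>2 / (trace M)\<^sup>2 \<le> 1 / (real CARD('n) - 1 + \<delta>)" and d: "0 < \<delta>"
  shows "norm (mat 1 - (trace M / (norm M)\<^sup>2) *\<^sub>R M) \<le> sqrt (1 - \<delta>)"
proof -
  let ?g = "trace M / (norm M)\<^sup>2"
  have n: "1 \<le> real CARD('n)" using zero_less_card_finite[where 'a='n] by linarith
  have p: "0 < real CARD('n) - 1 + \<delta>" using n d by linarith
  have II: "(mat 1 :: real^'n^'n) \<bullet> mat 1 = real CARD('n)"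
    unfolding power2_norm_eq_inner[symmetric] norm_mat_1 by simp
  have q: "(norm (mat 1 - g *\<^sub>R M))\<^sup>2 = real CARD('n) - 2 * g * (mat 1 \<bullet> M) + g\<^sup>2 * (norm M)\<^sup>2" for g
    unfolding power2_norm_eq_inner
    by (simp add: inner_diff_left inner_diff_right inner_commute[of M "mat 1"] II power2_eq_square algebra_simps)
  have "(norm (mat 1 - ?g *\<^sub>R M))\<^sup>2 = real CARD('n) - 2 * ?g * trace M + ?g\<^sup>2 * (norm M)\<^sup>2"
    unfolding trace_inner by (rule q)
  also have "\<dots> = real CARD('n) - (trace M)\<^sup>2 / (norm M)\<^sup>2"
    using elliptic_at_pos by (simp add: power2_eq_square field_simps)
  also have "\<dots> \<le> real CARD('n) - (real CARD('n) - 1 + \<delta>)"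
  proof -
    have "(norm M)\<^sup>2 * (real CARD('n) - 1 + \<delta>) \<le> (trace M)\<^sup>2"
      using c p elliptic_at_pos(1) by (simp add: field_simps)
    then have "real CARD('n) - 1 + \<delta> \<le> (trace M)\<^sup>2 / (norm M)\<^sup>2"
      using elliptic_at_pos(2) by (simp add: pos_le_divide_eq mult.commute)
    then show ?thesis by simp
  qed
  finally have "(norm (mat 1 - ?g *\<^sub>R M))\<^sup>2 \<le> 1 - \<delta>" by simp
  then show ?thesis by (rule real_le_rsqrt)
qed

lemma elliptic_at_normalized: "elliptic_at (l\<^sup>2 / L\<^sup>2) (L\<^sup>2 / l\<^sup>2) ((trace M / (norm M)\<^sup>2) *\<^sub>R M)"
  unfolding elliptic_at_def
proof (intro conjI allI)
  let ?g = "trace M / (norm M)\<^sup>2"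
  have "transpose M = M" using M by (simp add: elliptic_at_def)
  then show "transpose (?g *\<^sub>R M) = ?g *\<^sub>R M" by (simp add: transpose_def vec_eq_iff)
  fix \<xi>
  have e: "((?g *\<^sub>R M) *v \<xi>) \<bullet> \<xi> = ?g * ((M *v \<xi>) \<bullet> \<xi>)" by (simp add: scaleR_matrix_vector_assoc[symmetric])
  have b: "l * (norm \<xi>)\<^sup>2 \<le> (M *v \<xi>) \<bullet> \<xi>" "(M *v \<xi>) \<bullet> \<xi> \<le> L * (norm \<xi>)\<^sup>2"
    using M by (auto simp: elliptic_at_def)
  have n: "0 \<le> l * (norm \<xi>)\<^sup>2" using l by simp
  have "l / L\<^sup>2 * (l * (norm \<xi>)\<^sup>2) \<le> ?g * ((M *v \<xi>) \<bullet> \<xi>)"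
    using elliptic_at_gamma b n l by (intro mult_mono) (auto intro: order_trans[of _ "l / L\<^sup>2"])
  then show "l\<^sup>2 / L\<^sup>2 * (norm \<xi>)\<^sup>2 \<le> ((?g *\<^sub>R M) *v \<xi>) \<bullet> \<xi>"
    unfolding e by (simp add: power2_eq_square)
  have "?g * ((M *v \<xi>) \<bullet> \<xi>) \<le> L / l\<^sup>2 * (L * (norm \<xi>)\<^sup>2)"
    using elliptic_at_gamma b n L by (intro mult_mono) auto
  then show "((?g *\<^sub>R M) *v \<xi>) \<bullet> \<xi> \<le> L\<^sup>2 / l\<^sup>2 * (norm \<xi>)\<^sup>2"
    unfolding e by (simp add: power2_eq_square)
qed

end

lemma borel_measurable_trace:
  fixes X :: "'a \<Rightarrow> real^'n^'n"
  assumes "X \<in> borel_measurable M" shows "(\<lambda>x. trace (X x)) \<in> borel_measurable M"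
  unfolding trace_def by (intro borel_measurable_sum borel_measurable_matrix_component assms)

section \<open>The equation for psi and the invariant measures to B\<close>

context near_identity
begin

lemma square_integrable_hessian:
  assumes f: "f \<in> H_per 2"
  shows "square_integrable cell (\<lambda>x. hessian f x $ i $ j)"
  using L2_per_square_integrable[OF weak_deriv2(1)[OF f]] by (simp add: hessian_def)

lemma square_integrable_B_hessian:
  assumes f: "f \<in> H_per 2" shows "square_integrable cell (\<lambda>x. B x \<bullet> hessian f x)"
proof -
  have "square_integrable cell (\<lambda>x. B x $ i $ j * hessian f x $ i $ j)" for i j
    using L2_per_square_integrable[OF B_mult_L2_per[OF weak_deriv2(1)[OF f]]] by (simp add: hessian_def)
  then show ?thesis unfolding matrix_inner by (intro square_integrable_sum)
qed

text \<open>The right-hand side is the inner product of B : D^2 phi with 1. Moved to the left, it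
  says that 1 minus the Laplacian of psi is orthogonal to all B : D^2 phi.\<close>

lemma solution_iff:
  assumes p: "\<psi> \<in> H_per0 2"
  shows "(\<forall>\<phi>\<in>H_per0 2. L2_inner (\<lambda>x. B x \<bullet> hessian \<phi> x) (laplacian \<psi>) = cell_integral (\<lambda>x. B x \<bullet> hessian \<phi> x))
    \<longleftrightarrow> adjoint_null (\<lambda>x. 1 - laplacian \<psi> x)"
proof -
  have pH: "\<psi> \<in> H_per 2" using p by (simp add: H_per0_def)
  have w: "(\<lambda>x. 1 - laplacian \<psi> x) \<in> L2_per" by (intro L2_per_diff L2_per_const laplacian_L2_per pH)
  have eq: "L2_inner (\<lambda>x. 1 - laplacian \<psi> x) (\<lambda>x. B x \<bullet> hessian \<phi> x)
      = cell_integral (\<lambda>x. B x \<bullet> hessian \<phi> x) - L2_inner (\<lambda>x. B x \<bullet> hessian \<phi> x) (laplacian \<psi>)"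
    if f: "\<phi> \<in> H_per 2" for \<phi>
  proof -
    have "inner_on cell (\<lambda>x. 1 - laplacian \<psi> x) (\<lambda>x. B x \<bullet> hessian \<phi> x)
        = inner_on cell (\<lambda>x. 1) (\<lambda>x. B x \<bullet> hessian \<phi> x) - inner_on cell (laplacian \<psi>) (\<lambda>x. B x \<bullet> hessian \<phi> x)"
      by (intro inner_on_diff square_integrable_B_hessian f L2_per_square_integrable laplacian_L2_per pH L2_per_const)
    moreover have "inner_on cell (\<lambda>x. 1) (\<lambda>x. B x \<bullet> hessian \<phi> x) = cell_integral (\<lambda>x. B x \<bullet> hessian \<phi> x)"
      by (simp add: inner_on_def cell_integral_eq)
    ultimately show ?thesis by (simp add: L2_inner_eq inner_on_commute[of _ "laplacian \<psi>"])
  qed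
  have H: "\<phi> \<in> H_per 2" if "\<phi> \<in> H_per0 2" for \<phi> :: "real^'n \<Rightarrow> real" using that by (simp add: H_per0_def)
  show ?thesis
  proof
    assume s: "\<forall>\<phi>\<in>H_per0 2. L2_inner (\<lambda>x. B x \<bullet> hessian \<phi> x) (laplacian \<psi>) = cell_integral (\<lambda>x. B x \<bullet> hessian \<phi> x)"
    show "adjoint_null (\<lambda>x. 1 - laplacian \<psi> x)"
      by (rule orthogonal_adjoint_null[OF w]) (use s eq H in auto)
  next
    assume n: "adjoint_null (\<lambda>x. 1 - laplacian \<psi> x)"
    show "\<forall>\<phi>\<in>H_per0 2. L2_inner (\<lambda>x. B x \<bullet> hessian \<phi> x) (laplacian \<psi>) = cell_integral (\<lambda>x. B x \<bullet> hessian \<phi> x)"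
      using adjoint_null_orthogonal[OF w n] eq H by fastforce
  qed
qed

lemma adjoint_null_cong_AE:
  assumes w: "w \<in> L2_per" and v: "v \<in> L2_per" and eq: "AE x in lebesgue. w x = v x" and n: "adjoint_null w"
  shows "adjoint_null v"
proof -
  have "coef (\<lambda>x. B x $ i $ j * w x) k = coef (\<lambda>x. B x $ i $ j * v x) k" for i j k
    unfolding coef_def
  proof (rule inner_on_cong_AE)
    show "AE x in cell. B x $ i $ j * w x = B x $ i $ j * v x"
      using AE_cell[OF eq] by eventually_elim simp
  qed (auto intro: square_integrable_measurable L2_per_square_integrable B_mult_L2_per w v)
  then show ?thesis using n by (simp add: adjoint_null_def)
qed

lemma solution_exists:
  obtains \<psi> where "\<psi> \<in> H_per0 2" "adjoint_null (\<lambda>x. 1 - laplacian \<psi> x)"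
proof -
  obtain w where w: "w \<in> L2_per" "adjoint_null w" "coef w 0 = 1" by (rule adjoint_null_exists)
  let ?g = "\<lambda>x. 1 - w x"
  have g: "?g \<in> L2_per" by (intro L2_per_diff L2_per_const w)
  have "coef ?g 0 = 0"
    using w L2_per_square_integrable[OF L2_per_const] L2_per_square_integrable[OF w(1)]
    by (subst coef_diff) (auto simp: coef_const)
  then obtain \<psi> where p: "\<psi> \<in> H_per0 2" "AE x in lebesgue. laplacian \<psi> x = ?g x"
    by (rule Poisson[OF g])
  have "adjoint_null (\<lambda>x. 1 - laplacian \<psi> x)"
  proof (rule adjoint_null_cong_AE[OF w(1) _ _ w(2)])
    show "(\<lambda>x. 1 - laplacian \<psi> x) \<in> L2_per"
      using p(1) by (intro L2_per_diff L2_per_const laplacian_L2_per) (simp add: H_per0_def)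
    show "AE x in lebesgue. w x = 1 - laplacian \<psi> x" using p(2) by eventually_elim simp
  qed
  with p(1) show thesis by (rule that)
qed

lemma solution_residual:
  assumes p: "\<psi> \<in> H_per0 2"
  shows "(\<lambda>x. 1 - laplacian \<psi> x) \<in> L2_per" "coef (\<lambda>x. 1 - laplacian \<psi> x) 0 = 1"
proof -
  have pH: "\<psi> \<in> H_per 2" using p by (simp add: H_per0_def)
  show "(\<lambda>x. 1 - laplacian \<psi> x) \<in> L2_per" by (intro L2_per_diff L2_per_const laplacian_L2_per pH)
  show "coef (\<lambda>x. 1 - laplacian \<psi> x) 0 = 1"
    using L2_per_square_integrable[OF L2_per_const] L2_per_square_integrable[OF laplacian_L2_per[OF pH]]
    by (subst coef_diff) (auto simp: coef_const coef_laplacian[OF pH])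
qed

text \<open>The residuals are proportional and both have mean 1, so the Laplacians agree. This fixes
  every coefficient except the mean, which is 0 by definition of the space.\<close>

lemma solution_unique:
  assumes p: "\<psi> \<in> H_per0 2" "adjoint_null (\<lambda>x. 1 - laplacian \<psi> x)"
    and q: "\<zeta> \<in> H_per0 2" "adjoint_null (\<lambda>x. 1 - laplacian \<zeta> x)"
  shows "AE x in lebesgue. \<zeta> x = \<psi> x"
proof -
  have pH: "\<psi> \<in> H_per 2" "\<zeta> \<in> H_per 2" using p q by (auto simp: H_per0_def)
  have "AE x in lebesgue. 1 - laplacian \<zeta> x = coef (\<lambda>x. 1 - laplacian \<zeta> x) 0 * (1 - laplacian \<psi> x)"
    using solution_residual p q by (intro adjoint_null_proportional) auto
  then have ae: "AE x in lebesgue. laplacian \<zeta> x = laplacian \<psi> x"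
    unfolding solution_residual(2)[OF q(1)] by eventually_elim simp
  have cl: "coef (laplacian \<zeta>) k = coef (laplacian \<psi>) k" for k
    unfolding coef_def using AE_cell[OF ae] laplacian_L2_per[OF pH(1)] laplacian_L2_per[OF pH(2)]
    by (intro inner_on_cong_AE) (auto intro: square_integrable_measurable L2_per_square_integrable)
  have "coef \<zeta> k = coef \<psi> k" for k
  proof (cases "k = 0")
    case True
    then show ?thesis using p(1) q(1) by (simp add: coef_0 H_per0_def cell_integral_eq)
  next
    case False
    then show ?thesis using cl[of k] by (simp add: coef_laplacian pH)
  qed
  then show ?thesis by (intro coef_eq_imp_AE H_per2_L2_per pH)
qed

text \<open>Let X be the norm of the Laplacian of psi and H its Hessian. Split the Laplacian as (I -
  B) : H + B : H and use the equation with psi as test function. As \<open>Miranda_Talenti\<close>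
  gives H the norm X, this yields X^2 \<le> \<theta> X^2 + K X, where the last term bounds an L1
  norm on a cell of measure 1.\<close>

lemma solution_bound:
  assumes p: "\<psi> \<in> H_per0 2"
    and s: "\<And>\<phi>. \<phi> \<in> H_per0 2 \<Longrightarrow>
      L2_inner (\<lambda>x. B x \<bullet> hessian \<phi> x) (laplacian \<psi>) = cell_integral (\<lambda>x. B x \<bullet> hessian \<phi> x)"
    and K: "AE x in lebesgue. norm (B x) \<le> K"
  shows "norm_on cell (laplacian \<psi>) \<le> K / (1 - \<theta>)"
proof -
  have pH: "\<psi> \<in> H_per 2" using p by (simp add: H_per0_def)
  have "AE x in (lebesgue :: (real^'n) measure). 0 \<le> K"
    using K by eventually_elim (use norm_ge_zero order_trans in blast)
  then have K0: "0 \<le> K" by (rule AE_lebesgue_const)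
  let ?H = "hessian \<psi>" and ?D = "laplacian \<psi>"
  let ?X = "norm_on cell ?D"
  have Hs: "square_integrable cell (\<lambda>x. norm (?H x))"
    by (intro norm_on_matrix_norm square_integrable_hessian pH)
  have Ds: "square_integrable cell ?D" by (rule L2_per_square_integrable[OF laplacian_L2_per[OF pH]])
  have Bs: "square_integrable cell (\<lambda>x. B x \<bullet> ?H x)" by (rule square_integrable_B_hessian[OF pH])
  have "(norm_on cell (\<lambda>x. norm (?H x)))\<^sup>2 = ?X\<^sup>2"
    unfolding norm_on_matrix_norm(2)[OF square_integrable_hessian[OF pH]] Miranda_Talenti[OF pH, symmetric]
    by (simp add: hessian_def)
  then have HX: "norm_on cell (\<lambda>x. norm (?H x)) = ?X"
    by (rule power2_eq_imp_eq) auto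
  have dec: "?D x - B x \<bullet> ?H x = defect x \<bullet> ?H x" for x
    unfolding defect_def inner_diff_left trace_inner[symmetric]
    by (simp add: trace_def hessian_def laplacian_def)
  have ds: "square_integrable cell (\<lambda>x. defect x \<bullet> ?H x)"
    using square_integrable_diff[OF Ds Bs] unfolding dec .
  have "norm_on cell (\<lambda>x. defect x \<bullet> ?H x) \<le> norm_on cell (\<lambda>x. \<theta> * norm (?H x))"
  proof (rule norm_on_mono)
    show "AE x in cell. \<bar>defect x \<bullet> ?H x\<bar> \<le> \<bar>\<theta> * norm (?H x)\<bar>"
      using AE_cell[OF defect_bounded]
    proof eventually_elim
      case (elim x)
      have "\<bar>defect x \<bullet> ?H x\<bar> \<le> norm (defect x) * norm (?H x)" by (rule Cauchy_Schwarz_ineq2)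
      also have "\<dots> \<le> \<theta> * norm (?H x)" using elim by (intro mult_right_mono) auto
      finally show ?case by linarith
    qed
  qed (intro square_integrable_cmult Hs, rule square_integrable_measurable[OF ds])
  then have dn: "norm_on cell (\<lambda>x. defect x \<bullet> ?H x) \<le> \<theta> * ?X"
    using \<theta> HX by (simp add: norm_on_cmult)
  have "?X\<^sup>2 = inner_on cell (\<lambda>x. defect x \<bullet> ?H x + B x \<bullet> ?H x) ?D"
    unfolding norm_on_square dec[symmetric] by simp
  also have "\<dots> = inner_on cell (\<lambda>x. defect x \<bullet> ?H x) ?D + inner_on cell (\<lambda>x. B x \<bullet> ?H x) ?D"
    by (rule inner_on_add[OF ds Bs Ds])
  also have "inner_on cell (\<lambda>x. B x \<bullet> ?H x) ?D = integral\<^sup>L cell (\<lambda>x. B x \<bullet> ?H x)"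
    using s[OF p] by (simp add: L2_inner_eq cell_integral_eq)
  also have "inner_on cell (\<lambda>x. defect x \<bullet> ?H x) ?D \<le> \<theta> * ?X * ?X"
  proof -
    have "inner_on cell (\<lambda>x. defect x \<bullet> ?H x) ?D \<le> norm_on cell (\<lambda>x. defect x \<bullet> ?H x) * ?X"
      using Cauchy_Schwarz_on[OF ds Ds] by linarith
    also have "\<dots> \<le> \<theta> * ?X * ?X" using dn by (intro mult_right_mono) auto
    finally show ?thesis .
  qed
  also have "integral\<^sup>L cell (\<lambda>x. B x \<bullet> ?H x) \<le> K * ?X"
  proof -
    have "integral\<^sup>L cell (\<lambda>x. B x \<bullet> ?H x) \<le> (\<integral>x. K * norm (?H x) \<partial>cell)"
    proof (rule integral_mono_AE)
      show "AE x in cell. B x \<bullet> ?H x \<le> K * norm (?H x)"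
        using AE_cell[OF K]
      proof eventually_elim
        case (elim x)
        have "B x \<bullet> ?H x \<le> norm (B x) * norm (?H x)" by (rule norm_cauchy_schwarz)
        also have "\<dots> \<le> K * norm (?H x)" using elim by (intro mult_right_mono) auto
        finally show ?case .
      qed
    qed (auto intro: cell.square_integrable_integrable Bs Hs)
    also have "\<dots> = K * (\<integral>x. \<bar>norm (?H x)\<bar> \<partial>cell)" by simp
    also have "\<dots> \<le> K * ?X"
      using cell.norm_on_L1_bound[OF Hs] HX K0 by (intro mult_left_mono) auto
    finally show ?thesis .
  qed
  finally have main: "?X\<^sup>2 \<le> \<theta> * ?X * ?X + K * ?X" by simp
  show ?thesis
  proof (cases "?X = 0")
    case True
    then show ?thesis using K0 \<theta> by simp
  next
    case False
    then have X: "?X > 0" using norm_on_nonneg[of cell ?D] by linarith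
    have "?X * ((1 - \<theta>) * ?X) \<le> ?X * K" using main by (simp add: power2_eq_square algebra_simps)
    then have "(1 - \<theta>) * ?X \<le> K" using X by simp
    then show ?thesis using \<theta> by (simp add: pos_le_divide_eq mult.commute)
  qed
qed

text \<open>Invariance is tested on all of H^2, which includes the mean-zero functions that already
  force \<open>adjoint_null\<close>; conversely \<open>adjoint_null\<close> gives orthogonality for
  every Hessian in H^2.\<close>

lemma invariant_measure_iff:
  assumes e: "\<exists>l>0. \<exists>L>0. B \<in> elliptic l L"
  shows "invariant_measure B r \<longleftrightarrow> r \<in> L2_per \<and> coef r 0 = 1 \<and> adjoint_null r"
proof -
  have m: "L2_inner r (\<lambda>x. (- B x) \<bullet> hessian \<phi> x) = - L2_inner r (\<lambda>x. B x \<bullet> hessian \<phi> x)" for \<phi>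
    by (simp add: L2_inner_eq inner_on_def)
  have H: "\<phi> \<in> H_per 2" if "\<phi> \<in> H_per0 2" for \<phi> :: "real^'n \<Rightarrow> real" using that by (simp add: H_per0_def)
  show ?thesis
    unfolding invariant_measure_def m
    using e adjoint_null_orthogonal[of r] orthogonal_adjoint_null[of r] H
    by (auto simp: coef_0 cell_integral_eq)
qed

end

lemma Linf_mult_L2_per:
  assumes g: "g \<in> borel_measurable lebesgue" "ae_periodic g" "AE x in lebesgue. \<bar>g x\<bar> \<le> C" and f: "f \<in> L2_per"
  shows "(\<lambda>x. g x * f x) \<in> L2_per"
  unfolding L2_per_iff
proof (intro conjI)
  show "(\<lambda>x. g x * f x) \<in> borel_measurable lebesgue" using g f by (auto simp: L2_per_iff)
  show "ae_periodic (\<lambda>x. g x * f x)"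
    using g f by (intro ae_periodic_compose2[where h="(*)"]) (auto simp: L2_per_iff)
  show "square_integrable cell (\<lambda>x. g x * f x)"
    by (intro square_integrable_bounded_mult[where C=C] L2_per_square_integrable f measurable_cell g AE_cell)
qed

theorem theorem3p1:
  fixes A :: "real^'n \<Rightarrow> real^'n^'n" and l L \<delta> :: real
  assumes "l > 0" and "L > 0" and "A \<in> elliptic l L"
    and "0 < \<delta>" and "\<delta> \<le> 1" and "cordes \<delta> A"
  shows "let n = real CARD('n);
             \<gamma> = cordes_gamma A;
             A' = (\<lambda>x. \<gamma> x *\<^sub>R A x);
             C = 1 / (1 - sqrt (1 - \<delta>));
             is_sol = (\<lambda>\<psi>. \<psi> \<in> H_per0 2 \<and>
               (\<forall>\<phi>\<in>H_per0 2. cordes_form A \<phi> \<psi> = cell_integral (\<lambda>x. A' x \<bullet> hessian \<phi> x)))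
         in \<gamma> \<in> Linf_per \<and>
            (\<exists>\<psi>. unique_ae is_sol \<psi>) \<and>
            (\<forall>\<psi>. is_sol \<psi> \<longrightarrow>
               L2_norm (laplacian \<psi>) \<le> sqrt n * (L / l) * C \<and>
               (let r' = (\<lambda>x. 1 - laplacian \<psi> x);
                    r = (\<lambda>x. inverse (L2_inner \<gamma> r') * (\<gamma> x * r' x))
                in r' \<in> L2_per \<and>
                   unique_ae (invariant_measure A') r' \<and>
                   (AE x in lebesgue. r' x \<ge> 0) \<and>
                   r \<in> L2_per \<and>
                   unique_ae (invariant_measure A) r \<and>
                   (AE x in lebesgue. r x \<ge> 0) \<and>
                   L2_norm r \<le> L ^ 3 / l ^ 3 * L2_norm r' \<and>
                   L ^ 3 / l ^ 3 * L2_norm r' \<le> L ^ 3 / l ^ 3 * (sqrt n * (L / l) * C + 1)))"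
proof -
  note l = assms(1) and L = assms(2)
  define \<gamma> where "\<gamma> = cordes_gamma A"
  define B where "B = (\<lambda>x. \<gamma> x *\<^sub>R A x)"
  define \<theta> where "\<theta> = sqrt (1 - \<delta>)"
  have ell: "AE x in lebesgue. elliptic_at l L (A x)" and AL: "A \<in> Linf_per"
    using assms(3) by (auto simp: elliptic_iff)
  have Am: "A \<in> borel_measurable lebesgue" and Ap: "ae_periodic A"
    using AL by (auto simp: Linf_per_def)
  have \<gamma>_eq: "\<gamma> x = trace (A x) / (norm (A x))\<^sup>2" for x by (simp add: \<gamma>_def cordes_gamma_def)
  have gb: "AE x in lebesgue. l / L\<^sup>2 \<le> \<gamma> x \<and> \<gamma> x \<le> L / l\<^sup>2"
    using ell by eventually_elim (auto simp: \<gamma>_eq intro: elliptic_at_gamma[OF l L])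
  have lL: "l \<le> L"
  proof -
    have "AE x in (lebesgue :: (real^'n) measure). l \<le> L"
      using ell by eventually_elim (rule elliptic_at_le[OF l L])
    then show ?thesis by (rule AE_lebesgue_const)
  qed
  have low: "0 < l / L\<^sup>2" using l L by simp
  have gm: "\<gamma> \<in> borel_measurable lebesgue"
    unfolding \<gamma>_def cordes_gamma_def[abs_def]
    using borel_measurable_trace[OF Am] Am by measurable
  have gp: "ae_periodic \<gamma>"
    unfolding \<gamma>_def cordes_gamma_def[abs_def] using Ap by (rule ae_periodic_compose)
  have gabs: "AE x in lebesgue. \<bar>\<gamma> x\<bar> \<le> L / l\<^sup>2"
    using gb by eventually_elim (use low in linarith)
  have gLinf: "\<gamma> \<in> Linf_per"
    using gm gp gabs by (auto simp: Linf_per_def)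
  have Bm: "B \<in> borel_measurable lebesgue" unfolding B_def using gm Am by measurable
  have Bp: "ae_periodic B" unfolding B_def using gp Ap by (rule ae_periodic_compose2)
  have th: "0 \<le> \<theta>" "\<theta> < 1" using assms(4,5) by (auto simp: \<theta>_def)
  have near: "AE x in lebesgue. norm (mat 1 - B x) \<le> \<theta>"
    using ell assms(6)[unfolded cordes_def]
    by eventually_elim (auto simp: B_def \<gamma>_eq \<theta>_def intro: cordes_at[OF l L] assms(4))
  interpret near_identity B \<theta>
    by standard (fact Bm Bp near th)+
  have Bn: "AE x in lebesgue. norm (B x) \<le> sqrt (real CARD('n))"
    using ell by eventually_elim (simp add: B_def \<gamma>_eq elliptic_at_normalized_norm[OF l L] del: norm_scaleR)
  have Bell: "B \<in> elliptic (l\<^sup>2 / L\<^sup>2) (L\<^sup>2 / l\<^sup>2)"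
    unfolding elliptic_iff Linf_per_def
  proof (intro conjI CollectI Bm Bp exI)
    show "AE x in lebesgue. norm (B x) \<le> sqrt (real CARD('n))" by (rule Bn)
    show "AE x in lebesgue. elliptic_at (l\<^sup>2 / L\<^sup>2) (L\<^sup>2 / l\<^sup>2) (B x)"
      using ell by eventually_elim (simp add: B_def \<gamma>_eq elliptic_at_normalized[OF l L])
  qed
  have Bell': "\<exists>l>0. \<exists>L>0. B \<in> elliptic l L"
    by (rule exI[of _ "l\<^sup>2 / L\<^sup>2"], rule conjI, use l L in simp, rule exI[of _ "L\<^sup>2 / l\<^sup>2"])
       (use l L Bell in simp)
  note inv_iff = invariant_measure_iff[OF Bell']
  define sol where "sol \<psi> \<longleftrightarrow> \<psi> \<in> H_per0 2 \<and>
    (\<forall>\<phi>\<in>H_per0 2. cordes_form A \<phi> \<psi> = cell_integral (\<lambda>x. B x \<bullet> hessian \<phi> x))" for \<psi>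
  have sol_iff: "sol \<psi> \<longleftrightarrow> \<psi> \<in> H_per0 2 \<and> adjoint_null (\<lambda>x. 1 - laplacian \<psi> x)" for \<psi>
    unfolding sol_def cordes_form_def \<gamma>_def[symmetric] B_def[symmetric, THEN fun_cong]
    using solution_iff[of \<psi>] by blast
  have ex: "\<exists>\<psi>. unique_ae sol \<psi>"
  proof -
    obtain \<psi> where p: "\<psi> \<in> H_per0 2" "adjoint_null (\<lambda>x. 1 - laplacian \<psi> x)" by (rule solution_exists)
    then show ?thesis
      unfolding unique_ae_def sol_iff using solution_unique[OF p] by blast
  qed
  let ?K = "sqrt (real CARD('n)) * (L / l) * (1 / (1 - \<theta>))"
  have main: "L2_norm (laplacian \<psi>) \<le> ?K \<and> r' \<in> L2_per \<and> unique_ae (invariant_measure B) r' \<and>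
      (AE x in lebesgue. r' x \<ge> 0) \<and> r \<in> L2_per \<and> unique_ae (invariant_measure A) r \<and>
      (AE x in lebesgue. r x \<ge> 0) \<and> L2_norm r \<le> L ^ 3 / l ^ 3 * L2_norm r' \<and>
      L ^ 3 / l ^ 3 * L2_norm r' \<le> L ^ 3 / l ^ 3 * (?K + 1)"
    if s: "sol \<psi>" and r'_def: "r' = (\<lambda>x. 1 - laplacian \<psi> x)"
      and r_def: "r = (\<lambda>x. inverse (L2_inner \<gamma> r') * (\<gamma> x * r' x))" for \<psi> r' r
  proof -
    have p: "\<psi> \<in> H_per0 2" and n: "adjoint_null r'" using s by (auto simp: sol_iff r'_def)
    have pH: "\<psi> \<in> H_per 2" using p by (simp add: H_per0_def)
    have r'L: "r' \<in> L2_per" and r'1: "coef r' 0 = 1"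
      unfolding r'_def using solution_residual[OF p] by auto
    have r's: "square_integrable cell r'" by (rule L2_per_square_integrable[OF r'L])
    have bound: "norm_on cell (laplacian \<psi>) \<le> sqrt (real CARD('n)) / (1 - \<theta>)"
      using s[unfolded sol_def cordes_form_def \<gamma>_def[symmetric] B_def[symmetric, THEN fun_cong]]
      by (intro solution_bound[OF p _ Bn]) blast
    \<comment> \<open>The factor L / l of the claimed bound enters here, through l \<le> L.\<close>
    also have "\<dots> \<le> ?K"
    proof -
      have "1 \<le> L / l" using lL l by simp
      then have "sqrt (real CARD('n)) * 1 * (1 / (1 - \<theta>)) \<le> ?K"
        using th by (intro mult_right_mono mult_left_mono) auto
      then show ?thesis by simp
    qed
    finally have b1: "norm_on cell (laplacian \<psi>) \<le> ?K" .
    have u': "unique_ae (invariant_measure B) r'"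
      unfolding unique_ae_def inv_iff
    proof (intro conjI allI impI r'L r'1 n)
      fix g assume g: "g \<in> L2_per \<and> coef g 0 = 1 \<and> adjoint_null g"
      then have "AE x in lebesgue. g x = coef g 0 * r' x"
        by (intro adjoint_null_proportional r'L n r'1) auto
      then show "AE x in lebesgue. g x = r' x" using g by simp
    qed
    have r'0: "AE x in lebesgue. r' x \<ge> 0" by (rule adjoint_null_nonneg[OF r'L n r'1])
    let ?I = "L2_inner \<gamma> r'"
    have gr: "(\<lambda>x. \<gamma> x * r' x) \<in> L2_per" by (rule Linf_mult_L2_per[OF gm gp gabs r'L])
    \<comment> \<open>Since r' is nonnegative with mean 1, the pointwise lower bound of
      \<open>\<gamma>\<close> passes to the normalizing constant.\<close>
    have I: "l / L\<^sup>2 \<le> ?I"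
    proof -
      have "(\<integral>x. l / L\<^sup>2 * r' x \<partial>cell) \<le> (\<integral>x. \<gamma> x * r' x \<partial>cell)"
      proof (rule integral_mono_AE)
        show "AE x in cell. l / L\<^sup>2 * r' x \<le> \<gamma> x * r' x"
          using AE_cell[OF gb] AE_cell[OF r'0] by eventually_elim (intro mult_right_mono; simp)
        show "integrable cell (\<lambda>x. l / L\<^sup>2 * r' x)"
          by (rule cell.square_integrable_integrable[OF square_integrable_cmult[OF r's]])
        show "integrable cell (\<lambda>x. \<gamma> x * r' x)"
          by (rule cell.square_integrable_integrable[OF L2_per_square_integrable[OF gr]])
      qed
      then show ?thesis using r'1 by (simp add: L2_inner_eq inner_on_def coef_0)
    qed
    then have Ipos: "?I > 0" using low by linarith
    have c: "0 < inverse ?I" "inverse ?I \<le> L\<^sup>2 / l"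
      using Ipos le_imp_inverse_le[OF I low] by auto
    have rL: "r \<in> L2_per" unfolding r_def by (rule L2_per_cmult[OF gr])
    have r1: "cell_integral r = 1"
      using Ipos by (simp add: r_def cell_integral_eq L2_inner_eq inner_on_def)
    have "L2_inner r (\<lambda>x. (- A x) \<bullet> hessian \<phi> x) = 0" if "\<phi> \<in> H_per 2" for \<phi>
    proof -
      \<comment> \<open>The factor \<open>\<gamma>\<close> moves from the measure to the matrix,
        turning r A into a constant multiple of r' B.\<close>
      have "(\<lambda>x. r x * ((- A x) \<bullet> hessian \<phi> x)) = (\<lambda>x. - inverse ?I * (r' x * (B x \<bullet> hessian \<phi> x)))"
        by (simp add: r_def B_def mult_ac)
      then have "L2_inner r (\<lambda>x. (- A x) \<bullet> hessian \<phi> x) = - inverse ?I * L2_inner r' (\<lambda>x. B x \<bullet> hessian \<phi> x)"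
        unfolding L2_inner_def cell_integral_eq by simp
      then show ?thesis using adjoint_null_orthogonal[OF r'L n that] by simp
    qed
    then have rinv: "invariant_measure A r"
      unfolding invariant_measure_def using assms(1-3) rL r1 by blast
    have u: "unique_ae (invariant_measure A) r"
      unfolding unique_ae_def
    proof (intro conjI allI impI rinv)
      fix g assume g: "invariant_measure A g"
      then have gL: "g \<in> L2_per" and g1: "cell_integral g = 1"
        and go: "\<And>\<phi>. \<phi> \<in> H_per 2 \<Longrightarrow> L2_inner g (\<lambda>x. (- A x) \<bullet> hessian \<phi> x) = 0"
        by (auto simp: invariant_measure_def)
      \<comment> \<open>Dividing by \<open>\<gamma>\<close> turns an invariant measure to A into a
        solution of the adjoint equation for B, which is unique up to a factor. As
        \<open>\<gamma>\<close> is bounded away from 0, the quotient stays in L2.\<close>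
      define w where "w x = inverse (\<gamma> x) * g x" for x
      have ib: "AE x in lebesgue. \<bar>inverse (\<gamma> x)\<bar> \<le> L\<^sup>2 / l"
        using gb
      proof eventually_elim
        case (elim x)
        then have "\<gamma> x > 0" using low by linarith
        then show ?case using le_imp_inverse_le[of "l / L\<^sup>2" "\<gamma> x"] elim low by auto
      qed
      have wL: "w \<in> L2_per"
        unfolding w_def[abs_def]
        using gm gp by (intro Linf_mult_L2_per[OF _ _ ib gL] borel_measurable_inverse
            ae_periodic_compose[where h=inverse]) auto
      have gw: "AE x in lebesgue. g x = \<gamma> x * w x"
        using gb by eventually_elim (use low in \<open>auto simp: w_def field_simps\<close>)
      have "adjoint_null w"
      proof (rule orthogonal_adjoint_null[OF wL])
        fix \<phi> :: "real^'n \<Rightarrow> real" assume "\<phi> \<in> H_per0 2"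
        then have f: "\<phi> \<in> H_per 2" by (simp add: H_per0_def)
        have m: "(\<lambda>x. w x * (B x \<bullet> hessian \<phi> x)) \<in> borel_measurable cell"
          by (intro borel_measurable_times square_integrable_measurable L2_per_square_integrable wL
              square_integrable_B_hessian f)
        have "(\<lambda>x. A x \<bullet> hessian \<phi> x) \<in> borel_measurable cell"
          unfolding matrix_inner
          by (intro borel_measurable_sum borel_measurable_times borel_measurable_matrix_component
              measurable_cell Am square_integrable_measurable square_integrable_hessian f)
        then have m': "(\<lambda>x. g x * (A x \<bullet> hessian \<phi> x)) \<in> borel_measurable cell"
          by (intro borel_measurable_times square_integrable_measurable[OF L2_per_square_integrable[OF gL]])
        have "L2_inner w (\<lambda>x. B x \<bullet> hessian \<phi> x) = (\<integral>x. g x * (A x \<bullet> hessian \<phi> x) \<partial>cell)"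
          unfolding L2_inner_def cell_integral_eq
        proof (rule integral_cong_AE[OF m m'])
          show "AE x in cell. w x * (B x \<bullet> hessian \<phi> x) = g x * (A x \<bullet> hessian \<phi> x)"
            using AE_cell[OF gw] by eventually_elim (simp add: B_def)
        qed
        also have "\<dots> = - L2_inner g (\<lambda>x. (- A x) \<bullet> hessian \<phi> x)"
          by (simp add: L2_inner_def cell_integral_eq)
        finally show "L2_inner w (\<lambda>x. B x \<bullet> hessian \<phi> x) = 0" using go[OF f] by simp
      qed
      then have "AE x in lebesgue. w x = coef w 0 * r' x"
        by (intro adjoint_null_proportional wL r'L n r'1)
      with gw have ge: "AE x in lebesgue. g x = coef w 0 * (\<gamma> x * r' x)"
        by eventually_elim simp
      \<comment> \<open>The normalization of \<open>g\<close> determines the remaining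
        factor.\<close>
      have "1 = integral\<^sup>L cell g" using g1 by (simp add: cell_integral_eq)
      also have "\<dots> = (\<integral>x. coef w 0 * (\<gamma> x * r' x) \<partial>cell)"
        using AE_cell[OF ge]
        by (intro integral_cong_AE square_integrable_measurable L2_per_square_integrable gL L2_per_cmult gr)
      also have "\<dots> = coef w 0 * ?I" by (simp add: L2_inner_eq inner_on_def)
      finally have "coef w 0 = inverse ?I" using Ipos by (simp add: field_simps)
      then show "AE x in lebesgue. g x = r x" using ge by (simp add: r_def)
    qed
    have r0: "AE x in lebesgue. r x \<ge> 0"
      using r'0 gb by eventually_elim (use c low in \<open>auto simp: r_def intro!: mult_nonneg_nonneg\<close>)
    \<comment> \<open>The constant is a product: L^2 / l bounds the inverse of the normalizing
      constant, and L / l^2 bounds \<open>\<gamma>\<close>.\<close>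
    have nr: "norm_on cell r \<le> L ^ 3 / l ^ 3 * norm_on cell r'"
    proof -
      have "norm_on cell r \<le> norm_on cell (\<lambda>x. (L ^ 3 / l ^ 3) * r' x)"
      proof (rule norm_on_mono)
        show "square_integrable cell (\<lambda>x. (L ^ 3 / l ^ 3) * r' x)" by (rule square_integrable_cmult[OF r's])
        show "r \<in> borel_measurable cell"
          by (intro square_integrable_measurable L2_per_square_integrable rL)
        show "AE x in cell. \<bar>r x\<bar> \<le> \<bar>(L ^ 3 / l ^ 3) * r' x\<bar>"
          using AE_cell[OF gabs]
        proof eventually_elim
          case (elim x)
          have "\<bar>r x\<bar> = inverse ?I * \<bar>\<gamma> x\<bar> * \<bar>r' x\<bar>" using c by (simp add: r_def abs_mult)
          also have "\<dots> \<le> (L\<^sup>2 / l) * (L / l\<^sup>2) * \<bar>r' x\<bar>"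
            using c elim l L by (intro mult_right_mono mult_mono) auto
          also have "(L\<^sup>2 / l) * (L / l\<^sup>2) = L ^ 3 / l ^ 3" by (simp add: power2_eq_square power3_eq_cube)
          finally show ?case using l L by (simp add: abs_mult)
        qed
      qed
      moreover have "0 \<le> L ^ 3 / l ^ 3" using l L by simp
      ultimately show ?thesis by (simp only: norm_on_cmult abs_of_nonneg)
    qed
    have nr': "norm_on cell r' \<le> ?K + 1"
    proof -
      have o: "square_integrable cell (\<lambda>x::real^'n. 1)" by (rule L2_per_square_integrable[OF L2_per_const])
      have d: "square_integrable cell (\<lambda>x. (-1) * laplacian \<psi> x)"
        by (intro square_integrable_cmult L2_per_square_integrable laplacian_L2_per pH)
      have "norm_on cell r' \<le> norm_on cell (\<lambda>x::real^'n. 1) + norm_on cell (\<lambda>x. (-1) * laplacian \<psi> x)"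
        using norm_on_triangle[OF o d] by (simp add: r'_def)
      also have "\<dots> = 1 + norm_on cell (laplacian \<psi>)"
        unfolding norm_on_cmult norm_on_const by simp
      finally show ?thesis using b1 by simp
    qed
    have "L ^ 3 / l ^ 3 * norm_on cell r' \<le> L ^ 3 / l ^ 3 * (?K + 1)"
      using l L by (intro mult_left_mono nr') auto
    then show ?thesis
      unfolding L2_norm_eq using b1 r'L u' r'0 rL u r0 nr by blast
  qed
  have "\<gamma> \<in> Linf_per \<and> (\<exists>\<psi>. unique_ae sol \<psi>) \<and>
    (\<forall>\<psi>. sol \<psi> \<longrightarrow> L2_norm (laplacian \<psi>) \<le> ?K \<and>
      (let r' = (\<lambda>x. 1 - laplacian \<psi> x); r = (\<lambda>x. inverse (L2_inner \<gamma> r') * (\<gamma> x * r' x))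
       in r' \<in> L2_per \<and> unique_ae (invariant_measure B) r' \<and> (AE x in lebesgue. r' x \<ge> 0) \<and>
          r \<in> L2_per \<and> unique_ae (invariant_measure A) r \<and> (AE x in lebesgue. r x \<ge> 0) \<and>
          L2_norm r \<le> L ^ 3 / l ^ 3 * L2_norm r' \<and>
          L ^ 3 / l ^ 3 * L2_norm r' \<le> L ^ 3 / l ^ 3 * (?K + 1)))"
    unfolding Let_def using gLinf ex main[OF _ refl refl] by blast
  then show ?thesis
    unfolding Let_def sol_def[abs_def] B_def \<gamma>_def \<theta>_def .
qed

end
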